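(* Let $p,q,r \geq 2$ be integers, and let $\Delta^+(p, q, r)$ be the index $2$ subgroup of the triangle group $\Delta(p,q,r)$ consisting of its orientation preserving elements, that is, \[ \Delta^+(p, q, r) = \langle a, b, c \mid a^p = b^q = c^r = abc = 1 \rangle. \] Define a group automorphism $\sigma\colon \Delta^+(p, q, r) \to \Delta^+(p, q, r)$ by $\sigma(g) := a^{-1} g a$. Then the generalized Alexander quandle $X := \mathrm{GAlex}(\Delta^+(p, q, r), \sigma)$ satisfies the following: (1) The displacement group $\mathrm{Dis}(X)$ is isomorphic to a finite index subgroup of $\Delta^+(p,q,r)$. (2) If $\frac{1}{p} + \frac{1}{q} + \frac{1}{r} > 1$, then the quandle $X$ is finite. (3) If $\frac{1}{p} + \frac{1}{q} + \frac{1}{r} = 1$, then a connected component of $X$ with a displacement metric is quasi-isometric to the Euclidean plane. (4) If $\frac{1}{p} + \frac{1}{q} + \frac{1}{r} < 1$, then a connected component of $X$ with a displacement metric is quasi-isometric to the $2$-dimensional hyperbolic space. In (3) and (4), the connected component is arbitrary and the displacement metric is $d^{\mathrm{Dis}}_U$ for any finite generating set $U$ of $\mathrm{Dis}(X)$.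
   Context: A quandle is a non-empty set $X$ with a binary operation $\triangleleft$ such that (i) $x \triangleleft x = x$ for all $x$; (ii) for every $y \in X$ the map $s_y \colon X \to X$, $s_y(x) = x \triangleleft y$, is a bijection (the point symmetry at $y$); (iii) $(x \triangleleft y)\triangleleft z = (x \triangleleft z)\triangleleft (y \triangleleft z)$ for all $x,y,z$. $\mathrm{Aut}(X)$ is the group of bijective quandle homomorphisms $X\to X$ with product $fg := g \circ f$; it acts on $X$ from the right by $x\cdot f := f(x)$. $\mathrm{Inn}(X)$ is the subgroup of $\mathrm{Aut}(X)$ generated by $\{s_y \mid y \in X\}$, and the displacement group $\mathrm{Dis}(X)$ is the subgroup generated by $\{s_x s_y^{-1} \mid x,y\in X\}$. A connected component of $X$ is an orbit of $\mathrm{Inn}(X)$; the orbits of $\mathrm{Dis}(X)$ on $X$ are the same sets. For a group $G$ and an automorphism $\sigma$ of $G$, the generalized Alexander quandle $\mathrm{GAlex}(G,\sigma)$ is the set $G$ with the operation $x \triangleleft y := \sigma(xy^{-1})y$. For a generating set $U$ of $\mathrm{Dis}(X)$, consider the undirected graph with vertex set $X$ in which $x,y$ are joined by an edge if $y = x\cdot u$ for some $u \in U\cup U^{-1}$. Its connected components are the connected components of $X$; the displacement metric $d^{\mathrm{Dis}}_U$ on a connected component is the path metric of this graph (edges have length one). *)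

theory Defs
  imports "HOL-Analysis.Analysis" "HOL-Algebra.Bij" "HOL-Algebra.Elementary_Groups"
begin

section \<open>Quandles\<close>

record 'a quandle = "'a partial_object" +
  qop :: "'a \<Rightarrow> 'a \<Rightarrow> 'a"  (infixl \<open>\<triangleleft>\<index>\<close> 70)

locale quandle =
  fixes Q :: "('a, 'm) quandle_scheme" (structure)
  assumes nonempty: "carrier Q \<noteq> {}"
    and idem: "x \<in> carrier Q \<Longrightarrow> x \<triangleleft> x = x"
    and bij: "y \<in> carrier Q \<Longrightarrow> bij_betw (\<lambda>x. x \<triangleleft> y) (carrier Q) (carrier Q)"
    and distrib: "\<lbrakk>x \<in> carrier Q; y \<in> carrier Q; z \<in> carrier Q\<rbrakk> \<Longrightarrow>
       (x \<triangleleft> y) \<triangleleft> z = (x \<triangleleft> z) \<triangleleft> (y \<triangleleft> z)"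

definition point_sym :: "('a, 'm) quandle_scheme \<Rightarrow> 'a \<Rightarrow> 'a \<Rightarrow> 'a" where
  "point_sym Q y = (\<lambda>x\<in>carrier Q. x \<triangleleft>\<^bsub>Q\<^esub> y)"

text \<open>Automorphisms are taken extensional, so that equality of automorphisms is equality of
  functions. The group acts from the right: the product \<open>f g\<close> is ``first \<open>f\<close>, then \<open>g\<close>''.\<close>

definition quandle_aut :: "('a, 'm) quandle_scheme \<Rightarrow> ('a \<Rightarrow> 'a) monoid" where
  "quandle_aut Q =
    \<lparr>carrier = {f \<in> Bij (carrier Q). \<forall>x\<in>carrier Q. \<forall>y\<in>carrier Q. f (x \<triangleleft>\<^bsub>Q\<^esub> y) = f x \<triangleleft>\<^bsub>Q\<^esub> f y},
     monoid.mult = (\<lambda>f g. compose (carrier Q) g f),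
     one = (\<lambda>x\<in>carrier Q. x)\<rparr>"

lemma (in quandle) qop_closed: "x \<in> carrier Q \<Longrightarrow> y \<in> carrier Q \<Longrightarrow> x \<triangleleft> y \<in> carrier Q"
  using bij_betw_apply[OF bij] by blast

lemma (in quandle) group_quandle_aut: "group (quandle_aut Q)"
proof (rule groupI)
  fix f g h
  assume f: "f \<in> carrier (quandle_aut Q)" and g: "g \<in> carrier (quandle_aut Q)"
    and h: "h \<in> carrier (quandle_aut Q)"
  show "f \<otimes>\<^bsub>quandle_aut Q\<^esub> g \<in> carrier (quandle_aut Q)"
  proof -
    have "f x \<in> carrier Q" if "x \<in> carrier Q" for x
      using that f Bij_imp_funcset by (fastforce simp: quandle_aut_def)
    then show ?thesis
      using f g by (simp add: quandle_aut_def compose_Bij compose_eq qop_closed)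
  qed
  show "f \<otimes>\<^bsub>quandle_aut Q\<^esub> g \<otimes>\<^bsub>quandle_aut Q\<^esub> h = f \<otimes>\<^bsub>quandle_aut Q\<^esub> (g \<otimes>\<^bsub>quandle_aut Q\<^esub> h)"
    using f by (simp add: quandle_aut_def compose_assoc Bij_imp_funcset)
next
  show "\<one>\<^bsub>quandle_aut Q\<^esub> \<in> carrier (quandle_aut Q)"
    by (auto simp: quandle_aut_def id_Bij qop_closed)
next
  fix f assume "f \<in> carrier (quandle_aut Q)"
  then have f: "f \<in> Bij (carrier Q)"
    and hom: "\<And>x y. x \<in> carrier Q \<Longrightarrow> y \<in> carrier Q \<Longrightarrow> f (x \<triangleleft> y) = f x \<triangleleft> f y"
    by (auto simp: quandle_aut_def)
  show "\<one>\<^bsub>quandle_aut Q\<^esub> \<otimes>\<^bsub>quandle_aut Q\<^esub> f = f"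
    using f by (simp add: quandle_aut_def compose_def Bij_def extensional_def fun_eq_iff)
  define f' where "f' = (\<lambda>x\<in>carrier Q. inv_into (carrier Q) f x)"
  have bf: "bij_betw f (carrier Q) (carrier Q)"
    using f by (simp add: Bij_def)
  have "f' (x \<triangleleft> y) = f' x \<triangleleft> f' y" if xy: "x \<in> carrier Q" "y \<in> carrier Q" for x y
  proof -
    have c: "f' x \<in> carrier Q" "f' y \<in> carrier Q"
      using f xy by (auto simp: f'_def Bij_inv_into_mem)
    have "f (f' x \<triangleleft> f' y) = x \<triangleleft> y"
      using hom[OF c] xy bf by (simp add: f'_def bij_betw_inv_into_right)
    then have "inv_into (carrier Q) f (x \<triangleleft> y) = f' x \<triangleleft> f' y"
      using bij_betw_inv_into_left[OF bf qop_closed[OF c]] by simp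
    then show ?thesis
      using xy by (simp add: f'_def qop_closed)
  qed
  then have "f' \<in> carrier (quandle_aut Q)"
    using restrict_inv_into_Bij[OF f] by (simp add: quandle_aut_def f'_def)
  moreover have "f' \<otimes>\<^bsub>quandle_aut Q\<^esub> f = \<one>\<^bsub>quandle_aut Q\<^esub>"
    using bf by (auto simp: quandle_aut_def f'_def compose_def bij_betw_inv_into_right
        Bij_inv_into_mem[OF f])
  ultimately show "\<exists>f'\<in>carrier (quandle_aut Q). f' \<otimes>\<^bsub>quandle_aut Q\<^esub> f = \<one>\<^bsub>quandle_aut Q\<^esub>"
    by blast
qed

lemma (in quandle) point_sym_in_aut:
  assumes "y \<in> carrier Q"
  shows "point_sym Q y \<in> carrier (quandle_aut Q)"
proof -
  have "point_sym Q y \<in> Bij (carrier Q)"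
    unfolding Bij_def point_sym_def using bij[OF assms] by simp
  moreover have "point_sym Q y (x \<triangleleft> z) = point_sym Q y x \<triangleleft> point_sym Q y z"
    if "x \<in> carrier Q" "z \<in> carrier Q" for x z
    using that distrib[OF that assms] by (simp add: point_sym_def qop_closed)
  ultimately show ?thesis
    by (simp add: quandle_aut_def)
qed

definition Inn :: "('a, 'm) quandle_scheme \<Rightarrow> ('a \<Rightarrow> 'a) monoid" where
  "Inn Q = subgroup_generated (quandle_aut Q) (point_sym Q ` carrier Q)"

definition Dis :: "('a, 'm) quandle_scheme \<Rightarrow> ('a \<Rightarrow> 'a) monoid" where
  "Dis Q = subgroup_generated (quandle_aut Q)
     {point_sym Q x \<otimes>\<^bsub>quandle_aut Q\<^esub> inv\<^bsub>quandle_aut Q\<^esub> point_sym Q y |x y.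
        x \<in> carrier Q \<and> y \<in> carrier Q}"

definition quandle_components :: "('a, 'm) quandle_scheme \<Rightarrow> 'a set set" where
  "quandle_components Q = {{f x |f. f \<in> carrier (Inn Q)} |x. x \<in> carrier Q}"

definition dis_edges :: "('a, 'm) quandle_scheme \<Rightarrow> ('a \<Rightarrow> 'a) set \<Rightarrow> ('a \<times> 'a) set" where
  "dis_edges Q U = {(x, y). x \<in> carrier Q \<and> y \<in> carrier Q \<and>
     (\<exists>u \<in> U \<union> m_inv (Dis Q) ` U. y = u x)}"

text \<open>The path metric; only meaningful for two points of the same connected component
  (otherwise no path exists and \<open>LEAST\<close> is unspecified).\<close>

definition dis_metric :: "('a, 'm) quandle_scheme \<Rightarrow> ('a \<Rightarrow> 'a) set \<Rightarrow> 'a \<Rightarrow> 'a \<Rightarrow> real" where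
  "dis_metric Q U x y = real (LEAST n. (x, y) \<in> dis_edges Q U ^^ n)"

definition GAlex :: "('a, 'm) monoid_scheme \<Rightarrow> ('a \<Rightarrow> 'a) \<Rightarrow> 'a quandle" where
  "GAlex G \<sigma> = \<lparr>carrier = carrier G, qop = (\<lambda>x y. \<sigma> (x \<otimes>\<^bsub>G\<^esub> inv\<^bsub>G\<^esub> y) \<otimes>\<^bsub>G\<^esub> y)\<rparr>"

lemma (in group) quandle_GAlex:
  assumes "\<sigma> \<in> iso G G"
  shows "quandle (GAlex G \<sigma>)"
proof -
  have bij: "bij_betw \<sigma> (carrier G) (carrier G)" and hom: "\<sigma> \<in> hom G G"
    using assms by (auto simp: iso_def)
  interpret s: group_hom G G \<sigma>
    using hom by unfold_locales
  have bij_r: "bij_betw (\<lambda>x. x \<otimes> z) (carrier G) (carrier G)" if "z \<in> carrier G" for z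
    by (rule bij_betw_byWitness[where f' = "\<lambda>x. x \<otimes> inv z"]) (use that in \<open>auto simp: m_assoc\<close>)
  show ?thesis
  proof
    show "carrier (GAlex G \<sigma>) \<noteq> {}"
      by (auto simp: GAlex_def)
  next
    fix x assume "x \<in> carrier (GAlex G \<sigma>)"
    then show "x \<triangleleft>\<^bsub>GAlex G \<sigma>\<^esub> x = x"
      by (simp add: GAlex_def)
  next
    fix y assume "y \<in> carrier (GAlex G \<sigma>)"
    then have y: "y \<in> carrier G"
      by (simp add: GAlex_def)
    have "bij_betw ((\<lambda>x. x \<otimes> y) \<circ> (\<sigma> \<circ> (\<lambda>x. x \<otimes> inv y))) (carrier G) (carrier G)"
      using bij_betw_trans[OF bij_betw_trans[OF bij_r[of "inv y"] bij] bij_r[of y]] y by simp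
    then show "bij_betw (\<lambda>x. x \<triangleleft>\<^bsub>GAlex G \<sigma>\<^esub> y) (carrier (GAlex G \<sigma>)) (carrier (GAlex G \<sigma>))"
      by (simp add: GAlex_def comp_def)
  next
    fix x y z
    assume "x \<in> carrier (GAlex G \<sigma>)" "y \<in> carrier (GAlex G \<sigma>)" "z \<in> carrier (GAlex G \<sigma>)"
    then have c [simp]: "x \<in> carrier G" "y \<in> carrier G" "z \<in> carrier G"
      by (auto simp: GAlex_def)
    have sc [simp]: "\<sigma> w \<in> carrier G" if "w \<in> carrier G" for w
      using that by (rule s.hom_closed)
    have canc: "u \<otimes> inv w \<otimes> z \<otimes> inv (v \<otimes> inv w \<otimes> z) = u \<otimes> inv v"
      if [simp]: "u \<in> carrier G" "v \<in> carrier G" "w \<in> carrier G" for u v w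
    proof -
      have "u \<otimes> inv w \<otimes> z = (u \<otimes> inv v) \<otimes> (v \<otimes> inv w \<otimes> z)"
        by (simp add: m_assoc) (simp add: m_assoc [symmetric])
      then show ?thesis
        using m_assoc[of "u \<otimes> inv v" "v \<otimes> inv w \<otimes> z" "inv (v \<otimes> inv w \<otimes> z)"]
        by (simp only: r_inv r_one m_closed inv_closed that c)
    qed
    have "\<sigma> (\<sigma> (x \<otimes> inv y) \<otimes> y \<otimes> inv z) \<otimes> z =
          \<sigma> (\<sigma> (x \<otimes> inv y)) \<otimes> (\<sigma> (y \<otimes> inv z) \<otimes> z)"
      by (simp add: m_assoc s.hom_mult del: s.hom_inv)
    also have "\<sigma> (\<sigma> (x \<otimes> inv y)) = \<sigma> (
        \<sigma> (x \<otimes> inv z) \<otimes> z \<otimes> inv (\<sigma> (y \<otimes> inv z) \<otimes> z))"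
      using canc[of "\<sigma> x" "\<sigma> y" "\<sigma> z"] by (simp add: s.hom_mult)
    finally have "\<sigma> (\<sigma> (x \<otimes> inv y) \<otimes> y \<otimes> inv z) \<otimes> z =
          \<sigma> (\<sigma> (x \<otimes> inv z) \<otimes> z \<otimes> inv (\<sigma> (y \<otimes> inv z) \<otimes> z))
            \<otimes> (\<sigma> (y \<otimes> inv z) \<otimes> z)" .
    then show "(x \<triangleleft>\<^bsub>GAlex G \<sigma>\<^esub> y) \<triangleleft>\<^bsub>GAlex G \<sigma>\<^esub> z =
        (x \<triangleleft>\<^bsub>GAlex G \<sigma>\<^esub> z) \<triangleleft>\<^bsub>GAlex G \<sigma>\<^esub> (y \<triangleleft>\<^bsub>GAlex G \<sigma>\<^esub> z)"
      by (simp add: GAlex_def)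
  qed
qed

lemma (in group) conj_iso:
  assumes "a \<in> carrier G"
  shows "(\<lambda>g. inv a \<otimes> g \<otimes> a) \<in> iso G G"
proof (rule isoI)
  have "inv a \<otimes> (x \<otimes> y) \<otimes> a = (inv a \<otimes> x \<otimes> a) \<otimes> (inv a \<otimes> y \<otimes> a)"
    if "x \<in> carrier G" "y \<in> carrier G" for x y
    using assms that by (simp add: m_assoc) (simp add: m_assoc [symmetric])
  then show "(\<lambda>g. inv a \<otimes> g \<otimes> a) \<in> hom G G"
    using assms by (auto intro!: homI)
  show "bij_betw (\<lambda>g. inv a \<otimes> g \<otimes> a) (carrier G) (carrier G)"
  proof (rule bij_betw_byWitness[where f' = "\<lambda>g. a \<otimes> g \<otimes> inv a"])
    have *: "inv b \<otimes> (b \<otimes> g \<otimes> inv b) \<otimes> b = g" if "b \<in> carrier G" "g \<in> carrier G" for b g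
      using that by (simp add: m_assoc) (simp add: m_assoc [symmetric])
    show "\<forall>g\<in>carrier G. inv a \<otimes> (a \<otimes> g \<otimes> inv a) \<otimes> a = g"
      using * assms by blast
    show "\<forall>g\<in>carrier G. a \<otimes> (inv a \<otimes> g \<otimes> a) \<otimes> inv a = g"
      using *[of "inv a"] assms by simp
  qed (use assms in auto)
qed

section \<open>Groups given by generators and relators\<close>

text \<open>A word is a list of letters \<open>(x, True)\<close>, standing for the generator \<open>x\<close>, and
  \<open>(x, False)\<close>, standing for its formal inverse. The group presented by the generators \<open>UNIV\<close> and
  the set \<open>R\<close> of relators consists of the words modulo the congruence below.\<close>

inductive pres_eq :: "('g \<times> bool) list set \<Rightarrow> ('g \<times> bool) list \<Rightarrow> ('g \<times> bool) list \<Rightarrow> bool"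
  for R where
  refl: "pres_eq R u u"
| sym: "pres_eq R u v \<Longrightarrow> pres_eq R v u"
| trans: "pres_eq R u v \<Longrightarrow> pres_eq R v w \<Longrightarrow> pres_eq R u w"
| cancel: "pres_eq R (u @ [(x, e), (x, \<not> e)] @ v) (u @ v)"
| relator: "w \<in> R \<Longrightarrow> pres_eq R (u @ w @ v) (u @ v)"

definition pres_class :: "('g \<times> bool) list set \<Rightarrow> ('g \<times> bool) list \<Rightarrow> ('g \<times> bool) list set" where
  "pres_class R u = {v. pres_eq R u v}"

definition presented_group :: "('g \<times> bool) list set \<Rightarrow> ('g \<times> bool) list set monoid" where
  "presented_group R =
    \<lparr>carrier = range (pres_class R),
     monoid.mult = (\<lambda>A B. \<Union>u\<in>A. \<Union>v\<in>B. pres_class R (u @ v)),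
     one = pres_class R []\<rparr>"

lemma pres_class_eq_iff: "pres_class R u = pres_class R v \<longleftrightarrow> pres_eq R u v"
  
proof
  assume "pres_class R u = pres_class R v"
  moreover have "v \<in> pres_class R v"
    by (simp add: pres_class_def pres_eq.refl)
  ultimately show "pres_eq R u v"
    by (simp add: pres_class_def set_eq_iff)
next
  assume "pres_eq R u v"
  then show "pres_class R u = pres_class R v"
    unfolding pres_class_def by (blast intro: pres_eq.sym pres_eq.trans)
qed

lemma pres_eq_append_right: "pres_eq R u v \<Longrightarrow> pres_eq R (u @ w) (v @ w)"
proof (induction rule: pres_eq.induct)
  case (cancel u x e v)
  show ?case using pres_eq.cancel[of R u x e "v @ w"] by simp
next
  case (relator r u v)
  then show ?case using pres_eq.relator[of r R u "v @ w"] by simp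
next
  case (refl u)
  show ?case by (rule pres_eq.refl)
next
  case (sym u v)
  show ?case using sym.IH by (rule pres_eq.sym)
next
  case (trans u v v')
  show ?case using trans.IH by (rule pres_eq.trans)
qed

lemma pres_eq_append_left: "pres_eq R u v \<Longrightarrow> pres_eq R (w @ u) (w @ v)"
proof (induction rule: pres_eq.induct)
  case (cancel u x e v)
  show ?case using pres_eq.cancel[of R "w @ u" x e v] by simp
next
  case (relator r u v)
  then show ?case using pres_eq.relator[of r R "w @ u" v] by simp
next
  case (refl u)
  show ?case by (rule pres_eq.refl)
next
  case (sym u v)
  show ?case using sym.IH by (rule pres_eq.sym)
next
  case (trans u v v')
  show ?case using trans.IH by (rule pres_eq.trans)
qed

lemma pres_mult:
  "pres_class R u \<otimes>\<^bsub>presented_group R\<^esub> pres_class R v = pres_class R (u @ v)"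
proof -
  have "pres_class R (u' @ v') = pres_class R (u @ v)"
    if "pres_eq R u u'" "pres_eq R v v'" for u' v'
    unfolding pres_class_eq_iff
    by (meson pres_eq.sym pres_eq.trans pres_eq_append_left pres_eq_append_right that)
  moreover have "u \<in> pres_class R u" "v \<in> pres_class R v"
    by (auto simp: pres_class_def intro: pres_eq.refl)
  ultimately have "(\<Union>u'\<in>pres_class R u. \<Union>v'\<in>pres_class R v. pres_class R (u' @ v')) =
      pres_class R (u @ v)"
    unfolding pres_class_def[of R u] pres_class_def[of R v] by blast
  then show ?thesis
    by (simp add: presented_group_def)
qed

lemma pres_inverse: "pres_eq R (map (\<lambda>(x, e). (x, \<not> e)) (rev u) @ u) []"
proof (induction u)
  case (Cons l u)
  obtain x e where l: "l = (x, e)" by force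
  have "pres_eq R (map (\<lambda>(x, e). (x, \<not> e)) (rev u) @ [(x, \<not> e), (x, \<not> \<not> e)] @ u)
          (map (\<lambda>(x, e). (x, \<not> e)) (rev u) @ u)"
    by (rule pres_eq.cancel)
  then show ?case
    using pres_eq.trans[OF _ Cons.IH] l by simp
qed (auto intro: pres_eq.refl)

lemma group_presented_group: "group (presented_group R)"
proof (rule groupI)
  fix A assume "A \<in> carrier (presented_group R)"
  then obtain u where A: "A = pres_class R u"
    by (auto simp: presented_group_def)
  have one: "\<one>\<^bsub>presented_group R\<^esub> = pres_class R []"
    and car: "pres_class R w \<in> carrier (presented_group R)" for w
    by (auto simp: presented_group_def)
  show "\<one>\<^bsub>presented_group R\<^esub> \<otimes>\<^bsub>presented_group R\<^esub> A = A"
    by (simp add: A one pres_mult)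
  show "\<exists>B\<in>carrier (presented_group R). B \<otimes>\<^bsub>presented_group R\<^esub> A = \<one>\<^bsub>presented_group R\<^esub>"
    using pres_inverse[of R u] car by (metis A one pres_mult pres_class_eq_iff)
next
  fix A B C
  assume "A \<in> carrier (presented_group R)" "B \<in> carrier (presented_group R)"
    "C \<in> carrier (presented_group R)"
  then obtain u v w where "A = pres_class R u" "B = pres_class R v" "C = pres_class R w"
    by (auto simp: presented_group_def)
  then show "A \<otimes>\<^bsub>presented_group R\<^esub> B \<otimes>\<^bsub>presented_group R\<^esub> C =
      A \<otimes>\<^bsub>presented_group R\<^esub> (B \<otimes>\<^bsub>presented_group R\<^esub> C)"
    by (simp add: pres_mult)
next
  fix A B
  assume "A \<in> carrier (presented_group R)" "B \<in> carrier (presented_group R)"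
  then obtain u v where "A = pres_class R u" "B = pres_class R v"
    by (auto simp: presented_group_def)
  then show "A \<otimes>\<^bsub>presented_group R\<^esub> B \<in> carrier (presented_group R)"
    by (simp add: pres_mult) (simp add: presented_group_def)
qed (simp add: presented_group_def)

datatype tri_gen = gen_a | gen_b | gen_c

definition tri_relators :: "nat \<Rightarrow> nat \<Rightarrow> nat \<Rightarrow> (tri_gen \<times> bool) list set" where
  "tri_relators p q r =
    {replicate p (gen_a, True), replicate q (gen_b, True), replicate r (gen_c, True),
     [(gen_a, True), (gen_b, True), (gen_c, True)]}"

text \<open>The orientation preserving subgroup of the triangle group, defined by its presentation
  \<open>\<langle>a, b, c | a\<^sup>p = b\<^sup>q = c\<^sup>r = abc = 1\<rangle>\<close>.\<close>

definition tri_group_pos :: "nat \<Rightarrow> nat \<Rightarrow> nat \<Rightarrow> (tri_gen \<times> bool) list set monoid" where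
  "tri_group_pos p q r = presented_group (tri_relators p q r)"

definition tri_elem :: "nat \<Rightarrow> nat \<Rightarrow> nat \<Rightarrow> tri_gen \<Rightarrow> (tri_gen \<times> bool) list set" where
  "tri_elem p q r x = pres_class (tri_relators p q r) [(x, True)]"

section \<open>Quasi-isometries and the hyperbolic plane\<close>

definition quasi_isometry ::
  "'a set \<Rightarrow> ('a \<Rightarrow> 'a \<Rightarrow> real) \<Rightarrow> 'b set \<Rightarrow> ('b \<Rightarrow> 'b \<Rightarrow> real) \<Rightarrow> ('a \<Rightarrow> 'b) \<Rightarrow> bool" where
  "quasi_isometry A dA B dB f \<longleftrightarrow> f \<in> A \<rightarrow> B \<and>
    (\<exists>K C. K \<ge> 1 \<and> C \<ge> 0 \<and>
      (\<forall>x\<in>A. \<forall>y\<in>A. dA x y / K - C \<le> dB (f x) (f y) \<and> dB (f x) (f y) \<le> K * dA x y + C) \<and>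
      (\<forall>z\<in>B. \<exists>x\<in>A. dB (f x) z \<le> C))"

definition quasi_isometric ::
  "'a set \<Rightarrow> ('a \<Rightarrow> 'a \<Rightarrow> real) \<Rightarrow> 'b set \<Rightarrow> ('b \<Rightarrow> 'b \<Rightarrow> real) \<Rightarrow> bool" where
  "quasi_isometric A dA B dB \<longleftrightarrow> (\<exists>f. quasi_isometry A dA B dB f)"

text \<open>The hyperboloid model: the upper sheet of the unit hyperboloid in Minkowski space, with
  \<open>cosh\<close> of the distance equal to minus the Lorentzian product, which is \<open>mink\<close> below.\<close>

fun mink :: "real \<times> real \<times> real \<Rightarrow> real \<times> real \<times> real \<Rightarrow> real" where
  "mink (x, y, t) (x', y', t') = t * t' - x * x' - y * y'"

definition hyp_plane :: "(real \<times> real \<times> real) set" where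
  "hyp_plane = {(x, y, t). mink (x, y, t) (x, y, t) = 1 \<and> t > 0}"

definition hyp_dist :: "real \<times> real \<times> real \<Rightarrow> real \<times> real \<times> real \<Rightarrow> real" where
  "hyp_dist u v = arcosh (mink u v)"

lemma mink_identity:
  assumes "(x, y, t) \<in> hyp_plane" "(x', y', t') \<in> hyp_plane"
  shows "(t * t')\<^sup>2 = (1 + x * x' + y * y')\<^sup>2 +
    ((x - x')\<^sup>2 + (y - y')\<^sup>2 + (x * y' - y * x')\<^sup>2)"
proof -
  have "t\<^sup>2 = 1 + x\<^sup>2 + y\<^sup>2" "t'\<^sup>2 = 1 + x'\<^sup>2 + y'\<^sup>2"
    using assms by (auto simp: hyp_plane_def power2_eq_square)
  then have "(t * t')\<^sup>2 = (1 + x\<^sup>2 + y\<^sup>2) * (1 + x'\<^sup>2 + y'\<^sup>2)"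
    by (simp only: power_mult_distrib)
  also have "\<dots> = (1 + x * x' + y * y')\<^sup>2 +
      ((x - x')\<^sup>2 + (y - y')\<^sup>2 + (x * y' - y * x')\<^sup>2)"
    by algebra
  finally show ?thesis .
qed

lemma mink_ge_1:
  assumes "u \<in> hyp_plane" "v \<in> hyp_plane"
  shows "mink u v \<ge> 1"
proof -
  obtain x y t x' y' t' where uv: "u = (x, y, t)" "v = (x', y', t')"
    by (metis prod_cases3)
  have "t > 0" "t' > 0"
    using assms by (auto simp: uv hyp_plane_def)
  then have "0 \<le> t * t'"
    by simp
  moreover have "(1 + x * x' + y * y')\<^sup>2 \<le> (t * t')\<^sup>2"
    using mink_identity[of x y t x' y' t'] assms uv by simp
  ultimately have "1 + x * x' + y * y' \<le> t * t'"
    by (rule power2_le_imp_le[rotated])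
  then show ?thesis
    by (simp add: uv)
qed

lemma mink_eq_1_iff:
  assumes "u \<in> hyp_plane" "v \<in> hyp_plane"
  shows "mink u v = 1 \<longleftrightarrow> u = v"
proof
  obtain x y t x' y' t' where uv: "u = (x, y, t)" "v = (x', y', t')"
    by (metis prod_cases3)
  assume "mink u v = 1"
  then have "t * t' = 1 + x * x' + y * y'"
    by (simp add: uv)
  then have "(x - x')\<^sup>2 + (y - y')\<^sup>2 + (x * y' - y * x')\<^sup>2 = 0"
    using mink_identity[of x y t x' y' t'] assms uv by simp
  then have "(x - x')\<^sup>2 = 0" "(y - y')\<^sup>2 = 0"
    using zero_le_power2[of "x - x'"] zero_le_power2[of "y - y'"]
      zero_le_power2[of "x * y' - y * x'"] by linarith+
  then have xy: "x = x'" "y = y'"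
    by simp_all
  then have "t\<^sup>2 = t'\<^sup>2" "0 \<le> t" "0 \<le> t'"
    using assms by (auto simp: uv hyp_plane_def power2_eq_square)
  then have "t = t'"
    using power2_eq_iff_nonneg by blast
  then show "u = v"
    by (simp add: uv xy)
next
  show "u = v \<Longrightarrow> mink u v = 1"
    using assms by (auto simp: hyp_plane_def)
qed

text \<open>The numbers \<open>hyp_dist u v\<close> are the values of a metric on \<open>hyp_plane\<close>; the locale
  \<open>Metric_space\<close> also demands nonnegativity and symmetry off the carrier.\<close>

lemma Metric_space_hyp_plane:
  "Metric_space hyp_plane (\<lambda>u v. if u \<in> hyp_plane \<and> v \<in> hyp_plane then hyp_dist u v else 0)"
proof
  have comm: "mink u v = mink v u" for u v
    by (cases u; cases v) (simp add: algebra_simps)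
  fix u v w
  show "0 \<le> (if u \<in> hyp_plane \<and> v \<in> hyp_plane then hyp_dist u v else 0)"
    using mink_ge_1[of u v] by (simp add: hyp_dist_def)
  show "(if u \<in> hyp_plane \<and> v \<in> hyp_plane then hyp_dist u v else 0) =
      (if v \<in> hyp_plane \<and> u \<in> hyp_plane then hyp_dist v u else 0)"
    by (simp add: hyp_dist_def comm[of u v])
  assume u: "u \<in> hyp_plane" and v: "v \<in> hyp_plane"
  show "(if u \<in> hyp_plane \<and> v \<in> hyp_plane then hyp_dist u v else 0) = 0 \<longleftrightarrow> u = v"
    using u v mink_ge_1[OF u v] mink_eq_1_iff[OF u v] by (simp add: hyp_dist_def)
  assume w: "w \<in> hyp_plane"
  define \<alpha> \<beta> \<gamma> where "\<alpha> = mink u v" and "\<beta> = mink v w" and "\<gamma> = mink u w"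
  have ge: "\<alpha> \<ge> 1" "\<beta> \<ge> 1" "\<gamma> \<ge> 1"
    using u v w by (auto simp: \<alpha>_def \<beta>_def \<gamma>_def mink_ge_1)
  obtain x1 y1 t1 x2 y2 t2 x3 y3 t3 where
    e: "u = (x1, y1, t1)" "v = (x2, y2, t2)" "w = (x3, y3, t3)"
    by (metis prod_cases3)
  have n: "t1 * t1 - x1 * x1 - y1 * y1 = 1" "t2 * t2 - x2 * x2 - y2 * y2 = 1"
      "t3 * t3 - x3 * x3 - y3 * y3 = 1"
    using u v w by (auto simp: e hyp_plane_def)
  define D where "D = t1 * (x2 * y3 - x3 * y2) - x1 * (t2 * y3 - t3 * y2) + y1 * (t2 * x3 - t3 * x2)"
  have gram: "n1 * n2 * n3 + 2 * (t1 * t2 - x1 * x2 - y1 * y2) * (t2 * t3 - x2 * x3 - y2 * y3) * (t1 * t3 - x1 * x3 - y1 * y3)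
      - n3 * (t1 * t2 - x1 * x2 - y1 * y2)\<^sup>2 - n1 * (t2 * t3 - x2 * x3 - y2 * y3)\<^sup>2
      - n2 * (t1 * t3 - x1 * x3 - y1 * y3)\<^sup>2 = D\<^sup>2"
    if "n1 = t1 * t1 - x1 * x1 - y1 * y1" "n2 = t2 * t2 - x2 * x2 - y2 * y2"
      "n3 = t3 * t3 - x3 * x3 - y3 * y3" for n1 n2 n3
    unfolding D_def that by algebra
  have "1 + 2 * \<alpha> * \<beta> * \<gamma> - \<alpha>\<^sup>2 - \<beta>\<^sup>2 - \<gamma>\<^sup>2 = D\<^sup>2"
    using gram[of 1 1 1] n by (simp add: \<alpha>_def \<beta>_def \<gamma>_def e)
  moreover have "(\<alpha>\<^sup>2 - 1) * (\<beta>\<^sup>2 - 1) - (\<gamma> - \<alpha> * \<beta>)\<^sup>2 =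
      1 + 2 * \<alpha> * \<beta> * \<gamma> - \<alpha>\<^sup>2 - \<beta>\<^sup>2 - \<gamma>\<^sup>2"
    by algebra
  ultimately have "(\<gamma> - \<alpha> * \<beta>)\<^sup>2 \<le> (\<alpha>\<^sup>2 - 1) * (\<beta>\<^sup>2 - 1)"
    using zero_le_power2[of D] by linarith
  then have "\<gamma> - \<alpha> * \<beta> \<le> sqrt ((\<alpha>\<^sup>2 - 1) * (\<beta>\<^sup>2 - 1))"
    by (rule real_le_rsqrt)
  also have "\<dots> = sinh (arcosh \<alpha>) * sinh (arcosh \<beta>)"
    using ge by (simp add: sinh_arcosh_real real_sqrt_mult)
  finally have "cosh (arcosh \<gamma>) \<le> cosh (arcosh \<alpha> + arcosh \<beta>)"
    using ge by (simp add: cosh_add)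
  then have "arcosh \<gamma> \<le> arcosh \<alpha> + arcosh \<beta>"
    using ge by (subst (asm) cosh_real_nonneg_le_iff) auto
  then show "(if u \<in> hyp_plane \<and> w \<in> hyp_plane then hyp_dist u w else 0) \<le>
      (if u \<in> hyp_plane \<and> v \<in> hyp_plane then hyp_dist u v else 0) +
      (if v \<in> hyp_plane \<and> w \<in> hyp_plane then hyp_dist v w else 0)"
    using u v w by (simp add: hyp_dist_def \<alpha>_def \<beta>_def \<gamma>_def)
qed

end

theory Submission
  imports Defs
begin

text \<open>
  Since \<open>x \<triangleleft> y = a\<^sup>-\<^sup>1 x (y\<^sup>-\<^sup>1 a y)\<close>, the group \<open>Dis(X)\<close> consists of the right translations by the normal
  subgroup \<open>H\<close> generated by the elements \<open>(x\<^sup>-\<^sup>1 a x) (y\<^sup>-\<^sup>1 a y)\<^sup>-\<^sup>1\<close>, and the components are the cosets of \<open>H\<close>.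
  Modulo \<open>H\<close> the element \<open>a\<close> is central, so the quotient is abelian and generated by the classes of
  \<open>a\<close> and \<open>b\<close>, which have finite order. Everything else is about the action of the triangle group on
  the sphere, the Euclidean or the hyperbolic plane.

  This action is controlled by the argument of Tits: if the word length of a chamber increases when
  its \<open>i\<close>-th wall is crossed, then the base point has height at least one over that wall, as seen from
  the chamber, and otherwise the height is at most minus one. Along a geodesic word a linear
  functional therefore drops by a definite amount at each step, which bounds the word length; in the
  spherical case the functional is bounded and the group is finite. In the other two cases the
  adjugate of the Gram matrix has nonnegative entries and a positive diagonal, so a point far away
  from the base point has a very negative height over some wall, and reflecting in this wall moves
  the point closer to the base point by a constant. This descent shows at once that the orbit is
  coarsely dense and that the word length is bounded linearly by the distance.
\<close>

text \<open>The group is known only through its presentation: nothing says beforehand that it acts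
  faithfully or discretely, or that the images of a triangle tile the plane. This is why lengths are
  defined by words in the abstract group and then compared with heights. A bound on the length by
  the displacement of the base point is properness, coarse density of the orbit is cocompactness,
  and together they are the input of the Milnor-Schwarz lemma, carried out with constants. The bound
  1 for the heights, instead of mere positivity, turns signs into a bound on the length. Two
  mismatches have to be bridged. Crossing a wall reverses orientation, while the group at hand
  contains no reflections, so lengths are measured among chambers of both orientations. And
  \<open>U\<close> generates only a subgroup of finite index, so these lengths must be converted to
  words in \<open>U\<close>.\<close>

section \<open>Reflections and chamber systems\<close>


text \<open>A vector \<open>c\<close> encodes the point \<open>o + \<Sum>\<^sub>i c\<^sub>i n\<^sub>i\<close>, where the \<open>n\<^sub>i\<close> are unit normals of the walls with
  Gram matrix \<open>A\<close> and \<open>o\<close> is a point at height one over each wall; \<open>wall A c i\<close> is its height over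
  the \<open>i\<close>-th wall. In this encoding the spherical, Euclidean and hyperbolic cases need not be
  distinguished.\<close>

definition wall :: "('i::finite \<Rightarrow> 'i \<Rightarrow> real) \<Rightarrow> ('i \<Rightarrow> real) \<Rightarrow> 'i \<Rightarrow> real" where
  "wall A c i = 1 + (\<Sum>j\<in>UNIV. A i j * c j)"

definition reflect :: "('i::finite \<Rightarrow> 'i \<Rightarrow> real) \<Rightarrow> 'i \<Rightarrow> ('i \<Rightarrow> real) \<Rightarrow> ('i \<Rightarrow> real)" where
  "reflect A i c = c(i := c i - 2 * wall A c i)"

lemma sum_fun_upd_mult:
  fixes f c :: "'i::finite \<Rightarrow> real"
  shows "(\<Sum>j\<in>UNIV. f j * (c(i := c i + t)) j) = (\<Sum>j\<in>UNIV. f j * c j) + f i * t"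
proof -
  have "(\<Sum>j\<in>UNIV. f j * (c(i := c i + t)) j) = (\<Sum>j\<in>UNIV. f j * c j + (if j = i then f i * t else 0))"
    by (rule sum.cong) (auto simp: algebra_simps)
  then show ?thesis
    by (simp add: sum.distrib)
qed

lemma wall_reflect: "wall A (reflect A i c) j = wall A c j - 2 * A j i * wall A c i"
  using sum_fun_upd_mult[of "A j" c i "- 2 * wall A c i"] by (simp add: wall_def[of A _ j] reflect_def)

lemma reflect_reflect: "A i i = 1 \<Longrightarrow> reflect A i (reflect A i c) = c"
  unfolding reflect_def[of A i "reflect A i c"] wall_reflect by (simp add: reflect_def)

text \<open>In the complex coordinate \<open>u\<^sub>j + e\<^sup>i\<^sup>\<theta> u\<^sub>i\<close> on the quotient by the fixed space, the
  two reflections are conjugation and conjugation followed by the rotation by \<open>2\<theta>\<close>.\<close>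

lemma reflect_braid:
  assumes "i \<noteq> j" and A: "A i i = 1" "A j j = 1" "A i j = - cos (pi / m)" "A j i = - cos (pi / m)"
    and m: "m \<ge> (2::nat)"
  shows "((reflect A j \<circ> reflect A i) ^^ m) c = c"
proof -
  define \<theta> where "\<theta> = pi / m"
  define \<zeta> where "\<zeta> c = of_real (wall A c j) + cis \<theta> * of_real (wall A c i)" for c
  have \<theta>: "0 < \<theta>" "\<theta> \<le> pi / 2"
    using m by (auto simp: \<theta>_def field_simps)
  have sin_pos: "sin \<theta> > 0"
    using \<theta> by (intro sin_gt_zero) auto
  have zi: "\<zeta> (reflect A i c) = cnj (\<zeta> c)" for c
    unfolding \<zeta>_def wall_reflect A \<theta>_def [symmetric]
    by (simp add: complex_eq_iff algebra_simps)
  have zj: "\<zeta> (reflect A j c) = cis \<theta> * cis \<theta> * cnj (\<zeta> c)" for c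
  proof -
    have 1: "cis \<theta> * cis \<theta> = 2 * cos \<theta> * cis \<theta> - 1"
      using sin_squared_eq[of \<theta>] by (simp add: complex_eq_iff power2_eq_square)
    have 2: "cis \<theta> * cnj (cis \<theta>) = 1"
      by (simp add: cis_cnj cis_mult)
    have "\<zeta> (reflect A j c) = (2 * cos \<theta> * cis \<theta> - 1) * wall A c j + cis \<theta> * wall A c i"
      unfolding \<zeta>_def wall_reflect A \<theta>_def [symmetric] by (simp add: algebra_simps)
    also have "\<dots> = cis \<theta> * cis \<theta> * wall A c j + (cis \<theta> * cnj (cis \<theta>)) * cis \<theta> * wall A c i"
      by (simp only: 1 2 mult_1)
    also have "\<dots> = cis \<theta> * cis \<theta> * cnj (\<zeta> c)"
      unfolding \<zeta>_def by (simp add: algebra_simps)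
    finally show ?thesis .
  qed
  have z: "\<zeta> ((reflect A j \<circ> reflect A i) c) = cis (2 * \<theta>) * \<zeta> c" for c
    by (simp add: zi zj cis_mult)
  have "\<zeta> (((reflect A j \<circ> reflect A i) ^^ k) c) = cis (2 * \<theta>) ^ k * \<zeta> c" for k
    by (induction k) (use z in \<open>auto simp del: o_apply simp: o_apply[of "reflect A j \<circ> reflect A i"]\<close>)
  moreover have "cis (2 * \<theta>) ^ m = 1"
  proof -
    have "real m * (2 * \<theta>) = 2 * pi"
      using m by (simp add: \<theta>_def)
    then show ?thesis
      by (simp only: Complex.DeMoivre cis_2pi)
  qed
  ultimately have eq: "\<zeta> (((reflect A j \<circ> reflect A i) ^^ m) c) = \<zeta> c"
    by simp
  \<comment> \<open>\<open>\<zeta>\<close> only sees the heights over the two walls. The change from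
    \<open>c\<close> to \<open>c'\<close> is supported on \<open>i\<close> and \<open>j\<close> and
    is killed by their 2x2 Gram matrix, whose determinant is the square of
    \<open>sin \<theta>\<close>.\<close>
  define c' where "c' = ((reflect A j \<circ> reflect A i) ^^ m) c"
  have wi: "wall A c' i = wall A c i"
    using arg_cong[OF eq, of Im] sin_pos by (simp add: \<zeta>_def c'_def)
  then have wj: "wall A c' j = wall A c j"
    using arg_cong[OF eq, of Re] by (simp add: \<zeta>_def c'_def)
  have other: "c' l = c l" if "l \<noteq> i" "l \<noteq> j" for l
    unfolding c'_def using that by (induction m) (auto simp: reflect_def)
  have c': "c' = (c(i := c i + (c' i - c i)))(j := (c(i := c i + (c' i - c i))) j + (c' j - c j))"
    using other \<open>i \<noteq> j\<close> by auto
  have w: "wall A c' l = wall A c l + A l i * (c' i - c i) + A l j * (c' j - c j)" for l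
    unfolding wall_def by (subst c', subst sum_fun_upd_mult, subst sum_fun_upd_mult) simp
  have e: "(c' i - c i) = cos \<theta> * (c' j - c j)" "(c' j - c j) = cos \<theta> * (c' i - c i)"
    using w[of i] w[of j] wi wj A by (auto simp: \<theta>_def algebra_simps)
  then have "(c' i - c i) * (1 - (cos \<theta>)\<^sup>2) = 0"
    by (simp add: power2_eq_square algebra_simps)
  then have "c' i = c i"
    using sin_pos by (simp add: sin_squared_eq [symmetric])
  with e other have "c' = c"
    by (metis diff_self eq_iff_diff_eq_0 ext mult_zero_right)
  then show ?thesis by (simp add: c'_def)
qed

text \<open>What Tits' argument uses of a Coxeter group and its geometric representation. Since
  faithfulness of the action is unknown for a presented group, \<open>u\<close> is just a function
  on chambers that transforms like heights. \<open>even_ch\<close> is the sign character; it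
  excludes moves that keep the length.\<close>

locale chamber_system =
  fixes m :: "'i \<Rightarrow> 'i \<Rightarrow> nat" and s :: "'i \<Rightarrow> 'x \<Rightarrow> 'x" and X :: "'x set" and x0 :: 'x
    and even_ch :: "'x \<Rightarrow> bool" and u :: "'x \<Rightarrow> 'i \<Rightarrow> real"
  assumes m: "i \<noteq> j \<Longrightarrow> m i j \<ge> 2"
    and x0: "x0 \<in> X"
    and s_closed: "x \<in> X \<Longrightarrow> s i x \<in> X"
    and connected: "x \<in> X \<Longrightarrow> \<exists>w. fold s w x0 = x"
    and s_s: "x \<in> X \<Longrightarrow> s i (s i x) = x"
    and braid: "i \<noteq> j \<Longrightarrow> x \<in> X \<Longrightarrow> ((s j \<circ> s i) ^^ m i j) x = x"
    and parity: "x \<in> X \<Longrightarrow> even_ch (s i x) \<longleftrightarrow> \<not> even_ch x"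
    and u0: "u x0 i = 1"
    and u_same: "x \<in> X \<Longrightarrow> u (s i x) i = - u x i"
    and u_other: "i \<noteq> j \<Longrightarrow> x \<in> X \<Longrightarrow> u (s i x) j = u x j + 2 * cos (pi / m i j) * u x i"
    and m_sym: "m i j = m j i"
begin

definition len :: "'x \<Rightarrow> nat" where
  "len x = (LEAST n. \<exists>w. length w = n \<and> fold s w x0 = x)"

lemma len_le: "fold s w x0 = x \<Longrightarrow> len x \<le> length w"
  unfolding len_def by (rule Least_le) blast

lemma len_word:
  assumes "x \<in> X"
  shows "\<exists>w. length w = len x \<and> fold s w x0 = x"
  unfolding len_def by (rule LeastI_ex) (use connected[OF assms] in blast)

lemma len_x0 [simp]: "len x0 = 0"
  using len_le[of "[]" x0] by simp

lemma len_eq_0: "x \<in> X \<Longrightarrow> len x = 0 \<Longrightarrow> x = x0"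
  using len_word[of x] by auto

lemma len_step_le: "x \<in> X \<Longrightarrow> len (s i x) \<le> Suc (len x)"
  using len_word[of x] len_le[of "w @ [i]" "s i x" for w] by force

lemma fold_in: "x \<in> X \<Longrightarrow> fold s w x \<in> X"
  by (induction w arbitrary: x) (auto simp: s_closed)

lemma even_fold: "x \<in> X \<Longrightarrow> even_ch (fold s w x) \<longleftrightarrow> (even_ch x \<longleftrightarrow> even (length w))"
  by (induction w arbitrary: x) (auto simp: s_closed parity)

lemma even_ch_len: "x \<in> X \<Longrightarrow> even_ch x \<longleftrightarrow> (even_ch x0 \<longleftrightarrow> even (len x))"
  using len_word[of x] even_fold[OF x0] by metis

lemma len_cases:
  assumes "x \<in> X"
  shows "len (s i x) = Suc (len x) \<or> Suc (len (s i x)) = len x"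
proof -
  have "len (s i x) \<noteq> len x"
    using even_ch_len[OF assms] even_ch_len[OF s_closed[OF assms]] parity[OF assms] by metis
  moreover have "len x \<le> Suc (len (s i x))"
    using len_step_le[OF s_closed[OF assms], of i i] s_s[OF assms] by simp
  ultimately show ?thesis
    using len_step_le[OF assms, of i] by linarith
qed

lemma len_descent:
  assumes "x \<in> X" "x \<noteq> x0"
  shows "\<exists>i. Suc (len (s i x)) = len x"
proof -
  obtain w where w: "length w = len x" "fold s w x0 = x"
    using len_word assms by blast
  then obtain w' i where w': "w = w' @ [i]"
    using assms by (cases w rule: rev_cases) auto
  let ?y = "fold s w' x0"
  have "?y \<in> X" by (simp add: fold_in x0)
  moreover have x: "x = s i ?y"
    using w w' by simp
  ultimately have "s i x = ?y"
    by (simp add: s_s)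
  then have "len (s i x) \<le> length w'"
    using len_le by metis
  then show ?thesis
    using len_cases[OF assms(1), of i] w(1) w' by auto
qed

fun alt :: "'i \<Rightarrow> 'i \<Rightarrow> 'x \<Rightarrow> nat \<Rightarrow> 'x" where
  "alt i j x 0 = x"
| "alt i j x (Suc n) = s (if even n then i else j) (alt i j x n)"

lemma alt_in: "x \<in> X \<Longrightarrow> alt i j x n \<in> X"
  by (induction n) (auto simp: s_closed)

lemma alt_double: "alt i j x (2 * n) = ((s j \<circ> s i) ^^ n) x"
  by (induction n) auto

text \<open>The two alternating paths from \<open>x\<close> run through the same closed path of
  \<open>2 * m i j\<close> steps in opposite directions.\<close>

lemma alt_reverse:
  assumes "i \<noteq> j" "x \<in> X" "n \<le> 2 * m i j"
  shows "alt j i x n = alt i j x (2 * m i j - n)"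
  using assms(3)
proof (induction n)
  case 0
  then show ?case
    using braid[OF assms(1,2)] by (simp add: alt_double)
next
  case (Suc n)
  then have IH: "alt j i x n = alt i j x (2 * m i j - n)"
    by simp
  obtain k where k: "2 * m i j - n = Suc k" "2 * m i j - Suc n = k"
    using Suc.prems by (cases "2 * m i j - n") auto
  have "even k \<longleftrightarrow> odd n"
    using k(1) Suc.prems by presburger
  then show ?case
    using k IH s_s[OF alt_in[OF assms(2), of i j k]] by auto
qed

lemma alt_braid: "i \<noteq> j \<Longrightarrow> x \<in> X \<Longrightarrow> alt j i x (m i j) = alt i j x (m i j)"
  using alt_reverse[of i j x "m i j"] by (simp add: mult_2)

lemma len_alt_ge: "x \<in> X \<Longrightarrow> len x \<le> len (alt i j x n) + n"
proof (induction n)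
  case (Suc n)
  let ?y = "alt i j x n"
  have "len ?y \<le> Suc (len (alt i j x (Suc n)))"
    using len_cases[OF alt_in[OF Suc.prems], of "if even n then i else j" i j n] by auto
  then show ?case using Suc by linarith
qed simp

lemma alt_shift: "alt i j x (Suc n) = alt j i (s i x) n"
  by (induction n) auto

text \<open>Otherwise, by the braid relation, the path beginning with \<open>i\<close> would meet
  the end of the first \<open>m i j\<close> descending steps, and \<open>s i x\<close>, being only
  \<open>m i j - 1\<close> steps away from that end, would be shorter than \<open>x\<close>.\<close>

lemma len_alt_descent_bound:
  assumes "i \<noteq> j" "x \<in> X" "len (s i x) = Suc (len x)" "len (alt j i x n) + n = len x"
  shows "n < m i j"
proof (rule ccontr)
  assume "\<not> n < m i j"
  then obtain k where k: "n = m i j + k"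
    using le_Suc_ex not_less by blast
  have y: "len (alt j i x (m i j)) + m i j \<le> len x"
    using assms(4) unfolding k
  proof (induction k)
    case (Suc k)
    have "len (alt j i x (m i j + k)) \<le> Suc (len (alt j i x (m i j + Suc k)))"
      using len_cases[OF alt_in[OF assms(2)], of "if even (m i j + k) then j else i" j i "m i j + k"]
      by auto
    moreover have "len x \<le> len (alt j i x (m i j + k)) + (m i j + k)"
      by (rule len_alt_ge[OF assms(2)])
    ultimately show ?case
      using Suc by linarith
  qed simp
  obtain l where l: "m i j = Suc l"
    using m[OF assms(1)] by (cases "m i j") auto
  have "len (s i x) \<le> len (alt i j x (m i j)) + l"
    using len_alt_ge[OF s_closed[OF assms(2), of i], of j i l] l by (simp only: alt_shift)
  then show False
    using y l assms(3) alt_braid[OF assms(1,2)] by simp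
qed

text \<open>Along the path \<open>u_other\<close> is a two-term recursion with factor
  \<open>2 * cos \<theta>\<close>, whose solutions are sines of multiples of \<theta>. The parity of
  \<open>k\<close> tells the next letter of the path from the other one.\<close>

lemma u_alt:
  assumes "i \<noteq> j" "x \<in> X"
  defines "\<theta> \<equiv> pi / real (m i j)"
  shows "sin \<theta> * u x i = sin (real (Suc k) * \<theta>) * u (alt j i x k) (if even k then i else j)
    + sin (real k * \<theta>) * u (alt j i x k) (if even k then j else i)"
proof (induction k)
  case (Suc k)
  define e f where "e = (if even k then j else i)" and "f = (if even k then i else j)"
  define y where "y = alt j i x (Suc k)"
  have y: "y \<in> X"
    unfolding y_def by (rule alt_in[OF assms(2)])
  have x: "alt j i x k = s e y"
    by (simp add: y_def e_def s_s alt_in assms)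
  have ef: "e \<noteq> f" "m e f = m i j"
    using assms(1) m_sym by (auto simp: e_def f_def)
  have "sin (real (Suc (Suc k)) * \<theta>) + sin (real k * \<theta>) = 2 * cos \<theta> * sin (real (Suc k) * \<theta>)"
    using sin_add[of "Suc k * \<theta>" \<theta>] sin_diff[of "Suc k * \<theta>" \<theta>] by (simp add: algebra_simps)
  moreover have "sin \<theta> * u x i = sin (real (Suc k) * \<theta>) * (u y f + 2 * cos \<theta> * u y e) - sin (real k * \<theta>) * u y e"
    using Suc u_other[OF ef(1) y] u_same[OF y, of e] ef(2)
    by (simp add: e_def [symmetric] f_def [symmetric] x \<theta>_def)
  ultimately have "sin \<theta> * u x i = sin (real (Suc (Suc k)) * \<theta>) * u y e + sin (real (Suc k) * \<theta>) * u y f"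
    by algebra
  then show ?case
    by (simp add: e_def f_def y_def [symmetric] del: alt.simps)
qed simp

text \<open>The analogue of Tits' theorem on roots: descend along the two letters \<open>i\<close>, \<open>j\<close> as long as
  possible and compare the ends of the resulting dihedral path.\<close>

theorem u_ascent:
  assumes "x \<in> X" "len (s i x) = Suc (len x)"
  shows "u x i \<ge> 1"
  using assms
proof (induction "len x" arbitrary: x i rule: less_induct)
  case less
  show ?case
  proof (cases "x = x0")
    case True
    then show ?thesis by (simp add: u0)
  next
    case False
    then obtain j where j: "Suc (len (s j x)) = len x"
      using len_descent less.prems(1) by blast
    then have ij: "i \<noteq> j"
      using less.prems(2) by auto
    define desc where "desc n \<longleftrightarrow> len (alt j i x n) + n = len x" for n
    have d1: "desc 1"
      using j by (simp add: desc_def)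
    have bound: "n < m i j" if "desc n" for n
      using len_alt_descent_bound[OF ij less.prems] that by (simp add: desc_def)
    \<comment> \<open>A longest descent; it exists since descents have fewer than
      \<open>m i j\<close> steps.\<close>
    define k where "k = (GREATEST n. desc n)"
    have k: "desc k" "1 \<le> k" "\<not> desc (Suc k)"
      using GreatestI_nat[of desc 1 "m i j"] Greatest_le_nat[of desc _ "m i j"] bound d1
      unfolding k_def by (force simp: less_imp_le)+
    define e f y where "e = (if even k then j else i)" and "f = (if even k then i else j)"
      and "y = alt j i x k"
    have y: "y \<in> X"
      unfolding y_def by (rule alt_in[OF less.prems(1)])
    have ly: "len y + k = len x"
      using k(1) by (simp add: desc_def y_def)
    \<comment> \<open>At the end \<open>y\<close> both letters lead upwards: \<open>e\<close>
      because the descent cannot be continued, \<open>f\<close> because it was crossed last.\<close>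
    have up_e: "len (s e y) = Suc (len y)"
      using k(3) len_cases[OF y, of e] ly by (auto simp: desc_def y_def e_def)
    obtain k' where k': "k = Suc k'"
      using k(2) by (cases k) auto
    have "s f y = alt j i x k'"
      by (simp add: y_def f_def k' s_s alt_in less.prems)
    moreover have "len x \<le> len (alt j i x k') + k'"
      by (rule len_alt_ge[OF less.prems(1)])
    ultimately have up_f: "len (s f y) = Suc (len y)"
      using len_cases[OF y, of f] ly k' by auto
    have u: "1 \<le> u y e" "1 \<le> u y f"
      using less.hyps[OF _ y up_e] less.hyps[OF _ y up_f] ly k(2) by auto
    define \<theta> where "\<theta> = pi / m i j"
    have km: "k < m i j"
      using bound k(1) .
    have \<theta>: "0 < \<theta>" "\<theta> \<le> pi / 2"
      using m[OF ij] by (auto simp: \<theta>_def field_simps)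
    have "Suc k * \<theta> \<le> m i j * \<theta>"
      using km \<theta> by (intro mult_right_mono) auto
    also have mt: "m i j * \<theta> = pi"
      using km by (simp add: \<theta>_def)
    finally have s1: "0 \<le> sin (real (Suc k) * \<theta>)" and kt: "k * \<theta> \<le> pi - \<theta>"
      using \<theta> by (auto intro!: sin_ge_zero simp: algebra_simps)
    \<comment> \<open>As \<open>k * \<theta>\<close> lies between \<theta> and
      \<open>pi - \<theta>\<close>, its sine is at least \<open>sin \<theta>\<close>. This carries
      the bound 1 through the induction; the other summand only has to be nonnegative.\<close>
    have "\<theta> \<le> k * \<theta>"
      using k(2) \<theta> by (simp add: mult_le_cancel_right1)
    then have "\<bar>k * \<theta> - pi / 2\<bar> \<le> pi / 2 - \<theta>"
      using kt by linarith
    then have "cos (pi / 2 - \<theta>) \<le> cos \<bar>k * \<theta> - pi / 2\<bar>"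
      using \<theta> by (intro cos_monotone_0_pi_le) auto
    then have s2: "sin \<theta> \<le> sin (real k * \<theta>)"
      by (simp add: cos_diff)
    have sp: "sin \<theta> > 0"
      using \<theta> by (intro sin_gt_zero) auto
    have "sin \<theta> * u x i = sin (real (Suc k) * \<theta>) * u y f + sin (real k * \<theta>) * u y e"
      using u_alt[OF ij less.prems(1), of k] by (simp add: \<theta>_def e_def f_def y_def)
    moreover have "0 \<le> sin (real (Suc k) * \<theta>) * u y f"
      using s1 u by simp
    moreover have "sin \<theta> * 1 \<le> sin (real k * \<theta>) * u y e"
      using s2 sp u by (intro mult_mono) auto
    ultimately have "sin \<theta> * 1 \<le> sin \<theta> * u x i"
      by linarith
    then show ?thesis
      using sp by (simp add: mult_le_cancel_left)
  qed
qed

corollary u_descent: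
  assumes "x \<in> X" "Suc (len (s i x)) = len x"
  shows "u x i \<le> - 1"
  using u_ascent[OF s_closed[OF assms(1), of i], of i] assms u_same s_s by fastforce

end

section \<open>The triangle group and its chambers\<close>


definition quad :: "('i::finite \<Rightarrow> 'i \<Rightarrow> real) \<Rightarrow> ('i \<Rightarrow> real) \<Rightarrow> real" where
  "quad A c = (\<Sum>i\<in>UNIV. c i * (\<Sum>j\<in>UNIV. A i j * c j))"

lemma quad_fun_upd:
  assumes "\<And>i j. A i j = A j i"
  shows "quad A (c(i := c i + t)) = quad A c + 2 * t * (\<Sum>j\<in>UNIV. A i j * c j) + t\<^sup>2 * A i i"
proof -
  define v where "v = (\<lambda>k. \<Sum>j\<in>UNIV. A k j * c j)"
  have "quad A (c(i := c i + t)) = (\<Sum>k\<in>UNIV. (v k + A i k * t) * (c(i := c i + t)) k)"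
    unfolding quad_def sum_fun_upd_mult v_def by (simp add: assms[of i] mult.commute)
  also have "\<dots> = (\<Sum>k\<in>UNIV. (v k + A i k * t) * c k) + (v i + A i i * t) * t"
    by (rule sum_fun_upd_mult)
  also have "(\<Sum>k\<in>UNIV. (v k + A i k * t) * c k) = quad A c + t * v i"
    by (simp add: quad_def v_def algebra_simps sum.distrib sum_distrib_left)
  also have "quad A c + t * v i + (v i + A i i * t) * t = quad A c + 2 * t * v i + t\<^sup>2 * A i i"
    by (simp add: power2_eq_square algebra_simps)
  finally show ?thesis
    by (simp only: v_def)
qed

lemma sum_reflect:
  fixes A :: "'i::finite \<Rightarrow> 'i \<Rightarrow> real"
  shows "sum (reflect A i c) UNIV = sum c UNIV - 2 * wall A c i"
  using sum_fun_upd_mult[of "\<lambda>_. 1" c i "- 2 * wall A c i"] by (simp add: reflect_def)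

text \<open>If the form is nondegenerate, then \<open>quad A c + 2 * sum c UNIV\<close> is the squared length of the point
  \<open>o + \<Sum>\<^sub>i c\<^sub>i n\<^sub>i\<close> minus that of \<open>o\<close>.\<close>

lemma quad_sum_reflect:
  assumes "\<And>i j. A i j = A j i" "A i i = 1"
  shows "quad A (reflect A i c) + 2 * sum (reflect A i c) UNIV = quad A c + 2 * sum c UNIV"
proof -
  define w where "w = wall A c i"
  have "reflect A i c = c(i := c i + - 2 * w)"
    by (simp add: reflect_def w_def)
  moreover have "(\<Sum>j\<in>UNIV. A i j * c j) = w - 1"
    by (simp add: w_def wall_def)
  ultimately have "quad A (reflect A i c) = quad A c + 2 * (- 2 * w) * (w - 1) + (- 2 * w)\<^sup>2 * A i i"
    using quad_fun_upd[of A c i "- 2 * w", OF assms(1)] by simp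
  then show ?thesis
    by (simp add: assms(2) sum_reflect w_def [symmetric] power2_eq_square algebra_simps)
qed

text \<open>The constant 1 in the heights cancels in differences, so these transform by a linear
  reflection, which preserves the form.\<close>

lemma quad_diff_reflect:
  assumes "\<And>i j. A i j = A j i" "A i i = 1"
  shows "quad A (reflect A i c - reflect A i d) = quad A (c - d)"
proof -
  define v where "v = (\<Sum>j\<in>UNIV. A i j * (c - d) j)"
  have "wall A c i - wall A d i = v"
    by (simp add: wall_def v_def sum_subtractf [symmetric] right_diff_distrib)
  then have "reflect A i c - reflect A i d = (c - d)(i := (c - d) i + (- 2 * v))"
    by (auto simp: reflect_def algebra_simps)
  then show ?thesis
    using quad_fun_upd[of A "c - d" i "- 2 * v", OF assms(1)]
    by (simp only: v_def [symmetric]) (simp add: assms(2) power2_eq_square)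
qed

section \<open>Angles of the triangle and the action of words\<close>

fun nxt :: "tri_gen \<Rightarrow> tri_gen" where
  "nxt gen_a = gen_b" | "nxt gen_b = gen_c" | "nxt gen_c = gen_a"

lemma UNIV_tri_gen: "UNIV = {gen_a, gen_b, gen_c}"
  using tri_gen.exhaust by auto

instance tri_gen :: finite
  by standard (simp add: UNIV_tri_gen)

lemma sum_tri_gen: "sum f (UNIV :: tri_gen set) = f gen_a + f gen_b + f gen_c"
  by (simp add: UNIV_tri_gen add.assoc)

fun tri_ord :: "nat \<Rightarrow> nat \<Rightarrow> nat \<Rightarrow> tri_gen \<Rightarrow> nat" where
  "tri_ord p q r gen_a = p" | "tri_ord p q r gen_b = q" | "tri_ord p q r gen_c = r"

text \<open>The default 1 on the diagonal makes \<open>tri_gram\<close> equal to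
  \<open>- cos pi\<close>, that is 1, there.\<close>

definition tri_m :: "nat \<Rightarrow> nat \<Rightarrow> nat \<Rightarrow> tri_gen \<Rightarrow> tri_gen \<Rightarrow> nat" where
  "tri_m p q r i j = (if j = nxt i then tri_ord p q r i else if i = nxt j then tri_ord p q r j else 1)"

definition tri_gram :: "nat \<Rightarrow> nat \<Rightarrow> nat \<Rightarrow> tri_gen \<Rightarrow> tri_gen \<Rightarrow> real" where
  "tri_gram p q r i j = - cos (pi / tri_m p q r i j)"

lemma nxt_neq [simp]: "nxt x \<noteq> x" "x \<noteq> nxt x"
  by (cases x; simp)+

lemma nxt_cases: "i \<noteq> j \<Longrightarrow> j = nxt i \<or> i = nxt j"
  by (cases i; cases j) auto

lemma tri_m_sym: "tri_m p q r i j = tri_m p q r j i"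
  by (cases i; cases j) (auto simp: tri_m_def)

lemma tri_m_nxt [simp]: "tri_m p q r x (nxt x) = tri_ord p q r x"
  by (simp add: tri_m_def)

lemma tri_m_nxt' [simp]: "tri_m p q r (nxt x) x = tri_ord p q r x"
  by (cases x) (auto simp: tri_m_def)

lemma tri_gram_diag [simp]: "tri_gram p q r i i = 1"
  by (cases i) (auto simp: tri_gram_def tri_m_def)

lemma tri_gram_sym: "tri_gram p q r i j = tri_gram p q r j i"
  by (simp add: tri_gram_def tri_m_sym[of p q r i j])

text \<open>The generator \<open>x\<close> is the rotation about the vertex where the walls
  \<open>x\<close> and \<open>nxt x\<close> meet. Words act from the right, first letter first, so
  that the reflections cancel cyclically in \<open>abc\<close>.\<close>

fun letter_act :: "nat \<Rightarrow> nat \<Rightarrow> nat \<Rightarrow> tri_gen \<times> bool \<Rightarrow> (tri_gen \<Rightarrow> real) \<Rightarrow> (tri_gen \<Rightarrow> real)" where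
  "letter_act p q r (x, True) = reflect (tri_gram p q r) (nxt x) \<circ> reflect (tri_gram p q r) x"
| "letter_act p q r (x, False) = reflect (tri_gram p q r) x \<circ> reflect (tri_gram p q r) (nxt x)"

locale triangle_group =
  fixes p q r :: nat
  assumes pqr: "p \<ge> 2" "q \<ge> 2" "r \<ge> 2"
begin

abbreviation "G \<equiv> tri_group_pos p q r"
abbreviation "el \<equiv> tri_elem p q r"
abbreviation "cls \<equiv> pres_class (tri_relators p q r)"
abbreviation "A \<equiv> tri_gram p q r"
abbreviation "act \<equiv> letter_act p q r"

sublocale group "tri_group_pos p q r"
  unfolding tri_group_pos_def by (rule group_presented_group)

lemma tri_ord_ge_2: "tri_ord p q r x \<ge> 2"
  by (cases x) (auto simp: pqr)

lemma tri_m_ge_2: "i \<noteq> j \<Longrightarrow> tri_m p q r i j \<ge> 2"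
  using nxt_cases[of i j] tri_ord_ge_2 by auto

lemma cls_in [simp]: "cls w \<in> carrier G"
  by (simp add: tri_group_pos_def presented_group_def)

lemma el_in [simp]: "el x \<in> carrier G"
  by (simp add: tri_elem_def)

lemma cls_mult: "cls u \<otimes>\<^bsub>G\<^esub> cls v = cls (u @ v)"
  by (simp add: tri_group_pos_def pres_mult)

lemma cls_Nil: "cls [] = \<one>\<^bsub>G\<^esub>"
  by (simp add: tri_group_pos_def presented_group_def)

lemma cls_replicate: "cls (replicate n (x, True)) = el x [^]\<^bsub>G\<^esub> n"
proof (induction n)
  case (Suc n)
  have "cls (replicate (Suc n) (x, True)) = cls (replicate n (x, True)) \<otimes>\<^bsub>G\<^esub> cls [(x, True)]"
    by (simp add: cls_mult replicate_append_same)
  then show ?case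
    by (simp add: Suc tri_elem_def)
qed (simp add: cls_Nil)

lemma cls_relator: "w \<in> tri_relators p q r \<Longrightarrow> cls w = \<one>\<^bsub>G\<^esub>"
  using pres_eq.relator[of w "tri_relators p q r" "[]" "[]"]
  by (simp add: cls_Nil [symmetric] pres_class_eq_iff)

lemma el_pow_ord: "el x [^]\<^bsub>G\<^esub> tri_ord p q r x = \<one>\<^bsub>G\<^esub>"
proof -
  have "replicate (tri_ord p q r x) (x, True) \<in> tri_relators p q r"
    by (cases x) (auto simp: tri_relators_def)
  from cls_relator[OF this] show ?thesis
    by (simp only: cls_replicate)
qed

lemma el_abc: "el gen_a \<otimes>\<^bsub>G\<^esub> el gen_b \<otimes>\<^bsub>G\<^esub> el gen_c = \<one>\<^bsub>G\<^esub>"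
proof -
  have "[(gen_a, True), (gen_b, True), (gen_c, True)] \<in> tri_relators p q r"
    by (simp add: tri_relators_def)
  from cls_relator[OF this] show ?thesis
    by (simp add: tri_elem_def cls_mult)
qed

lemma el_c: "el gen_c = inv\<^bsub>G\<^esub> el gen_b \<otimes>\<^bsub>G\<^esub> inv\<^bsub>G\<^esub> el gen_a"
proof -
  have "inv\<^bsub>G\<^esub> el gen_c = el gen_a \<otimes>\<^bsub>G\<^esub> el gen_b"
    using el_abc by (rule inv_equality) auto
  then have "inv\<^bsub>G\<^esub> (inv\<^bsub>G\<^esub> el gen_c) = inv\<^bsub>G\<^esub> el gen_b \<otimes>\<^bsub>G\<^esub> inv\<^bsub>G\<^esub> el gen_a"
    by (simp add: inv_mult_group)
  then show ?thesis by simp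
qed

lemma inv_el: "inv\<^bsub>G\<^esub> el x = cls [(x, False)]"
proof (rule inv_equality)
  have "cls [(x, False)] \<otimes>\<^bsub>G\<^esub> el x = cls [(x, False), (x, True)]"
    by (simp add: tri_elem_def cls_mult)
  also have "\<dots> = \<one>\<^bsub>G\<^esub>"
    using pres_eq.cancel[of "tri_relators p q r" "[]" x False "[]"]
    by (simp add: cls_Nil [symmetric] pres_class_eq_iff)
  finally show "cls [(x, False)] \<otimes>\<^bsub>G\<^esub> el x = \<one>\<^bsub>G\<^esub>" .
qed auto

lemma carrier_cases:
  assumes "g \<in> carrier G"
  obtains w where "g = cls w"
  using assms by (auto simp: tri_group_pos_def presented_group_def)

lemma tri_group_induct [consumes 1, case_names one mult mult_inv]:
  assumes "g \<in> carrier G" "P \<one>\<^bsub>G\<^esub>"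
    "\<And>g x. g \<in> carrier G \<Longrightarrow> P g \<Longrightarrow> P (g \<otimes>\<^bsub>G\<^esub> el x)"
    "\<And>g x. g \<in> carrier G \<Longrightarrow> P g \<Longrightarrow> P (g \<otimes>\<^bsub>G\<^esub> inv\<^bsub>G\<^esub> el x)"
  shows "P g"
proof -
  have "P (cls w)" for w
  proof (induction w rule: rev_induct)
    case Nil
    then show ?case using assms(2) by (simp add: cls_Nil)
  next
    case (snoc l w)
    obtain x e where l: "l = (x, e)" by force
    have "cls (w @ [l]) = cls w \<otimes>\<^bsub>G\<^esub> (if e then el x else inv\<^bsub>G\<^esub> el x)"
      by (cases e) (simp_all add: l inv_el cls_mult, simp add: tri_elem_def cls_mult)
    then show ?case
      using assms(3,4)[OF _ snoc, of x] by auto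
  qed
  with assms(1) show ?thesis
    by (auto elim: carrier_cases)
qed

lemma reflect_reflect_tri [simp]: "reflect A i (reflect A i c) = c"
  by (simp add: reflect_reflect)

lemma reflect_braid_tri: "i \<noteq> j \<Longrightarrow> ((reflect A j \<circ> reflect A i) ^^ tri_m p q r i j) c = c"
  using reflect_braid[of i j A "tri_m p q r i j"] tri_m_ge_2[of i j] tri_m_sym[of p q r i j]
  by (simp add: tri_gram_def [of p q r i j] tri_gram_def [of p q r j i])

lemma fold_replicate: "fold f (replicate n x) = f x ^^ n"
  by (induction n) (auto simp: funpow_swap1 fun_eq_iff)

lemma fold_act_relator:
  assumes "w \<in> tri_relators p q r"
  shows "fold act w c = c"
proof -
  have "fold act (replicate (tri_ord p q r x) (x, True)) c = c" for x
    using reflect_braid_tri[of x "nxt x"] by (simp add: fold_replicate)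
  from this[of gen_a] this[of gen_b] this[of gen_c] show ?thesis
    using assms by (auto simp: tri_relators_def)
qed

lemma fold_act_cong: "pres_eq (tri_relators p q r) u v \<Longrightarrow> fold act u c = fold act v c"
proof (induction arbitrary: c rule: pres_eq.induct)
  case (cancel u x e v)
  then show ?case by (cases e) auto
qed (auto simp: fold_act_relator)

text \<open>The base point as seen from the chamber of \<open>g\<close>; in terms of a left action
  it is moved by the inverse of \<open>g\<close>. Hence right multiplication acts on it by
  isometries.\<close>

definition pt :: "(tri_gen \<times> bool) list set \<Rightarrow> tri_gen \<Rightarrow> real" where
  "pt g = fold act (SOME w. g = cls w) (\<lambda>_. 0)"

lemma pt_cls: "pt (cls w) = fold act w (\<lambda>_. 0)"
proof -
  have "cls w = cls (SOME v. cls w = cls v)"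
    by (rule someI) simp
  then have "pres_eq (tri_relators p q r) w (SOME v. cls w = cls v)"
    by (simp only: pres_class_eq_iff)
  from fold_act_cong[OF this] show ?thesis
    unfolding pt_def by simp
qed

lemma pt_mult_cls: "g \<in> carrier G \<Longrightarrow> pt (g \<otimes>\<^bsub>G\<^esub> cls w) = fold act w (pt g)"
  by (elim carrier_cases) (simp add: cls_mult pt_cls)

lemma pt_one: "pt \<one>\<^bsub>G\<^esub> = (\<lambda>_. 0)"
  using pt_cls[of "[]"] by (simp add: cls_Nil)

lemma pt_mult_el: "g \<in> carrier G \<Longrightarrow> pt (g \<otimes>\<^bsub>G\<^esub> el x) = reflect A (nxt x) (reflect A x (pt g))"
  using pt_mult_cls[of g "[(x, True)]"] by (simp add: tri_elem_def)

lemma pt_mult_inv_el: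
  "g \<in> carrier G \<Longrightarrow> pt (g \<otimes>\<^bsub>G\<^esub> inv\<^bsub>G\<^esub> el x) = reflect A x (reflect A (nxt x) (pt g))"
  using pt_mult_cls[of g "[(x, False)]"] by (simp add: inv_el)

text \<open>The chambers are the elements \<open>(g, e)\<close> of the full triangle group, with \<open>e\<close> telling whether
  the element preserves orientation. Crossing the \<open>i\<close>-th wall is right multiplication by the \<open>i\<close>-th
  reflection; the second reflection is used to identify the two cosets.\<close>

fun tr :: "tri_gen \<Rightarrow> (tri_gen \<times> bool) list set" where
  "tr gen_a = el gen_a" | "tr gen_b = \<one>\<^bsub>G\<^esub>" | "tr gen_c = inv\<^bsub>G\<^esub> el gen_b"

lemma tr_in [simp]: "tr i \<in> carrier G"
  by (cases i) auto

text \<open>\<open>tr i\<close> stands for the product of the \<open>i\<close>-th and the second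
  reflection, and the latter cancels here. For \<open>gen_c\<close> this is the relation
  \<open>abc = 1\<close>.\<close>

lemma tr_nxt: "tr x \<otimes>\<^bsub>G\<^esub> inv\<^bsub>G\<^esub> tr (nxt x) = el x"
  by (cases x) (auto simp: el_c)

lemma tr_nxt': "tr (nxt x) \<otimes>\<^bsub>G\<^esub> inv\<^bsub>G\<^esub> tr x = inv\<^bsub>G\<^esub> el x"
  by (simp add: tr_nxt [symmetric] inv_mult_group)

fun adj :: "tri_gen \<Rightarrow> (tri_gen \<times> bool) list set \<times> bool \<Rightarrow> (tri_gen \<times> bool) list set \<times> bool" where
  "adj i (g, True) = (g \<otimes>\<^bsub>G\<^esub> tr i, False)"
| "adj i (g, False) = (g \<otimes>\<^bsub>G\<^esub> inv\<^bsub>G\<^esub> tr i, True)"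

fun chpt :: "(tri_gen \<times> bool) list set \<times> bool \<Rightarrow> tri_gen \<Rightarrow> real" where
  "chpt (g, True) = pt g"
| "chpt (g, False) = reflect A gen_b (pt g)"

lemma chpt_adj:
  assumes "x \<in> carrier G \<times> UNIV"
  shows "chpt (adj i x) = reflect A i (chpt x)"
proof -
  obtain g e where x: "x = (g, e)" and g: "g \<in> carrier G"
    using assms by auto
  show ?thesis
    by (cases e; cases i) (simp_all add: x g pt_mult_el pt_mult_inv_el)
qed

lemma tr_pow:
  assumes "i \<noteq> j"
  shows "(tr i \<otimes>\<^bsub>G\<^esub> inv\<^bsub>G\<^esub> tr j) [^]\<^bsub>G\<^esub> tri_m p q r i j = \<one>\<^bsub>G\<^esub>"
  using nxt_cases[OF assms]
  by (auto simp: tr_nxt tr_nxt' el_pow_ord nat_pow_inv)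

lemma adj_adj: "x \<in> carrier G \<times> UNIV \<Longrightarrow> adj i (adj i x) = x"
  by (cases "(i, x)" rule: adj.cases) (auto simp: m_assoc)

lemma adj_in: "x \<in> carrier G \<times> UNIV \<Longrightarrow> adj i x \<in> carrier G \<times> UNIV"
  by (cases "(i, x)" rule: adj.cases) auto

lemma adj_True_pow:
  assumes "g \<in> carrier G"
  shows "((adj j \<circ> adj i) ^^ n) (g, True) = (g \<otimes>\<^bsub>G\<^esub> (tr i \<otimes>\<^bsub>G\<^esub> inv\<^bsub>G\<^esub> tr j) [^]\<^bsub>G\<^esub> n, True)"
  using assms by (induction n) (auto simp: m_assoc)

lemma adj_braid:
  assumes "i \<noteq> j" "x \<in> carrier G \<times> UNIV"
  shows "((adj j \<circ> adj i) ^^ tri_m p q r i j) x = x"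
proof -
  have *: "((adj j \<circ> adj i) ^^ tri_m p q r i j) (g, True) = (g, True)" if "g \<in> carrier G" "i \<noteq> j" for g i j
    using adj_True_pow[OF that(1)] tr_pow[OF that(2)] that by simp
  obtain g e where x: "x = (g, e)" and g: "g \<in> carrier G"
    using assms by auto
  show ?thesis
  proof (cases e)
    case True
    then show ?thesis using * g assms by (simp add: x)
  next
    case False
    \<comment> \<open>An orientation reversing chamber is replaced by its orientation preserving
      neighbour \<open>y\<close>: conjugation by \<open>adj i\<close> exchanges the order of the two
      reflections.\<close>
    define y where "y = adj i x"
    have y: "y = (g \<otimes>\<^bsub>G\<^esub> inv\<^bsub>G\<^esub> tr i, True)"
      by (simp add: y_def x False)
    have yx: "x = adj i y"
      using assms by (simp add: y_def adj_adj)
    have in_y: "((adj i \<circ> adj j) ^^ n) y \<in> carrier G \<times> UNIV" for n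
      by (induction n) (use g y in \<open>auto simp del: adj.simps simp: adj_in\<close>)
    have "((adj j \<circ> adj i) ^^ n) x = adj i (((adj i \<circ> adj j) ^^ n) y)" for n
    proof (induction n)
      case (Suc n)
      then show ?case
        using in_y[of n] by (simp add: adj_adj adj_in comp_def)
    qed (simp add: yx)
    then have "((adj j \<circ> adj i) ^^ tri_m p q r i j) x = adj i (((adj i \<circ> adj j) ^^ tri_m p q r j i) y)"
      by (simp add: tri_m_sym[of p q r i j])
    also have "((adj i \<circ> adj j) ^^ tri_m p q r j i) y = y"
      unfolding y by (rule *) (use assms(1) g in auto)
    finally show ?thesis
      by (simp only: yx [symmetric])
  qed
qed

lemma adj_connected:
  assumes "x \<in> carrier G \<times> UNIV"
  shows "\<exists>w. fold adj w (\<one>\<^bsub>G\<^esub>, True) = x"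
proof -
  define P where "P x \<longleftrightarrow> (\<exists>w. fold adj w (\<one>\<^bsub>G\<^esub>, True) = x)" for x
  have step: "P (adj i x)" if "P x" for i x
  proof -
    from that obtain w where "fold adj w (\<one>\<^bsub>G\<^esub>, True) = x"
      unfolding P_def by blast
    then have "fold adj (w @ [i]) (\<one>\<^bsub>G\<^esub>, True) = adj i x"
      by simp
    then show ?thesis
      unfolding P_def by blast
  qed
  have T: "P (g, True)" if "g \<in> carrier G" for g
    using that
  proof (induction g rule: tri_group_induct)
    case one
    have "fold adj [] (\<one>\<^bsub>G\<^esub>, True) = (\<one>\<^bsub>G\<^esub>, True)"
      by simp
    then show ?case unfolding P_def by blast
  next
    case (mult g x)
    then show ?case
      using step[OF step[of "(g, True)" x], of "nxt x"] by (simp add: m_assoc tr_nxt)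
  next
    case (mult_inv g x)
    then show ?case
      using step[OF step[of "(g, True)" "nxt x"], of x] by (simp add: m_assoc tr_nxt')
  qed
  obtain g e where x: "x = (g, e)" and g: "g \<in> carrier G"
    using assms by auto
  have "P x"
    using T[OF g] step[OF T[OF g], of gen_b] g by (cases e) (auto simp: x)
  then show ?thesis by (simp add: P_def)
qed

sublocale chamber_system "tri_m p q r" adj "carrier G \<times> UNIV" "(\<one>\<^bsub>G\<^esub>, True)" snd "\<lambda>x. wall A (chpt x)"
proof
  fix i j :: tri_gen and x assume x: "x \<in> carrier G \<times> (UNIV :: bool set)"
  show "\<exists>w. fold adj w (\<one>\<^bsub>G\<^esub>, True) = x"
    by (rule adj_connected[OF x])
  show "adj i (adj i x) = x"
    by (rule adj_adj[OF x])
  show "snd (adj i x) \<longleftrightarrow> \<not> snd x"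
    by (cases "(i, x)" rule: adj.cases) auto
  show "wall A (chpt (adj i x)) i = - wall A (chpt x) i"
    by (simp add: chpt_adj[OF x] wall_reflect)
  show "wall A (chpt (adj i x)) j = wall A (chpt x) j + 2 * cos (pi / tri_m p q r i j) * wall A (chpt x) i"
    by (simp add: chpt_adj[OF x] wall_reflect tri_gram_def tri_m_sym[of p q r j i])
  show "((adj j \<circ> adj i) ^^ tri_m p q r i j) x = x" if "i \<noteq> j"
    by (rule adj_braid[OF that x])
  show "adj i x \<in> carrier G \<times> UNIV"
    by (rule adj_in[OF x])
next
  fix i j :: tri_gen
  show "2 \<le> tri_m p q r i j" if "i \<noteq> j"
    by (rule tri_m_ge_2[OF that])
  show "tri_m p q r i j = tri_m p q r j i"
    by (rule tri_m_sym)
  show "wall A (chpt (\<one>\<^bsub>G\<^esub>, True)) i = 1"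
    by (simp add: pt_one wall_def)
qed auto

text \<open>The invariant of \<open>quad_sum_reflect\<close> vanishes at the base point. Its zero
  set is the model surface: an ellipsoid, a paraboloid or a hyperboloid, according to the sign of
  the determinant.\<close>

lemma quad_chpt:
  assumes "x \<in> carrier G \<times> UNIV"
  shows "quad A (chpt x) + 2 * sum (chpt x) UNIV = 0"
proof -
  have "quad A (chpt (fold adj w (\<one>\<^bsub>G\<^esub>, True))) + 2 * sum (chpt (fold adj w (\<one>\<^bsub>G\<^esub>, True))) UNIV = 0" for w
  proof (induction w rule: rev_induct)
    case (snoc i w)
    then show ?case
      using quad_sum_reflect[of A i] tri_gram_sym[of p q r] chpt_adj[OF fold_in[OF x0]] by simp
  qed (simp add: pt_one quad_def)
  moreover obtain w where "fold adj w (\<one>\<^bsub>G\<^esub>, True) = x"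
    using adj_connected[OF assms] by blast
  ultimately show ?thesis
    by blast
qed

text \<open>By \<open>sum_reflect\<close> crossing a wall changes the coefficient sum by
  \<open>-2\<close> times the height, and on the way down this height is at most \<open>-1\<close>
  by \<open>u_descent\<close>.\<close>

lemma len_le_sum:
  assumes "x \<in> carrier G \<times> UNIV"
  shows "2 * real (len x) \<le> - sum (chpt x) UNIV"
  using assms
proof (induction "len x" arbitrary: x)
  case 0
  then show ?case
    using len_eq_0[of x] by (simp add: pt_one)
next
  case (Suc n)
  then have "x \<noteq> (\<one>\<^bsub>G\<^esub>, True)"
    using len_x0 by force
  then obtain i where i: "Suc (len (adj i x)) = len x"
    using len_descent Suc.prems by blast
  have "2 * real (len (adj i x)) \<le> - sum (chpt (adj i x)) UNIV"
    using Suc.hyps(1)[of "adj i x"] Suc.hyps(2) i adj_in[OF Suc.prems] by simp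
  then show ?case
    using u_descent[OF Suc.prems i] i by (simp add: chpt_adj[OF Suc.prems] sum_reflect)
qed

end

section \<open>Generalized Alexander quandles of inner automorphisms\<close>


locale conj_quandle = group G for G :: "('a, 'm) monoid_scheme" (structure) +
  fixes a :: 'a
  assumes a_in [simp]: "a \<in> carrier G"
begin

definition Q :: "'a quandle" where
  "Q = GAlex G (\<lambda>g. inv a \<otimes> g \<otimes> a)"

sublocale quandle Q
  unfolding Q_def by (rule quandle_GAlex[OF conj_iso[OF a_in]])

abbreviation "Aut \<equiv> quandle_aut Q"

sublocale Aut: group Aut
  by (rule group_quandle_aut)

definition cj :: "'a \<Rightarrow> 'a" where
  "cj x = inv x \<otimes> a \<otimes> x"

definition disp_gens :: "'a set" where
  "disp_gens = {cj x \<otimes> inv (cj y) |x y. x \<in> carrier G \<and> y \<in> carrier G}"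

definition H :: "'a set" where
  "H = generate G disp_gens"

definition rtrans :: "'a \<Rightarrow> 'a \<Rightarrow> 'a" where
  "rtrans h = (\<lambda>z\<in>carrier G. z \<otimes> h)"

lemma carrier_Q [simp]: "carrier Q = carrier G"
  by (simp add: Q_def GAlex_def)

lemma cj_in [simp]: "x \<in> carrier G \<Longrightarrow> cj x \<in> carrier G"
  by (simp add: cj_def)

lemma disp_gens_subset: "disp_gens \<subseteq> carrier G"
  by (auto simp: disp_gens_def)

sublocale H: subgroup H G
  unfolding H_def by (rule generate_is_subgroup[OF disp_gens_subset])

lemma H_in [simp]: "h \<in> H \<Longrightarrow> h \<in> carrier G"
  by (rule H.mem_carrier)

lemma qop_eq: "x \<in> carrier G \<Longrightarrow> y \<in> carrier G \<Longrightarrow> x \<triangleleft>\<^bsub>Q\<^esub> y = inv a \<otimes> x \<otimes> cj y"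
  by (simp add: Q_def GAlex_def cj_def m_assoc)

lemma cj_mult:
  assumes "x \<in> carrier G" "g \<in> carrier G"
  shows "cj (x \<otimes> g) = inv g \<otimes> cj x \<otimes> g"
  using assms by (simp add: cj_def inv_mult_group m_assoc)

lemma disp_gens_in_H: "x \<in> carrier G \<Longrightarrow> y \<in> carrier G \<Longrightarrow> cj x \<otimes> inv (cj y) \<in> H"
  unfolding H_def by (rule generate.incl) (auto simp: disp_gens_def)

lemma H_normal: "H \<lhd> G"
  unfolding H_def
proof (rule normal_generateI)
  show "disp_gens \<subseteq> carrier G" by (rule disp_gens_subset)
  fix h g assume h: "h \<in> disp_gens" and g: "g \<in> carrier G"
  then obtain x y where xy: "x \<in> carrier G" "y \<in> carrier G" "h = cj x \<otimes> inv (cj y)"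
    by (auto simp: disp_gens_def)
  have canc: "inv g \<otimes> (g \<otimes> z) = z" if "z \<in> carrier G" for z
    using g that by (simp add: m_assoc [symmetric])
  have "g \<otimes> h \<otimes> inv g = cj (x \<otimes> inv g) \<otimes> inv (cj (y \<otimes> inv g))"
    using xy g by (simp add: cj_mult inv_mult_group m_assoc canc)
  then show "g \<otimes> h \<otimes> inv g \<in> disp_gens"
    using xy g by (auto simp: disp_gens_def)
qed

text \<open>\<open>cj\<close> turns right multiplication by \<open>h\<close> into conjugation by
  \<open>h\<close>, and the inner factors cancel.\<close>

lemma rtrans_in_Aut:
  assumes "h \<in> carrier G"
  shows "rtrans h \<in> carrier Aut"
proof -
  have "bij_betw (rtrans h) (carrier G) (carrier G)"
    by (rule bij_betw_byWitness[where f' = "\<lambda>x. x \<otimes> inv h"]) (use assms in \<open>auto simp: m_assoc rtrans_def\<close>)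
  moreover have "rtrans h (x \<triangleleft>\<^bsub>Q\<^esub> y) = rtrans h x \<triangleleft>\<^bsub>Q\<^esub> rtrans h y"
    if "x \<in> carrier G" "y \<in> carrier G" for x y
  proof -
    have canc: "h \<otimes> (inv h \<otimes> z) = z" if "z \<in> carrier G" for z
      using assms that by (simp add: m_assoc [symmetric])
    show ?thesis
      using that assms by (simp add: rtrans_def qop_eq cj_mult m_assoc canc)
  qed
  ultimately show ?thesis
    by (simp add: quandle_aut_def Bij_def rtrans_def)
qed

text \<open>The product in \<open>Aut\<close> applies the left factor first, so right translations
  multiply in the order of \<open>G\<close>.\<close>

lemma rtrans_hom: "rtrans \<in> hom G Aut"
proof (rule homI)
  fix h k assume hk: "h \<in> carrier G" "k \<in> carrier G"
  then show "rtrans (h \<otimes> k) = rtrans h \<otimes>\<^bsub>Aut\<^esub> rtrans k"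
    by (auto simp: rtrans_def quandle_aut_def compose_def fun_eq_iff m_assoc)
qed (rule rtrans_in_Aut)

sublocale rt: group_hom G Aut rtrans
  by unfold_locales (rule rtrans_hom)

lemma inj_rtrans: "inj_on rtrans (carrier G)"
proof (rule inj_onI)
  fix h k assume "h \<in> carrier G" "k \<in> carrier G" "rtrans h = rtrans k"
  then have "rtrans h \<one> = rtrans k \<one>" by simp
  then show "h = k"
    using \<open>h \<in> carrier G\<close> \<open>k \<in> carrier G\<close> by (simp add: rtrans_def)
qed

lemma point_sym_diff:
  assumes "x \<in> carrier G" "y \<in> carrier G"
  shows "point_sym Q x \<otimes>\<^bsub>Aut\<^esub> inv\<^bsub>Aut\<^esub> point_sym Q y = rtrans (cj x \<otimes> inv (cj y))"
proof -
  have canc: "inv (cj y) \<otimes> (cj y) = \<one>"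
    using assms by simp
  have "rtrans (cj x \<otimes> inv (cj y)) \<otimes>\<^bsub>Aut\<^esub> point_sym Q y = point_sym Q x"
    using assms
    by (auto simp: rtrans_def quandle_aut_def compose_def fun_eq_iff point_sym_def qop_eq m_assoc canc)
  moreover have "point_sym Q x \<in> carrier Aut" "point_sym Q y \<in> carrier Aut"
    using assms by (auto intro: point_sym_in_aut)
  ultimately show ?thesis
    using Aut.inv_solve_right'[of "rtrans (cj x \<otimes> inv (cj y))" "point_sym Q x" "point_sym Q y"] assms
    by (simp add: rtrans_in_Aut)
qed

lemma Dis_eq: "Dis Q = Aut\<lparr>carrier := rtrans ` H\<rparr>"
proof -
  have "{point_sym Q x \<otimes>\<^bsub>Aut\<^esub> inv\<^bsub>Aut\<^esub> point_sym Q y |x y. x \<in> carrier Q \<and> y \<in> carrier Q} = rtrans ` disp_gens"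
    by (force simp: disp_gens_def point_sym_diff)
  moreover have "carrier Aut \<inter> rtrans ` disp_gens = rtrans ` disp_gens"
    using disp_gens_subset rtrans_in_Aut by auto
  ultimately show ?thesis
    unfolding Dis_def subgroup_generated_def H_def
    by (simp add: rt.generate_img[OF disp_gens_subset])
qed

lemma carrier_Dis: "carrier (Dis Q) = rtrans ` H"
  by (simp add: Dis_eq)

lemma Dis_iso: "Dis Q \<cong> G\<lparr>carrier := H\<rparr>"
proof -
  have "rtrans \<in> iso (G\<lparr>carrier := H\<rparr>) (Dis Q)"
    using rt.hom_mult inj_rtrans
    by (auto simp: iso_def Dis_eq hom_def bij_betw_def intro: inj_on_subset)
  then show ?thesis
    using group.iso_sym[OF H.subgroup_is_group[OF is_group]] by (auto simp: is_iso_def)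
qed

lemma rtrans_subgroup: "subgroup (rtrans ` H) Aut"
  using rt.subgroup_img_is_subgroup[OF H.subgroup_axioms] .

lemma inv_Dis: "h \<in> H \<Longrightarrow> inv\<^bsub>Dis Q\<^esub> rtrans h = rtrans (inv h)"
  using Aut.m_inv_consistent[OF rtrans_subgroup, of "rtrans h"] by (simp add: Dis_eq)

lemma generate_Dis:
  assumes "V \<subseteq> H" "generate (Dis Q) (rtrans ` V) = carrier (Dis Q)"
  shows "generate G V = H"
proof -
  have V: "V \<subseteq> carrier G"
    using assms(1) H.subset by blast
  have "generate (Dis Q) (rtrans ` V) = generate Aut (rtrans ` V)"
    unfolding Dis_eq using Aut.generate_consistent[OF _ rtrans_subgroup, of "rtrans ` V"] assms(1) by auto
  also have "\<dots> = rtrans ` generate G V"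
    by (rule rt.generate_img[OF V])
  finally have "rtrans ` generate G V = rtrans ` H"
    using assms(2) carrier_Dis by simp
  moreover have "generate G V \<subseteq> carrier G"
    using generate_incl[OF V] .
  ultimately show ?thesis
    using inj_on_image_eq_iff[OF inj_rtrans _ H.subset] by blast
qed

section \<open>Connected components as cosets\<close>

definition coset_preserving :: "('a \<Rightarrow> 'a) set" where
  "coset_preserving = {f \<in> carrier Aut. \<forall>z\<in>carrier G. inv z \<otimes> f z \<in> H}"

lemma Aut_apply: "f \<in> carrier Aut \<Longrightarrow> z \<in> carrier G \<Longrightarrow> f z \<in> carrier G"
  by (auto simp: quandle_aut_def Bij_def bij_betw_def)

lemma coset_preserving_subgroup: "subgroup coset_preserving Aut"
proof (rule Aut.subgroupI)
  have 1: "\<one>\<^bsub>Aut\<^esub> = (\<lambda>x\<in>carrier G. x)"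
    by (simp add: quandle_aut_def)
  have "\<one>\<^bsub>Aut\<^esub> \<in> coset_preserving"
    using Aut.one_closed unfolding coset_preserving_def by (simp add: 1)
  then show "coset_preserving \<noteq> {}" by blast
next
  fix f assume f: "f \<in> coset_preserving"
  then have fA: "f \<in> carrier Aut"
    by (simp add: coset_preserving_def)
  define g where "g = inv\<^bsub>Aut\<^esub> f"
  have gA: "g \<in> carrier Aut"
    using fA by (simp add: g_def)
  have "g \<otimes>\<^bsub>Aut\<^esub> f = \<one>\<^bsub>Aut\<^esub>"
    using fA by (simp add: g_def)
  then have fg: "f (g z) = z" if "z \<in> carrier G" for z
    using that by (auto simp: quandle_aut_def compose_def fun_eq_iff restrict_def split: if_splits)
  have "inv z \<otimes> g z \<in> H" if z: "z \<in> carrier G" for z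
  proof -
    have "inv (inv (g z) \<otimes> f (g z)) \<in> H"
      using f Aut_apply[OF gA z] unfolding coset_preserving_def by blast
    then show ?thesis
      using z Aut_apply[OF gA z] by (simp add: fg inv_mult_group)
  qed
  then show "inv\<^bsub>Aut\<^esub> f \<in> coset_preserving"
    using gA by (simp add: coset_preserving_def g_def)
next
  fix f g assume f: "f \<in> coset_preserving" and g: "g \<in> coset_preserving"
  then have A: "f \<in> carrier Aut" "g \<in> carrier Aut"
    by (auto simp: coset_preserving_def)
  have "inv z \<otimes> (f \<otimes>\<^bsub>Aut\<^esub> g) z \<in> H" if z: "z \<in> carrier G" for z
  proof -
    have fz: "f z \<in> carrier G"
      by (rule Aut_apply[OF A(1) z])
    have "(inv z \<otimes> f z) \<otimes> (inv (f z) \<otimes> g (f z)) \<in> H"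
      by (rule H.m_closed) (use f g z fz in \<open>auto simp: coset_preserving_def\<close>)
    also have "(inv z \<otimes> f z) \<otimes> (inv (f z) \<otimes> g (f z)) = inv z \<otimes> g (f z)"
      using z fz Aut_apply[OF A(2) fz] by (metis inv_closed l_inv l_one m_assoc m_closed r_inv)
    finally show ?thesis
      using z by (simp add: quandle_aut_def compose_def)
  qed
  then show "f \<otimes>\<^bsub>Aut\<^esub> g \<in> coset_preserving"
    using A by (simp add: coset_preserving_def)
qed (auto simp: coset_preserving_def)

text \<open>The quotient of the image of \<open>z\<close> by \<open>z\<close> is
  \<open>inv (cj z)\<close> times \<open>cj y\<close>, a conjugate of a generator of
  \<open>H\<close>.\<close>

lemma point_sym_coset_preserving:
  assumes "y \<in> carrier G"
  shows "point_sym Q y \<in> coset_preserving"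
proof -
  have "inv z \<otimes> point_sym Q y z \<in> H" if z: "z \<in> carrier G" for z
  proof -
    have "inv (cj z) \<otimes> (cj y \<otimes> inv (cj z)) \<otimes> cj z \<in> H"
      using normal.inv_op_closed1[OF H_normal, of "cj z"] disp_gens_in_H[OF assms z] z by simp
    also have "inv (cj z) \<otimes> (cj y \<otimes> inv (cj z)) \<otimes> cj z = inv (cj z) \<otimes> cj y"
      using z assms by (simp add: m_assoc)
    also have "\<dots> = inv z \<otimes> (inv a \<otimes> z \<otimes> cj y)"
      using z assms by (simp add: cj_def[of z] inv_mult_group m_assoc)
    finally show ?thesis
      using z assms by (simp add: point_sym_def qop_eq)
  qed
  then show ?thesis
    using assms point_sym_in_aut by (simp add: coset_preserving_def)
qed

text \<open>\<open>Inn\<close> may be larger than the group of translations by \<open>H\<close>, but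
  it lies between this group and \<open>coset_preserving\<close>, which have the same
  orbits.\<close>

lemma component_eq_coset:
  assumes "C \<in> quandle_components Q"
  obtains x where "x \<in> carrier G" "C = (\<lambda>h. x \<otimes> h) ` H"
proof -
  obtain x where x: "x \<in> carrier G" and C: "C = {f x |f. f \<in> carrier (Inn Q)}"
    using assms by (auto simp: quandle_components_def)
  have ps: "carrier Aut \<inter> point_sym Q ` carrier Q = point_sym Q ` carrier Q"
    using point_sym_in_aut by auto
  have Inn: "carrier (Inn Q) = generate Aut (point_sym Q ` carrier Q)"
    by (simp only: Inn_def carrier_subgroup_generated ps)
  have "carrier (Inn Q) \<subseteq> coset_preserving"
    unfolding Inn
    by (rule Aut.generate_subgroup_incl[OF _ coset_preserving_subgroup])
      (auto intro: point_sym_coset_preserving)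
  then have 1: "C \<subseteq> (\<lambda>h. x \<otimes> h) ` H"
  proof (intro subsetI)
    fix z assume sub: "carrier (Inn Q) \<subseteq> coset_preserving" and "z \<in> C"
    then obtain f where f: "f \<in> coset_preserving" "z = f x"
      by (auto simp: C)
    then have "inv x \<otimes> z \<in> H" "z \<in> carrier G"
      using x Aut_apply by (auto simp: coset_preserving_def)
    moreover from this have "z = x \<otimes> (inv x \<otimes> z)"
      using x by (simp add: m_assoc [symmetric])
    ultimately show "z \<in> (\<lambda>h. x \<otimes> h) ` H" by blast
  qed
  have "subgroup (carrier (Inn Q)) Aut"
    unfolding Inn by (rule Aut.generate_is_subgroup) (use point_sym_in_aut in auto)
  then have "rtrans h \<in> carrier (Inn Q)" if "h \<in> disp_gens" for h
  proof -
    assume sg: "subgroup (carrier (Inn Q)) Aut"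
    have "point_sym Q y \<in> carrier (Inn Q)" if "y \<in> carrier G" for y
      unfolding Inn using that by (auto intro: generate.incl)
    then have "point_sym Q x \<otimes>\<^bsub>Aut\<^esub> inv\<^bsub>Aut\<^esub> point_sym Q y \<in> carrier (Inn Q)"
      if "x \<in> carrier G" "y \<in> carrier G" for x y
      using that sg by (simp add: subgroup.m_closed subgroup.m_inv_closed)
    with that show ?thesis
      by (auto simp: disp_gens_def point_sym_diff simp del: rt.hom_mult)
  qed
  then have "generate Aut (rtrans ` disp_gens) \<subseteq> carrier (Inn Q)"
    using \<open>subgroup (carrier (Inn Q)) Aut\<close> by (intro Aut.generate_subgroup_incl) auto
  then have "rtrans ` H \<subseteq> carrier (Inn Q)"
    unfolding H_def rt.generate_img[OF disp_gens_subset] .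
  then have "rtrans h x \<in> C" if "h \<in> H" for h
    using that by (auto simp: C)
  then have "(\<lambda>h. x \<otimes> h) ` H \<subseteq> C"
    using x by (auto simp: rtrans_def)
  with 1 x that show ?thesis by blast
qed

end

section \<open>Word length for an arbitrary finite generating set\<close>

locale dis_graph = conj_quandle +
  fixes V :: "'a set" and W :: "'a set"
  assumes V: "V \<subseteq> H" "finite V" "generate G V = H"
    and W: "W \<subseteq> carrier G" "finite W" "\<And>g. g \<in> carrier G \<Longrightarrow> \<exists>w\<in>W. g \<otimes> inv w \<in> H"
begin

abbreviation "E \<equiv> dis_edges Q (rtrans ` V)"

lemma V_in [simp]: "v \<in> V \<Longrightarrow> v \<in> carrier G"
  using V(1) H.subset by blast

lemma edges_eq: "E = {(y, y \<otimes> v) |y v. y \<in> carrier G \<and> v \<in> V \<union> m_inv G ` V}"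
proof -
  define V' where "V' = V \<union> m_inv G ` V"
  have V': "v \<in> carrier G" if "v \<in> V'" for v
    using that by (auto simp: V'_def)
  have "m_inv (Dis Q) ` rtrans ` V = rtrans ` m_inv G ` V"
    using V(1) inv_Dis by (force simp: image_image)
  then have U: "rtrans ` V \<union> m_inv (Dis Q) ` rtrans ` V = rtrans ` V'"
    by (simp add: V'_def image_Un)
  have "(y, z) \<in> E \<longleftrightarrow> y \<in> carrier G \<and> (\<exists>v\<in>V'. z = y \<otimes> v)" for y z
    unfolding dis_edges_def U using V' by (auto simp: rtrans_def)
  then show ?thesis
    unfolding V'_def [symmetric] by auto
qed

text \<open>All starting points can be treated at once because the graph is invariant under left
  multiplication. The number of steps is exact, but it serves as an upper bound for the
  distance.\<close>

definition steps :: "nat \<Rightarrow> 'a \<Rightarrow> bool" where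
  "steps n h \<longleftrightarrow> (\<forall>y\<in>carrier G. (y, y \<otimes> h) \<in> E ^^ n)"

lemma steps_add:
  assumes "steps m h" "steps n k" "h \<in> carrier G" "k \<in> carrier G"
  shows "steps (m + n) (h \<otimes> k)"
  unfolding steps_def
proof
  fix y assume y: "y \<in> carrier G"
  have "(y, y \<otimes> h) \<in> E ^^ m" "(y \<otimes> h, y \<otimes> h \<otimes> k) \<in> E ^^ n"
    using assms y by (auto simp: steps_def)
  then show "(y, y \<otimes> (h \<otimes> k)) \<in> E ^^ (m + n)"
    using y assms by (auto simp: relpow_add m_assoc)
qed

lemma steps_exist:
  assumes "h \<in> H"
  shows "\<exists>n. steps n h"
proof -
  have 1: "steps 1 v" if "v \<in> V \<union> m_inv G ` V" for v
    using that by (auto simp: steps_def edges_eq)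
  from assms have "h \<in> generate G V"
    by (simp add: V(3))
  then show ?thesis
  proof (induction rule: generate.induct)
    case one
    have "steps 0 \<one>"
      by (simp add: steps_def)
    then show ?case by blast
  next
    case (eng h k)
    then have "h \<in> carrier G" "k \<in> carrier G"
      using V(3) H.subset by auto
    then show ?case
      using eng.IH steps_add by blast
  qed (use 1 in blast)+
qed

lemma steps_finite:
  assumes "finite F"
  shows "\<exists>N. \<forall>h\<in>F \<inter> H. \<exists>n\<le>N. steps n h"
proof -
  have "\<forall>h. \<exists>n. h \<in> H \<longrightarrow> steps n h"
    using steps_exist by blast
  then obtain f where f: "\<And>h. h \<in> H \<Longrightarrow> steps (f h) h"
    by metis
  have "f h \<le> Max (f ` F)" if "h \<in> F" for h
    using that assms by simp
  then show ?thesis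
    using f by (meson IntD1 IntD2)
qed

text \<open>The Schreier rewriting process: a word in \<open>S\<close> is followed in the coset space.\<close>

lemma undistorted:
  assumes S: "finite S" "S \<subseteq> carrier G"
  shows "\<exists>K. \<forall>ss. set ss \<subseteq> S \<longrightarrow> foldl (\<otimes>) \<one> ss \<in> H \<longrightarrow>
    (\<exists>n. n \<le> K * Suc (length ss) \<and> steps n (foldl (\<otimes>) \<one> ss))"
proof -
  \<comment> \<open>Besides the Schreier generators, \<open>B\<close> holds the pieces for the two
    ends of a word: passing to the representative of \<open>H\<close> itself at the start, and
    removing it at the end.\<close>
  define B where "B = (\<lambda>(w, s, w'). w \<otimes> s \<otimes> inv w') ` (W \<times> S \<times> W) \<union> m_inv G ` W \<union> W"
  have "finite B"
    using W(2) S(1) by (simp add: B_def)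
  then obtain N where N: "\<And>h. h \<in> B \<Longrightarrow> h \<in> H \<Longrightarrow> \<exists>n\<le>N. steps n h"
    using steps_finite by (metis IntI)
  have S_in: "s \<in> carrier G" if "s \<in> S" for s
    using that S(2) by blast
  have W_in: "w \<in> carrier G" if "w \<in> W" for w
    using that W(1) by blast
  have main: "foldl (\<otimes>) \<one> ss \<in> carrier G \<and> (\<exists>w\<in>W. foldl (\<otimes>) \<one> ss \<otimes> inv w \<in> H \<and>
      (\<exists>n. n \<le> N * Suc (length ss) \<and> steps n (foldl (\<otimes>) \<one> ss \<otimes> inv w)))"
    if "set ss \<subseteq> S" for ss
    using that
  proof (induction ss rule: rev_induct)
    case Nil
    obtain w where w: "w \<in> W" "\<one> \<otimes> inv w \<in> H"
      using W(3) by blast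
    then have "inv w \<in> H" "inv w \<in> B"
      using W_in by (auto simp: B_def)
    then obtain n where "n \<le> N" "steps n (inv w)"
      using N by blast
    then show ?case
      using w W_in by auto
  next
    case (snoc s ss)
    define g where "g = foldl (\<otimes>) \<one> ss"
    have s: "s \<in> S" "s \<in> carrier G"
      using snoc.prems S_in by auto
    obtain w n where gw: "g \<in> carrier G" "w \<in> W" "g \<otimes> inv w \<in> H" "n \<le> N * Suc (length ss)"
      "steps n (g \<otimes> inv w)"
      using snoc by (auto simp: g_def)
    obtain w' where w': "w' \<in> W" "g \<otimes> s \<otimes> inv w' \<in> H"
      using W(3)[of "g \<otimes> s"] gw(1) s by auto
    note c = gw(1) s(2) W_in[OF gw(2)] W_in[OF w'(1)]
    \<comment> \<open>The Schreier generator that carries the representative \<open>w\<close> across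
      the letter \<open>s\<close>.\<close>
    define b where "b = w \<otimes> s \<otimes> inv w'"
    have "inv (g \<otimes> inv w) \<otimes> (g \<otimes> s \<otimes> inv w') \<in> H"
      using gw(3) w'(2) by blast
    also have "inv (g \<otimes> inv w) \<otimes> (g \<otimes> s \<otimes> inv w') = b"
    proof -
      have "inv g \<otimes> (g \<otimes> z) = z" if "z \<in> carrier G" for z
        using c that by (simp add: m_assoc [symmetric])
      then show ?thesis
        using c by (simp add: b_def inv_mult_group m_assoc)
    qed
    finally have b: "b \<in> H" .
    moreover have "b \<in> B"
      using gw(2) w'(1) s(1) by (force simp: b_def B_def)
    ultimately obtain k where k: "k \<le> N" "steps k b"
      using N by blast
    have prod: "g \<otimes> inv w \<otimes> b = g \<otimes> s \<otimes> inv w'"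
    proof -
      have "inv w \<otimes> (w \<otimes> z) = z" if "z \<in> carrier G" for z
        using c that by (simp add: m_assoc [symmetric])
      then show ?thesis
        using c by (simp add: b_def m_assoc)
    qed
    have "steps (n + k) (g \<otimes> s \<otimes> inv w')"
      using steps_add[OF gw(5) k(2)] gw(3) b prod by simp
    moreover have "n + k \<le> N * Suc (length (ss @ [s]))"
      using gw(4) k(1) by simp
    ultimately show ?case
      using w' c by (auto simp: g_def)
  qed
  \<comment> \<open>If the product lies in \<open>H\<close>, then so does the last representative
    \<open>w\<close>, and one more piece removes it. This costs at most a factor 2.\<close>
  have "\<exists>n. n \<le> (2 * N) * Suc (length ss) \<and> steps n (foldl (\<otimes>) \<one> ss)"
    if ss: "set ss \<subseteq> S" and gH: "foldl (\<otimes>) \<one> ss \<in> H" for ss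
  proof -
    define g where "g = foldl (\<otimes>) \<one> ss"
    obtain w n where gw: "g \<in> carrier G" "w \<in> W" "g \<otimes> inv w \<in> H" "n \<le> N * Suc (length ss)"
      "steps n (g \<otimes> inv w)"
      using main[OF ss] by (auto simp: g_def)
    have w: "w \<in> carrier G"
      by (rule W_in[OF gw(2)])
    have "inv (g \<otimes> inv w) \<otimes> g \<in> H"
      using gw(3) gH by (auto simp: g_def)
    also have "inv (g \<otimes> inv w) \<otimes> g = w"
      using gw(1) w by (simp add: inv_mult_group m_assoc)
    finally have "w \<in> H" .
    moreover have "w \<in> B"
      using gw(2) by (simp add: B_def)
    ultimately obtain k where k: "k \<le> N" "steps k w"
      using N by blast
    have "steps (n + k) g"
      using steps_add[OF gw(5) k(2)] gw(1) w by (simp add: m_assoc)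
    moreover have "n + k \<le> (2 * N) * Suc (length ss)"
      using gw(4) k(1) by simp
    ultimately show ?thesis
      unfolding g_def by blast
  qed
  then show ?thesis by blast
qed

text \<open>A Milnor-Schwarz argument: finiteness of \<open>V\<close> bounds \<open>D\<close> from
  above by the path metric, and \<open>proper\<close> gives the other bound. Density of the orbit of
  \<open>G\<close> passes to that of \<open>H\<close> through the finite set
  \<open>W\<close>.\<close>

lemma quasi_isometric_component:
  fixes P :: "'p set" and D :: "'p \<Rightarrow> 'p \<Rightarrow> real" and f :: "'a \<Rightarrow> 'p" and \<alpha> \<beta> \<gamma> :: real
  assumes C: "C \<in> quandle_components Q"
    and sym: "\<And>x y. x \<in> P \<Longrightarrow> y \<in> P \<Longrightarrow> D x y = D y x"
    and nonneg: "\<And>x y. x \<in> P \<Longrightarrow> y \<in> P \<Longrightarrow> 0 \<le> D x y"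
    and zero: "\<And>x. x \<in> P \<Longrightarrow> D x x = 0"
    and triangle: "\<And>x y z. x \<in> P \<Longrightarrow> y \<in> P \<Longrightarrow> z \<in> P \<Longrightarrow> D x z \<le> D x y + D y z"
    and f: "\<And>g. g \<in> carrier G \<Longrightarrow> f g \<in> P"
    and f_inv: "\<And>g h k. g \<in> carrier G \<Longrightarrow> h \<in> carrier G \<Longrightarrow> k \<in> carrier G \<Longrightarrow>
      D (f (g \<otimes> k)) (f (h \<otimes> k)) = D (f g) (f h)"
    and proper: "\<And>h. h \<in> H \<Longrightarrow> \<exists>n. real n \<le> \<alpha> * D (f \<one>) (f h) + \<beta> \<and> steps n h"
    and dense: "\<And>z. z \<in> P \<Longrightarrow> \<exists>g\<in>carrier G. D (f g) z \<le> \<gamma>"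
  shows "quasi_isometric C (dis_metric Q (rtrans ` V)) P D"
proof -
  obtain x where x: "x \<in> carrier G" and C: "C = (\<lambda>h. x \<otimes> h) ` H"
    using component_eq_coset[OF C] .
  \<comment> \<open>The metric on \<open>C\<close> is invariant under left multiplication, the one induced by \<open>f\<close> under right
    multiplication; hence the inverse.\<close>
  define F where "F y = f (inv y \<otimes> x)" for y
  have C_in: "y \<in> carrier G" if "y \<in> C" for y
    using that x by (auto simp: C)
  have F_in: "F y \<in> P" if "y \<in> carrier G" for y
    using that x by (simp add: F_def f)
  have F_dist: "D (F y) (F (y \<otimes> k)) = D (f \<one>) (f (inv k))" if "y \<in> carrier G" "k \<in> carrier G" for y k
    using f_inv[of \<one> "inv k" "inv y \<otimes> x"] that x by (simp add: F_def inv_mult_group m_assoc)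
  have dist_inv: "D (f \<one>) (f (inv k)) = D (f \<one>) (f k)" if "k \<in> carrier G" for k
    using f_inv[of \<one> "inv k" k] sym[of "f k" "f \<one>"] f that by simp
  define K0 where "K0 = Max ((\<lambda>v. D (f \<one>) (f (inv v))) ` (V \<union> m_inv G ` V))"
  have K0: "D (f \<one>) (f (inv v)) \<le> K0" if "v \<in> V \<union> m_inv G ` V" for v
    unfolding K0_def using that V(2) by (intro Max_ge) auto
  have path: "z \<in> carrier G \<and> D (F y) (F z) \<le> \<bar>K0\<bar> * real n" if "(y, z) \<in> E ^^ n" "y \<in> carrier G" for y z n
    using that
  proof (induction n arbitrary: z)
    case 0
    then show ?case using zero[OF F_in] by simp
  next
    case (Suc n)
    then obtain z' where z': "(y, z') \<in> E ^^ n" "(z', z) \<in> E"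
      by auto
    then obtain v where v: "z = z' \<otimes> v" "v \<in> V \<union> m_inv G ` V" "z' \<in> carrier G"
      by (auto simp: edges_eq)
    then have vG: "v \<in> carrier G" by auto
    have "D (F z') (F z) \<le> \<bar>K0\<bar>"
      using K0[OF v(2)] F_dist[OF v(3) vG] v(1) by simp
    moreover have "D (F y) (F z') \<le> \<bar>K0\<bar> * real n"
      using Suc.IH[OF z'(1)] Suc.prems(2) by blast
    ultimately show ?case
      using triangle[of "F y" "F z'" "F z"] F_in Suc.prems(2) v vG by (simp add: algebra_simps)
  qed
  define K where "K = max 1 (max \<bar>K0\<bar> \<bar>\<alpha>\<bar>)"
  define M where "M = Max ((\<lambda>w. D (f w) (f \<one>)) ` W)"
  have M: "D (f w) (f \<one>) \<le> M" if "w \<in> W" for w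
    unfolding M_def using that W(2) by (intro Max_ge) auto
  define c where "c = max 0 (max \<bar>\<beta>\<bar> (\<bar>M\<bar> + \<bar>\<gamma>\<bar>))"
  have K: "1 \<le> K" "\<bar>K0\<bar> \<le> K" "\<bar>\<alpha>\<bar> \<le> K" and c: "0 \<le> c" "\<bar>\<beta>\<bar> \<le> c" "\<bar>M\<bar> + \<bar>\<gamma>\<bar> \<le> c"
    by (auto simp: K_def c_def)
  let ?d = "dis_metric Q (rtrans ` V)"
  have both: "?d y z / K - c \<le> D (F y) (F z) \<and> D (F y) (F z) \<le> K * ?d y z + c"
    if y: "y \<in> C" and z: "z \<in> C" for y z
  proof -
    obtain h h' where h: "h \<in> H" "y = x \<otimes> h" "h' \<in> H" "z = x \<otimes> h'"
      using y z by (auto simp: C)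
    define k where "k = inv h \<otimes> h'"
    have kH: "k \<in> H"
      using h by (auto simp: k_def)
    have "h \<otimes> (inv h \<otimes> h') = h'"
      using h by (simp add: m_assoc [symmetric])
    then have zk: "z = y \<otimes> k"
      using h x by (simp add: k_def m_assoc)
    have Dk: "D (F y) (F z) = D (f \<one>) (f k)"
      using F_dist[of y k] dist_inv[of k] kH C_in[OF y] by (simp add: zk)
    have D0: "0 \<le> D (F y) (F z)"
      using nonneg F_in C_in y z by simp
    obtain n where n: "real n \<le> \<alpha> * D (f \<one>) (f k) + \<beta>" "steps n k"
      using proper[OF kH] by blast
    then have en: "(y, z) \<in> E ^^ n"
      using C_in[OF y] by (simp add: steps_def zk)
    define n0 where "n0 = (LEAST n. (y, z) \<in> E ^^ n)"
    have n0: "(y, z) \<in> E ^^ n0" "n0 \<le> n" "?d y z = real n0"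
      using en by (auto simp: n0_def dis_metric_def intro: LeastI Least_le)
    have "real n0 \<le> K * D (F y) (F z) + c"
    proof -
      have "\<alpha> * D (F y) (F z) \<le> K * D (F y) (F z)"
        using K(3) D0 by (intro mult_right_mono) auto
      then show ?thesis
        using n(1) n0(2) c(2) by (simp add: Dk)
    qed
    then have "real n0 / K \<le> D (F y) (F z) + c / K"
      using K(1) by (simp add: field_simps)
    moreover have "c / K \<le> c"
      using K(1) c(1) by (simp add: divide_le_eq mult_le_cancel_left1)
    moreover have "D (F y) (F z) \<le> K * real n0"
      using path[OF n0(1) C_in[OF y]] K(2) mult_right_mono[of "\<bar>K0\<bar>" K "real n0"] by simp
    ultimately show ?thesis
      using n0(3) c(1) by simp
  qed
  have surj: "\<exists>y\<in>C. D (F y) z \<le> c" if z: "z \<in> P" for z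
  proof -
    obtain g where g: "g \<in> carrier G" "D (f g) z \<le> \<gamma>"
      using dense[OF z] by blast
    obtain w where w: "w \<in> W" "inv g \<otimes> inv w \<in> H"
      using W(3)[of "inv g"] g by auto
    have wG: "w \<in> carrier G"
      using w W(1) by blast
    \<comment> \<open>Chosen so that \<open>inv y\<close> times \<open>x\<close> is \<open>w\<close>
      times \<open>g\<close>; by right invariance its image is as far from \<open>f g\<close> as
      \<open>f w\<close> is from \<open>f \<one>\<close>.\<close>
    define y where "y = x \<otimes> (inv g \<otimes> inv w)"
    have y: "y \<in> C"
      using w by (simp add: y_def C)
    have "F y = f (w \<otimes> g)"
      using x g wG by (simp add: F_def y_def inv_mult_group m_assoc)
    moreover have "D (f (w \<otimes> g)) (f g) \<le> M"
      using f_inv[of w \<one> g] M[OF w(1)] wG g by simp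
    ultimately have "D (F y) z \<le> M + \<gamma>"
      using triangle[of "f (w \<otimes> g)" "f g" z] f g wG z by force
    then show ?thesis
      using y c(3) by (intro bexI[of _ y]) auto
  qed
  have "quasi_isometry C ?d P D F"
    unfolding quasi_isometry_def
  proof (rule conjI)
    show "F \<in> C \<rightarrow> P"
      using F_in C_in by blast
  qed (rule exI[of _ K], rule exI[of _ c], use K(1) c(1) both surj in blast)
  then show ?thesis
    unfolding quasi_isometric_def by blast
qed

end

section \<open>Quasi-isometry with a model plane\<close>


context triangle_group
begin

sublocale cq: conj_quandle "tri_group_pos p q r" "tri_elem p q r gen_a"
  by unfold_locales simp

section \<open>Finite index of the displacement subgroup\<close>

definition transversal :: "(tri_gen \<times> bool) list set set" where
  "transversal = (\<lambda>(i, j). el gen_a [^]\<^bsub>G\<^esub> i \<otimes>\<^bsub>G\<^esub> el gen_b [^]\<^bsub>G\<^esub> j) ` ({..<p} \<times> {..<q})"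

lemma transversal_subset: "transversal \<subseteq> carrier G"
  by (auto simp: transversal_def)

lemma finite_transversal: "finite transversal"
  by (simp add: transversal_def)

lemma inv_el_pow: "inv\<^bsub>G\<^esub> el x = el x [^]\<^bsub>G\<^esub> (tri_ord p q r x - 1)"
proof (rule inv_equality)
  have "el x [^]\<^bsub>G\<^esub> (tri_ord p q r x - 1) \<otimes>\<^bsub>G\<^esub> el x = el x [^]\<^bsub>G\<^esub> Suc (tri_ord p q r x - 1)"
    by simp
  also have "Suc (tri_ord p q r x - 1) = tri_ord p q r x"
    using tri_ord_ge_2[of x] by simp
  finally show "el x [^]\<^bsub>G\<^esub> (tri_ord p q r x - 1) \<otimes>\<^bsub>G\<^esub> el x = \<one>\<^bsub>G\<^esub>"
    by (simp only: el_pow_ord)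
qed auto

lemma el_pow_mod: "el x [^]\<^bsub>G\<^esub> n = el x [^]\<^bsub>G\<^esub> (n mod tri_ord p q r x)"
proof -
  have "el x [^]\<^bsub>G\<^esub> (tri_ord p q r x * (n div tri_ord p q r x) + n mod tri_ord p q r x)
      = el x [^]\<^bsub>G\<^esub> (n mod tri_ord p q r x)"
    by (simp only: nat_pow_mult [symmetric] nat_pow_pow [symmetric] el_in el_pow_ord nat_pow_one
      nat_pow_closed l_one)
  then show ?thesis by simp
qed

text \<open>Modulo \<open>H\<close> the element \<open>a\<close> becomes central, so the quotient is generated by two commuting
  elements of finite order.\<close>

lemma transversal_covers:
  assumes "g \<in> carrier G"
  shows "\<exists>w\<in>transversal. g \<otimes>\<^bsub>G\<^esub> inv\<^bsub>G\<^esub> w \<in> cq.H"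
proof -
  let ?M = "G Mod cq.H"
  define \<pi> where "\<pi> g = cq.H #>\<^bsub>G\<^esub> g" for g
  interpret N: normal cq.H G
    by (rule cq.H_normal)
  interpret M: group ?M
    by (rule N.factorgroup_is_group)
  have hom: "\<pi> \<in> hom G ?M"
    unfolding \<pi>_def by (rule N.r_coset_hom_Mod)
  interpret \<pi>: group_hom G ?M \<pi>
    by unfold_locales (rule hom)
  have \<pi>_eq: "g \<otimes>\<^bsub>G\<^esub> inv\<^bsub>G\<^esub> h \<in> cq.H" if "g \<in> carrier G" "h \<in> carrier G" "\<pi> g = \<pi> h" for g h
    using that cq.H.rcos_module[OF is_group, of h g] rcos_self[OF that(1) cq.H.subgroup_axioms] by (simp add: \<pi>_def)
  let ?a = "el gen_a" and ?b = "el gen_b"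
  \<comment> \<open>With this \<open>x\<close> the generator \<open>cj x\<close> times
    \<open>inv (cj \<one>)\<close> of \<open>H\<close> is the commutator of \<open>b\<close> and
    \<open>a\<close>.\<close>
  define x where "x = inv\<^bsub>G\<^esub> ?b"
  have "cq.cj x \<otimes>\<^bsub>G\<^esub> inv\<^bsub>G\<^esub> cq.cj \<one>\<^bsub>G\<^esub> \<in> cq.H"
    by (rule cq.disp_gens_in_H) (auto simp: x_def)
  then have comm_H: "?b \<otimes>\<^bsub>G\<^esub> ?a \<otimes>\<^bsub>G\<^esub> inv\<^bsub>G\<^esub> ?b \<otimes>\<^bsub>G\<^esub> inv\<^bsub>G\<^esub> ?a \<in> cq.H"
    by (simp add: cq.cj_def x_def)
  have "\<pi> (?b \<otimes>\<^bsub>G\<^esub> ?a) = \<pi> (?a \<otimes>\<^bsub>G\<^esub> ?b)"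
  proof -
    have "(?b \<otimes>\<^bsub>G\<^esub> ?a) \<otimes>\<^bsub>G\<^esub> inv\<^bsub>G\<^esub> (?a \<otimes>\<^bsub>G\<^esub> ?b) \<in> cq.H"
      using comm_H by (simp add: inv_mult_group m_assoc)
    then have "?b \<otimes>\<^bsub>G\<^esub> ?a \<in> cq.H #>\<^bsub>G\<^esub> (?a \<otimes>\<^bsub>G\<^esub> ?b)"
      using cq.H.rcos_module[OF is_group] by simp
    then show ?thesis
      unfolding \<pi>_def using repr_independence cq.H.subgroup_axioms by (metis el_in m_closed)
  qed
  then have comm: "\<pi> ?b \<otimes>\<^bsub>?M\<^esub> \<pi> ?a = \<pi> ?a \<otimes>\<^bsub>?M\<^esub> \<pi> ?b"
    by simp
  have comm_pow: "\<pi> ?b [^]\<^bsub>?M\<^esub> j \<otimes>\<^bsub>?M\<^esub> \<pi> ?a = \<pi> ?a \<otimes>\<^bsub>?M\<^esub> \<pi> ?b [^]\<^bsub>?M\<^esub> j" for j :: nat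
    by (rule M.group_commutes_pow) (use comm in auto)
  define good where "good g \<longleftrightarrow> (\<exists>(i::nat) (j::nat). \<pi> g = \<pi> ?a [^]\<^bsub>?M\<^esub> i \<otimes>\<^bsub>?M\<^esub> \<pi> ?b [^]\<^bsub>?M\<^esub> j)" for g
  have step_a: "good (g \<otimes>\<^bsub>G\<^esub> ?a)" if "g \<in> carrier G" "good g" for g
  proof -
    obtain i j :: nat where ij: "\<pi> g = \<pi> ?a [^]\<^bsub>?M\<^esub> i \<otimes>\<^bsub>?M\<^esub> \<pi> ?b [^]\<^bsub>?M\<^esub> j"
      using \<open>good g\<close> by (auto simp: good_def)
    have c: "\<pi> ?a \<in> carrier ?M" "\<pi> ?b \<in> carrier ?M"
      using \<pi>.hom_closed el_in by blast+
    have "\<pi> (g \<otimes>\<^bsub>G\<^esub> ?a) = \<pi> ?a [^]\<^bsub>?M\<^esub> i \<otimes>\<^bsub>?M\<^esub> (\<pi> ?b [^]\<^bsub>?M\<^esub> j \<otimes>\<^bsub>?M\<^esub> \<pi> ?a)"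
      using that(1) c by (simp only: \<pi>.hom_mult el_in ij M.m_assoc M.nat_pow_closed)
    also have "\<dots> = \<pi> ?a [^]\<^bsub>?M\<^esub> Suc i \<otimes>\<^bsub>?M\<^esub> \<pi> ?b [^]\<^bsub>?M\<^esub> j"
      using c by (simp only: comm_pow M.nat_pow_Suc M.m_assoc M.nat_pow_closed)
    finally show ?thesis
      unfolding good_def by blast
  qed
  have step_b: "good (g \<otimes>\<^bsub>G\<^esub> ?b)" if "g \<in> carrier G" "good g" for g
  proof -
    obtain i j :: nat where ij: "\<pi> g = \<pi> ?a [^]\<^bsub>?M\<^esub> i \<otimes>\<^bsub>?M\<^esub> \<pi> ?b [^]\<^bsub>?M\<^esub> j"
      using \<open>good g\<close> by (auto simp: good_def)
    have c: "\<pi> ?a \<in> carrier ?M" "\<pi> ?b \<in> carrier ?M"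
      using \<pi>.hom_closed el_in by blast+
    have "\<pi> (g \<otimes>\<^bsub>G\<^esub> ?b) = \<pi> ?a [^]\<^bsub>?M\<^esub> i \<otimes>\<^bsub>?M\<^esub> \<pi> ?b [^]\<^bsub>?M\<^esub> Suc j"
      using that(1) c by (simp only: \<pi>.hom_mult el_in ij M.m_assoc M.nat_pow_closed M.nat_pow_Suc)
    then show ?thesis
      unfolding good_def by blast
  qed
  have pow_a: "good (g \<otimes>\<^bsub>G\<^esub> ?a [^]\<^bsub>G\<^esub> n)" if "g \<in> carrier G" "good g" for g and n :: nat
  proof (induction n)
    case (Suc n)
    then show ?case
      using step_a[of "g \<otimes>\<^bsub>G\<^esub> ?a [^]\<^bsub>G\<^esub> n"] that by (simp add: m_assoc)
  qed (use that in simp)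
  have pow_b: "good (g \<otimes>\<^bsub>G\<^esub> ?b [^]\<^bsub>G\<^esub> n)" if "g \<in> carrier G" "good g" for g and n :: nat
  proof (induction n)
    case (Suc n)
    then show ?case
      using step_b[of "g \<otimes>\<^bsub>G\<^esub> ?b [^]\<^bsub>G\<^esub> n"] that by (simp add: m_assoc)
  qed (use that in simp)
  have step_inv_a: "good (g \<otimes>\<^bsub>G\<^esub> inv\<^bsub>G\<^esub> ?a)" and step_inv_b: "good (g \<otimes>\<^bsub>G\<^esub> inv\<^bsub>G\<^esub> ?b)"
    if "g \<in> carrier G" "good g" for g
    unfolding inv_el_pow using pow_a pow_b that by blast+
  have "good g"
    using assms
  proof (induction g rule: tri_group_induct)
    case one
    have "\<pi> \<one>\<^bsub>G\<^esub> = \<pi> ?a [^]\<^bsub>?M\<^esub> (0::nat) \<otimes>\<^bsub>?M\<^esub> \<pi> ?b [^]\<^bsub>?M\<^esub> (0::nat)"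
      by (simp only: \<pi>.hom_one M.nat_pow_0 M.l_one M.one_closed)
    then show ?case unfolding good_def by blast
  next
    case (mult g x)
    show ?case
    proof (cases x)
      case gen_c
      have "g \<otimes>\<^bsub>G\<^esub> el gen_c = g \<otimes>\<^bsub>G\<^esub> inv\<^bsub>G\<^esub> ?b \<otimes>\<^bsub>G\<^esub> inv\<^bsub>G\<^esub> ?a"
        using mult.hyps by (simp add: el_c m_assoc)
      then show ?thesis
        using step_inv_a[OF _ step_inv_b[OF mult]] mult(1) gen_c by simp
    qed (use step_a step_b mult in blast)+
  next
    case (mult_inv g x)
    show ?case
    proof (cases x)
      case gen_c
      have "g \<otimes>\<^bsub>G\<^esub> inv\<^bsub>G\<^esub> el gen_c = g \<otimes>\<^bsub>G\<^esub> ?a \<otimes>\<^bsub>G\<^esub> ?b"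
        using mult_inv.hyps by (simp add: el_c m_assoc inv_mult_group)
      then show ?thesis
        using step_b[OF _ step_a[OF mult_inv]] mult_inv(1) gen_c by simp
    qed (use step_inv_a step_inv_b mult_inv in blast)+
  qed
  then obtain i j :: nat where ij: "\<pi> g = \<pi> ?a [^]\<^bsub>?M\<^esub> i \<otimes>\<^bsub>?M\<^esub> \<pi> ?b [^]\<^bsub>?M\<^esub> j"
    by (auto simp: good_def)
  define w where "w = ?a [^]\<^bsub>G\<^esub> (i mod p) \<otimes>\<^bsub>G\<^esub> ?b [^]\<^bsub>G\<^esub> (j mod q)"
  have "w = ?a [^]\<^bsub>G\<^esub> i \<otimes>\<^bsub>G\<^esub> ?b [^]\<^bsub>G\<^esub> j"
    using el_pow_mod[of gen_a i] el_pow_mod[of gen_b j] by (simp add: w_def)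
  then have "\<pi> g = \<pi> w"
    by (simp add: ij \<pi>.hom_nat_pow)
  moreover have "w \<in> transversal"
    using pqr by (auto simp: w_def transversal_def)
  ultimately show ?thesis
    using \<pi>_eq[OF assms, of w] transversal_subset by blast
qed

lemma finite_rcosets: "finite (rcosets\<^bsub>G\<^esub> cq.H)"
proof -
  have "rcosets\<^bsub>G\<^esub> cq.H \<subseteq> (\<lambda>w. cq.H #>\<^bsub>G\<^esub> w) ` transversal"
  proof
    fix K assume "K \<in> rcosets\<^bsub>G\<^esub> cq.H"
    then obtain g where g: "g \<in> carrier G" "K = cq.H #>\<^bsub>G\<^esub> g"
      by (auto simp: RCOSETS_def)
    obtain w where w: "w \<in> transversal" "g \<otimes>\<^bsub>G\<^esub> inv\<^bsub>G\<^esub> w \<in> cq.H"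
      using transversal_covers[OF g(1)] by blast
    have wG: "w \<in> carrier G"
      using w transversal_subset by blast
    then have "g \<in> cq.H #>\<^bsub>G\<^esub> w"
      using cq.H.rcos_module[OF is_group wG g(1)] w by simp
    then have "K = cq.H #>\<^bsub>G\<^esub> w"
      using repr_independence[of g cq.H w] wG cq.H.subgroup_axioms g(2) by simp
    then show "K \<in> (\<lambda>w. cq.H #>\<^bsub>G\<^esub> w) ` transversal"
      using w by blast
  qed
  then show ?thesis
    by (rule finite_subset) (simp add: finite_transversal)
qed

text \<open>Thus \<open>len\<close> bounds the word length of a group element over the finite set of
  the \<open>tr i\<close> and their inverses.\<close>

lemma adj_word_product:
  "\<exists>ss. set ss \<subseteq> range tr \<union> m_inv G ` range tr \<and> length ss = length w \<and>
    foldl (\<otimes>\<^bsub>G\<^esub>) \<one>\<^bsub>G\<^esub> ss = fst (fold adj w (\<one>\<^bsub>G\<^esub>, True))"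
proof (induction w rule: rev_induct)
  case (snoc i w)
  then obtain ss where ss: "set ss \<subseteq> range tr \<union> m_inv G ` range tr" "length ss = length w"
    "foldl (\<otimes>\<^bsub>G\<^esub>) \<one>\<^bsub>G\<^esub> ss = fst (fold adj w (\<one>\<^bsub>G\<^esub>, True))"
    by blast
  obtain g e where ge: "fold adj w (\<one>\<^bsub>G\<^esub>, True) = (g, e)"
    by force
  show ?case
    by (rule exI[of _ "ss @ [if e then tr i else inv\<^bsub>G\<^esub> tr i]"]) (use ss ge in auto)
qed simp

text \<open>The common part of the Euclidean and the hyperbolic case. \<open>M\<close> is the level
  set of \<open>quad_chpt\<close>, cut down by \<open>\<pi> c \<in> P\<close> to one sheet in the
  hyperbolic case. \<open>descent\<close> is the geometric input far from the base point,
  \<open>near\<close> the one close to it.\<close>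

lemma quasi_isometric_model:
  fixes P :: "'p set" and D :: "'p \<Rightarrow> 'p \<Rightarrow> real" and \<pi> :: "(tri_gen \<Rightarrow> real) \<Rightarrow> 'p"
    and \<epsilon> R N :: real
  defines "M \<equiv> {c. quad A c + 2 * sum c UNIV = 0 \<and> \<pi> c \<in> P}"
  assumes C: "C \<in> quandle_components cq.Q"
    and U: "U \<subseteq> carrier (Dis cq.Q)" "finite U" "generate (Dis cq.Q) U = carrier (Dis cq.Q)"
    and sym: "\<And>x y. x \<in> P \<Longrightarrow> y \<in> P \<Longrightarrow> D x y = D y x"
    and nonneg: "\<And>x y. x \<in> P \<Longrightarrow> y \<in> P \<Longrightarrow> 0 \<le> D x y"
    and zero: "\<And>x. x \<in> P \<Longrightarrow> D x x = 0"
    and triangle: "\<And>x y z. x \<in> P \<Longrightarrow> y \<in> P \<Longrightarrow> z \<in> P \<Longrightarrow> D x z \<le> D x y + D y z"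
    and surj: "\<And>z. z \<in> P \<Longrightarrow> \<exists>c\<in>M. \<pi> c = z"
    and M0: "(\<lambda>_. 0) \<in> M"
    and M_reflect: "\<And>c i. c \<in> M \<Longrightarrow> reflect A i c \<in> M"
    and isometry: "\<And>c d i. c \<in> M \<Longrightarrow> d \<in> M \<Longrightarrow> D (\<pi> (reflect A i c)) (\<pi> (reflect A i d)) = D (\<pi> c) (\<pi> d)"
    and eps: "0 < \<epsilon>" "0 \<le> R"
    and descent: "\<And>c. c \<in> M \<Longrightarrow> R < D (\<pi> (\<lambda>_. 0)) (\<pi> c) \<Longrightarrow>
      \<exists>i. wall A c i < 0 \<and> D (\<pi> (\<lambda>_. 0)) (\<pi> (reflect A i c)) \<le> D (\<pi> (\<lambda>_. 0)) (\<pi> c) - \<epsilon>"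
    and near: "\<And>c. c \<in> M \<Longrightarrow> D (\<pi> (\<lambda>_. 0)) (\<pi> c) \<le> R \<Longrightarrow> - sum c UNIV \<le> N"
  shows "quasi_isometric C (dis_metric cq.Q U) P D"
proof -
  define \<delta> where "\<delta> c d = D (\<pi> c) (\<pi> d)" for c d
  let ?o = "\<lambda>_::tri_gen. 0::real"
  have M_P: "\<pi> c \<in> P" if "c \<in> M" for c
    using that by (simp add: M_def)
  obtain V where VU: "V \<subseteq> cq.H" "finite V" "U = cq.rtrans ` V"
    using U(1,2) finite_subset_image[of U cq.rtrans cq.H] unfolding cq.carrier_Dis by blast
  interpret dis_graph "tri_group_pos p q r" "tri_elem p q r gen_a" V transversal
    using VU cq.generate_Dis[of V] U(3) transversal_subset finite_transversal transversal_covers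
    by unfold_locales auto
  have chpt_M: "chpt x \<in> M" if "x \<in> carrier G \<times> UNIV" for x
  proof -
    have "chpt (fold adj w (\<one>\<^bsub>G\<^esub>, True)) \<in> M" for w
      by (induction w rule: rev_induct)
        (use M0 M_reflect chpt_adj[OF fold_in[OF x0]] in \<open>auto simp: pt_one\<close>)
    then show ?thesis
      using adj_connected[OF that] by metis
  qed
  have pt_M: "pt g \<in> M" if "g \<in> carrier G" for g
    using chpt_M[of "(g, True)"] that by simp
  have act_M: "act l c \<in> M" if "c \<in> M" for l c
    by (cases "(p, q, r, l)" rule: letter_act.cases) (use that M_reflect in auto)
  have act_isometry: "\<delta> (act l c) (act l d) = \<delta> c d" if "c \<in> M" "d \<in> M" for l c d
    by (cases "(p, q, r, l)" rule: letter_act.cases) (use that M_reflect isometry in \<open>auto simp: \<delta>_def\<close>)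
  have fold_isometry: "\<delta> (fold act w c) (fold act w d) = \<delta> c d" if "c \<in> M" "d \<in> M" for w c d
    using that by (induction w arbitrary: c d) (auto simp: act_M act_isometry)
  define N' where "N' = max 0 (N / 2)"
  \<comment> \<open>By \<open>u_ascent\<close> a wall of negative height leads to a shorter chamber,
    so each step of the geometric descent trades one unit of length for at least \<epsilon> of
    distance. Within radius \<open>R\<close> the bound of \<open>len_le_sum\<close> takes
    over.\<close>
  have len_bound: "real (len x) \<le> \<delta> ?o (chpt x) / \<epsilon> + N'" if "x \<in> carrier G \<times> UNIV" for x
    using that
  proof (induction "len x" arbitrary: x rule: less_induct)
    case less
    note xM = chpt_M[OF less.prems]
    show ?case
    proof (cases "R < \<delta> ?o (chpt x)")
      case True
      then obtain i where i: "wall A (chpt x) i < 0" "\<delta> ?o (reflect A i (chpt x)) \<le> \<delta> ?o (chpt x) - \<epsilon>"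
        using descent[OF xM] by (auto simp: \<delta>_def)
      then have down: "Suc (len (adj i x)) = len x"
        using len_cases[OF less.prems, of i] u_ascent[OF less.prems, of i] by force
      have "real (len (adj i x)) \<le> \<delta> ?o (reflect A i (chpt x)) / \<epsilon> + N'"
        using less.hyps[of "adj i x"] down adj_in[OF less.prems] chpt_adj[OF less.prems] by simp
      also have "\<dots> \<le> (\<delta> ?o (chpt x) - \<epsilon>) / \<epsilon> + N'"
        using i(2) eps by (simp add: divide_right_mono)
      finally show ?thesis
        using down eps by (simp add: diff_divide_distrib)
    next
      case False
      then have "- sum (chpt x) UNIV \<le> N"
        using near[OF xM] by (simp add: \<delta>_def)
      moreover have "0 \<le> \<delta> ?o (chpt x) / \<epsilon>"
        using nonneg M_P M0 xM eps by (simp add: \<delta>_def)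
      ultimately show ?thesis
        using len_le_sum[OF less.prems] by (simp add: N'_def)
    qed
  qed
  define S where "S = range tr \<union> m_inv G ` range tr"
  have "finite S" "S \<subseteq> carrier G"
    by (auto simp: S_def)
  then obtain K where K: "\<And>ss. set ss \<subseteq> S \<Longrightarrow> foldl (\<otimes>\<^bsub>G\<^esub>) \<one>\<^bsub>G\<^esub> ss \<in> cq.H \<Longrightarrow>
    \<exists>n. n \<le> K * Suc (length ss) \<and> steps n (foldl (\<otimes>\<^bsub>G\<^esub>) \<one>\<^bsub>G\<^esub> ss)"
    using undistorted by meson
  have proper: "\<exists>n. real n \<le> (K / \<epsilon>) * \<delta> ?o (pt h) + K * (N' + 1) \<and> steps n h" if h: "h \<in> cq.H" for h
  proof -
    have x: "(h, True) \<in> carrier G \<times> UNIV"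
      using cq.H_in[OF h] by simp
    obtain w where w: "length w = len (h, True)" "fold adj w (\<one>\<^bsub>G\<^esub>, True) = (h, True)"
      using len_word[OF x] by blast
    then obtain ss where ss: "set ss \<subseteq> S" "length ss = len (h, True)" "foldl (\<otimes>\<^bsub>G\<^esub>) \<one>\<^bsub>G\<^esub> ss = h"
      using adj_word_product[of w] by (auto simp: S_def)
    then obtain n where n: "n \<le> K * Suc (len (h, True))" "steps n h"
      using K[of ss] h by auto
    have "real n \<le> real K * (real (len (h, True)) + 1)"
      using n(1) by (metis of_nat_Suc of_nat_le_iff of_nat_mult add.commute)
    also have "\<dots> \<le> real K * (\<delta> ?o (pt h) / \<epsilon> + N' + 1)"
      using len_bound[OF x] by (intro mult_left_mono) auto
    finally show ?thesis
      using n(2) by (auto simp: algebra_simps)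
  qed
  \<comment> \<open>The second summand pays for the orientation reversing chamber next to the base
    chamber.\<close>
  define \<gamma> where "\<gamma> = R + \<delta> (reflect A gen_b ?o) ?o"
  have \<delta>_nonneg: "0 \<le> \<delta> c d" if "c \<in> M" "d \<in> M" for c d
    using nonneg M_P that by (simp add: \<delta>_def)
  \<comment> \<open>Both parities are carried along since each step of the descent changes the parity.\<close>
  have dense: "\<exists>x\<in>carrier G \<times> UNIV. snd x = b \<and> \<delta> (chpt x) c \<le> \<gamma>" if "c \<in> M" for b c
    using that
  proof (induction "nat \<lceil>\<delta> ?o c / \<epsilon>\<rceil>" arbitrary: b c rule: less_induct)
    case less
    show ?case
    proof (cases "R < \<delta> ?o c")
      case True
      then obtain i where i: "\<delta> ?o (reflect A i c) \<le> \<delta> ?o c - \<epsilon>"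
        using descent[OF less.prems] by (auto simp: \<delta>_def)
      then have "\<delta> ?o (reflect A i c) / \<epsilon> \<le> (\<delta> ?o c - \<epsilon>) / \<epsilon>"
        using eps by (simp add: divide_right_mono)
      also have "\<dots> = \<delta> ?o c / \<epsilon> - 1"
        using eps by (simp add: diff_divide_distrib)
      finally have "\<lceil>\<delta> ?o (reflect A i c) / \<epsilon>\<rceil> \<le> \<lceil>\<delta> ?o c / \<epsilon>\<rceil> - 1"
        by (metis ceiling_diff_one ceiling_mono)
      moreover have "0 < \<delta> ?o c / \<epsilon>"
        using True eps by simp
      ultimately have "nat \<lceil>\<delta> ?o (reflect A i c) / \<epsilon>\<rceil> < nat \<lceil>\<delta> ?o c / \<epsilon>\<rceil>"
        by linarith
      then obtain x where x: "x \<in> carrier G \<times> UNIV" "snd x = (\<not> b)" "\<delta> (chpt x) (reflect A i c) \<le> \<gamma>"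
        using less.hyps[of "reflect A i c" "\<not> b"] M_reflect[OF less.prems] by blast
      \<comment> \<open>Reflecting back: if a chamber is close to the reflected point, then its
        neighbour across wall \<open>i\<close> is close to \<open>c\<close>.\<close>
      have "\<delta> (chpt (adj i x)) c = \<delta> (reflect A i (chpt x)) (reflect A i (reflect A i c))"
        using x(1) by (simp add: chpt_adj)
      also have "\<dots> \<le> \<gamma>"
        using isometry[OF chpt_M[OF x(1)] M_reflect[OF less.prems], of i i] x(3) by (simp add: \<delta>_def)
      finally show ?thesis
        using x adj_in[OF x(1)] parity[OF x(1)] by (intro bexI[of _ "adj i x"]) auto
    next
      case False
      show ?thesis
      proof (cases b)
        case True
        have "\<delta> (chpt (\<one>\<^bsub>G\<^esub>, True)) c \<le> \<gamma>"
          using False \<delta>_nonneg[OF M_reflect[OF M0] M0, of gen_b] by (simp add: \<gamma>_def pt_one)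
        then show ?thesis
          using True by (intro bexI[of _ "(\<one>\<^bsub>G\<^esub>, True)"]) auto
      next
        case b: False
        have "\<delta> (chpt (\<one>\<^bsub>G\<^esub>, False)) c \<le> \<delta> (reflect A gen_b ?o) ?o + \<delta> ?o c"
          using triangle[OF M_P M_P M_P, OF M_reflect[OF M0] M0 less.prems, of gen_b] by (simp add: \<delta>_def pt_one)
        then have "\<delta> (chpt (\<one>\<^bsub>G\<^esub>, False)) c \<le> \<gamma>"
          using False by (simp add: \<gamma>_def)
        then show ?thesis
          using b by (intro bexI[of _ "(\<one>\<^bsub>G\<^esub>, False)"]) auto
      qed
    qed
  qed
  show ?thesis
    unfolding VU(3)
  proof (rule quasi_isometric_component[where f = "\<lambda>g. \<pi> (pt g)" and \<alpha> = "K / \<epsilon>" and \<beta> = "K * (N' + 1)" and \<gamma> = \<gamma>])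
    fix g h k assume g: "g \<in> carrier G" and h: "h \<in> carrier G" and k: "k \<in> carrier G"
    obtain w where w: "k = cls w"
      using carrier_cases[OF k] .
    show "D (\<pi> (pt (g \<otimes>\<^bsub>G\<^esub> k))) (\<pi> (pt (h \<otimes>\<^bsub>G\<^esub> k))) = D (\<pi> (pt g)) (\<pi> (pt h))"
      using fold_isometry[OF pt_M[OF g] pt_M[OF h], of w] g h by (simp add: w pt_mult_cls \<delta>_def)
  next
    fix h assume "h \<in> cq.H"
    then show "\<exists>n. real n \<le> K / \<epsilon> * D (\<pi> (pt \<one>\<^bsub>G\<^esub>)) (\<pi> (pt h)) + K * (N' + 1) \<and> steps n h"
      using proper[of h] by (simp add: \<delta>_def pt_one)
  next
    fix z assume "z \<in> P"
    then obtain c where c: "c \<in> M" "\<pi> c = z"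
      using surj by blast
    then obtain x where "x \<in> carrier G \<times> UNIV" "snd x = True" "\<delta> (chpt x) c \<le> \<gamma>"
      using dense by blast
    then show "\<exists>g\<in>carrier G. D (\<pi> (pt g)) z \<le> \<gamma>"
      using c(2) by (intro bexI[of _ "fst x"]) (auto simp: \<delta>_def)
  qed (use C sym nonneg zero triangle M_P pt_M in auto)
qed

end

section \<open>The Gram matrix\<close>


text \<open>If all coordinates were \<open>> -\<epsilon> m\<close>, where \<open>m\<close> is the largest one, then the value of the
  form would be of the order of \<open>m\<^sup>2\<close>.\<close>

lemma nonneg_form_neg_coordinate:
  fixes J :: "'i::finite \<Rightarrow> 'i \<Rightarrow> real"
  assumes J: "\<And>i j. 0 \<le> J i j" and pos: "\<And>i. 0 < J i i"
  shows "\<exists>\<epsilon> R. 0 < \<epsilon> \<and> 0 \<le> R \<and>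
    (\<forall>u. quad J u = N \<longrightarrow> (\<forall>k. R < \<bar>u k\<bar> \<longrightarrow> (\<exists>i. u i \<le> - \<epsilon> * \<bar>u k\<bar>)))"
proof -
  define d where "d = Min (range (\<lambda>i. J i i))"
  have d: "0 < d" "\<And>i. d \<le> J i i"
    using pos by (auto simp: d_def)
  define T where "T = (\<Sum>i\<in>UNIV. \<Sum>j\<in>UNIV. J i j)"
  have "T > 0"
  proof -
    have *: "0 < (\<Sum>j\<in>UNIV. J i j)" for i
      by (rule sum_pos2[of _ i]) (use J pos in auto)
    show ?thesis
      unfolding T_def by (rule sum_pos) (use * in auto)
  qed
  \<comment> \<open>So small that all negative products together cost at most half of the diagonal
    term \<open>d * m\<^sup>2\<close>.\<close>
  define \<epsilon> where "\<epsilon> = min 1 (d / (2 * T))"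
  have eps: "0 < \<epsilon>" "\<epsilon> \<le> 1" "\<epsilon> * T \<le> d / 2"
  proof -
    show "0 < \<epsilon>" "\<epsilon> \<le> 1"
      using d \<open>T > 0\<close> by (auto simp: \<epsilon>_def)
    have "\<epsilon> * T \<le> d / (2 * T) * T"
      using \<open>T > 0\<close> by (intro mult_right_mono) (auto simp: \<epsilon>_def)
    then show "\<epsilon> * T \<le> d / 2"
      using \<open>T > 0\<close> by simp
  qed
  \<comment> \<open>Beyond this modulus the remaining half of the diagonal term exceeds the absolute
    value of \<open>N\<close>.\<close>
  define R where "R = sqrt (2 * \<bar>N\<bar> / d)"
  have "\<exists>i. u i \<le> - \<epsilon> * \<bar>u k\<bar>" if u: "quad J u = N" and k: "R < \<bar>u k\<bar>" for u k
  proof (rule ccontr)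
    assume neg: "\<not> ?thesis"
    define m where "m = Max (range (\<lambda>i. \<bar>u i\<bar>))"
    have m: "\<bar>u i\<bar> \<le> m" for i
      by (simp add: m_def)
    have "m \<in> range (\<lambda>i. \<bar>u i\<bar>)"
      unfolding m_def by (rule Max_in) auto
    then obtain l where l: "m = \<bar>u l\<bar>" by auto
    show False
    proof (cases "\<exists>i. u i \<le> - \<epsilon> * m")
      case True
      then obtain i where "u i \<le> - \<epsilon> * m" by blast
      moreover have "\<epsilon> * \<bar>u k\<bar> \<le> \<epsilon> * m"
        using m eps by simp
      ultimately show False
        using neg by (metis minus_mult_left neg_le_iff_le order_trans)
    next
      case False
      then have gt: "- \<epsilon> * m < u i" for i
        by (simp add: not_le)
      have m0: "0 \<le> m"
        using l by simp
      have ul: "u l = m"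
      proof (rule ccontr)
        assume "u l \<noteq> m"
        then have "u l = - m"
          using l by linarith
        moreover have "\<epsilon> * m \<le> 1 * m"
          using eps m0 by (intro mult_right_mono)
        ultimately show False
          using gt[of l] by simp
      qed
      have prod: "- (\<epsilon> * m * m) \<le> u i * u j" for i j
      proof -
        have *: "- (\<epsilon> * m * m) \<le> a * b" if "a \<le> 0" "0 \<le> b" "- \<epsilon> * m < a" "b \<le> m" for a b
        proof -
          have "(- \<epsilon> * m) * m \<le> (- \<epsilon> * m) * b"
            using that m0 eps by (intro mult_left_mono_neg) auto
          also have "\<dots> \<le> a * b"
            using that by (intro mult_right_mono) auto
          finally show ?thesis by simp
        qed
        have "0 \<le> \<epsilon> * m * m"
          using eps m0 by simp
        moreover have "u i \<le> m" "u j \<le> m"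
          using m by (meson abs_le_D1)+
        moreover have "0 \<le> u i * u j \<or> (u i \<le> 0 \<and> 0 \<le> u j) \<or> (u j \<le> 0 \<and> 0 \<le> u i)"
          by (auto simp: zero_le_mult_iff)
        ultimately show ?thesis
          using *[of "u i" "u j"] *[of "u j" "u i"] gt[of i] gt[of j]
          by (auto simp: mult.commute[of "u j" "u i"])
      qed
      have summand: "(if i = l \<and> j = l then d * m\<^sup>2 else 0) - \<epsilon> * m\<^sup>2 * J i j \<le> u i * (J i j * u j)" for i j
      proof (cases "i = l \<and> j = l")
        case True
        have "d * m\<^sup>2 \<le> J l l * m\<^sup>2"
          using d by (intro mult_right_mono) auto
        moreover have "0 \<le> \<epsilon> * m\<^sup>2 * J l l"
          using eps J by simp
        ultimately show ?thesis
          using True ul by (simp add: power2_eq_square algebra_simps)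
      next
        case False
        have "J i j * - (\<epsilon> * m * m) \<le> J i j * (u i * u j)"
          using prod J by (intro mult_left_mono)
        then show ?thesis
          using False by (auto simp: power2_eq_square algebra_simps)
      qed
      have "(\<Sum>i\<in>UNIV. \<Sum>j\<in>UNIV. (if i = l \<and> j = l then d * m\<^sup>2 else 0) - \<epsilon> * m\<^sup>2 * J i j) \<le> quad J u"
        unfolding quad_def sum_distrib_left by (intro sum_mono summand)
      also have "(\<Sum>i\<in>UNIV. \<Sum>j\<in>UNIV. (if i = l \<and> j = l then d * m\<^sup>2 else 0) - \<epsilon> * m\<^sup>2 * J i j)
          = d * m\<^sup>2 - \<epsilon> * m\<^sup>2 * T"
      proof -
        have "(if i = l \<and> j = l then d * m\<^sup>2 else 0) = (if j = l then if i = l then d * m\<^sup>2 else 0 else 0)" for i j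
          by simp
        then show ?thesis
          by (simp add: sum_subtractf T_def sum_distrib_left [symmetric])
      qed
      finally have "d * m\<^sup>2 - \<epsilon> * T * m\<^sup>2 \<le> N"
        using u by (simp add: mult_ac)
      moreover have "\<epsilon> * T * m\<^sup>2 \<le> d / 2 * m\<^sup>2"
        using eps by (intro mult_right_mono) auto
      ultimately have "m\<^sup>2 \<le> 2 * \<bar>N\<bar> / d"
        using d by (simp add: field_simps)
      then have "m \<le> R"
        unfolding R_def by (rule real_le_rsqrt)
      then show False
        using k m[of k] by linarith
    qed
  qed
  moreover have "0 \<le> R"
    using d by (simp add: R_def)
  ultimately show ?thesis
    using eps(1) by blast
qed

lemma cos_sin_pi_div:
  assumes "n \<ge> (2::nat)"
  shows "0 < pi / n" "pi / n \<le> pi / 2" "0 \<le> cos (pi / n)" "cos (pi / n) < 1" "0 < sin (pi / n)"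
proof -
  show *: "0 < pi / n" "pi / n \<le> pi / 2"
    using assms by (auto simp: field_simps)
  show "0 \<le> cos (pi / n)"
    using * by (intro cos_ge_zero) auto
  have "pi / n < pi"
    using *(2) pi_gt_zero by linarith
  then show "cos (pi / n) < 1" "0 < sin (pi / n)"
    using *(1) cos_monotone_0_pi[of 0 "pi / n"] by (auto intro: sin_gt_zero)
qed

context triangle_group
begin

text \<open>The Gram matrix is that of the vectors \<open>(1, 0, 0)\<close>, \<open>(- ca, sa, 0)\<close>, \<open>(- cc, - kk, 1)\<close> for the
  form \<open>diag(1, 1, \<kappa>)\<close>, and \<open>Z1 c\<close>, \<open>Z2 c\<close>, \<open>c gen_c\<close> are the coordinates of their linear
  combination with coefficients \<open>c\<close>. The constants \<open>1\<close>, \<open>o2\<close>, \<open>ee\<close> express the functional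
  ``sum of the coefficients'' in these coordinates.\<close>

definition "ca = cos (pi / p)"
definition "cb = cos (pi / q)"
definition "cc = cos (pi / r)"
definition "sa = sin (pi / p)"
definition "\<Delta> = 1 - ca\<^sup>2 - cb\<^sup>2 - cc\<^sup>2 - 2 * ca * cb * cc"
definition "kk = (cb + ca * cc) / sa"
definition "\<kappa> = \<Delta> / sa\<^sup>2"
definition "o2 = (1 + ca) / sa"
definition "ee = 1 + cc + kk * o2"
definition "Z1 c = c gen_a - ca * c gen_b - cc * c gen_c"
definition "Z2 c = sa * c gen_b - kk * c gen_c"

lemma cs: "0 \<le> ca" "ca < 1" "0 \<le> cb" "cb < 1" "0 \<le> cc" "cc < 1" "0 < sa" "sa\<^sup>2 = 1 - ca\<^sup>2"
  using cos_sin_pi_div pqr by (auto simp: ca_def cb_def cc_def sa_def sin_squared_eq)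

lemma gram_values [simp]:
  "A gen_a gen_b = - ca" "A gen_b gen_a = - ca" "A gen_b gen_c = - cb" "A gen_c gen_b = - cb"
  "A gen_c gen_a = - cc" "A gen_a gen_c = - cc"
  by (auto simp: tri_gram_def tri_m_def ca_def cb_def cc_def)

text \<open>The angle sum enters only here: \<open>\<Delta>\<close> is the determinant of the Gram matrix.\<close>

lemma \<Delta>_sgn: "sgn \<Delta> = sgn (1 / real p + 1 / real q + 1 / real r - 1)"
proof -
  define \<alpha> \<beta> \<gamma> where "\<alpha> = pi / p" and "\<beta> = pi / q" and "\<gamma> = pi / r"
  have ang: "0 < \<alpha>" "\<alpha> \<le> pi / 2" "0 < \<beta>" "\<beta> \<le> pi / 2" "0 < \<gamma>" "\<gamma> \<le> pi / 2"
    using cos_sin_pi_div(1,2) pqr unfolding \<alpha>_def \<beta>_def \<gamma>_def by blast+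
  have sp: "0 < sin \<beta> * sin \<gamma>"
    using cos_sin_pi_div(5) pqr unfolding \<beta>_def \<gamma>_def by simp
  have e: "ca = cos \<alpha>" "cb = cos \<beta>" "cc = cos \<gamma>"
    by (auto simp: ca_def cb_def cc_def \<alpha>_def \<beta>_def \<gamma>_def)
  \<comment> \<open>A difference of two squares. One factor compares \<open>cos \<alpha>\<close>
    with the cosine of \<open>pi - (\<beta> + \<gamma>)\<close>, the other is positive because no
    angle exceeds \<open>pi / 2\<close>.\<close>
  have "\<Delta> = (1 - cb\<^sup>2) * (1 - cc\<^sup>2) - (ca + cb * cc)\<^sup>2"
    by (simp add: \<Delta>_def power2_eq_square algebra_simps)
  also have "\<dots> = (sin \<beta> * sin \<gamma> - (ca + cb * cc)) * (sin \<beta> * sin \<gamma> + (ca + cb * cc))"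
    by (simp add: e sin_squared_eq [symmetric]) (simp add: power2_eq_square algebra_simps)
  also have "sin \<beta> * sin \<gamma> - (ca + cb * cc) = cos (pi - (\<beta> + \<gamma>)) - cos \<alpha>"
    by (simp add: e cos_add cos_diff)
  finally have \<Delta>: "\<Delta> = (cos (pi - (\<beta> + \<gamma>)) - cos \<alpha>) * (sin \<beta> * sin \<gamma> + (ca + cb * cc))" .
  have "0 < sin \<beta> * sin \<gamma> + (ca + cb * cc)"
    using sp cs by (simp add: add_pos_nonneg)
  then have "sgn \<Delta> = sgn (cos (pi - (\<beta> + \<gamma>)) - cos \<alpha>)"
    by (simp add: \<Delta> sgn_mult)
  also have "\<dots> = sgn (\<alpha> - (pi - (\<beta> + \<gamma>)))"
  proof (cases \<alpha> "pi - (\<beta> + \<gamma>)" rule: linorder_cases)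
    case less
    then show ?thesis
      using cos_monotone_0_pi[of \<alpha> "pi - (\<beta> + \<gamma>)"] ang by simp
  next
    case greater
    then show ?thesis
      using cos_monotone_0_pi[of "pi - (\<beta> + \<gamma>)" \<alpha>] ang by simp
  qed simp
  also have "\<alpha> - (pi - (\<beta> + \<gamma>)) = pi * (1 / p + 1 / q + 1 / r - 1)"
    by (simp add: \<alpha>_def \<beta>_def \<gamma>_def algebra_simps)
  finally show ?thesis
    by (simp add: sgn_mult)
qed

lemma kk_sa: "sa * kk = cb + ca * cc"
  using cs by (simp add: kk_def)

lemma o2_sa: "sa * o2 = 1 + ca"
  using cs by (simp add: o2_def)

lemma \<kappa>_eq: "\<kappa> + kk\<^sup>2 + cc\<^sup>2 = 1"
proof -
  have "sa\<^sup>2 * (\<kappa> + kk\<^sup>2 + cc\<^sup>2) = \<Delta> + (sa * kk)\<^sup>2 + sa\<^sup>2 * cc\<^sup>2"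
    using cs(7) by (simp add: \<kappa>_def power_mult_distrib distrib_left)
  also have "\<dots> = sa\<^sup>2 * 1"
    unfolding kk_sa cs(8) \<Delta>_def by algebra
  finally show ?thesis
    using cs(7) by simp
qed

lemma quad_gram: "quad A c = (Z1 c)\<^sup>2 + (Z2 c)\<^sup>2 + \<kappa> * (c gen_c)\<^sup>2"
proof -
  have "quad A c = (c gen_a)\<^sup>2 + (ca\<^sup>2 + sa\<^sup>2) * (c gen_b)\<^sup>2 + (\<kappa> + kk\<^sup>2 + cc\<^sup>2) * (c gen_c)\<^sup>2
    - 2 * ca * c gen_a * c gen_b - 2 * cc * c gen_a * c gen_c + (2 * ca * cc - 2 * (sa * kk)) * c gen_b * c gen_c"
    unfolding quad_def sum_tri_gen \<kappa>_eq cs(8) kk_sa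
    by (simp add: power2_eq_square algebra_simps)
  also have "\<dots> = (Z1 c)\<^sup>2 + (Z2 c)\<^sup>2 + \<kappa> * (c gen_c)\<^sup>2"
    unfolding Z1_def Z2_def by algebra
  finally show ?thesis .
qed

lemma sum_coords: "sum c UNIV = Z1 c + o2 * Z2 c + ee * c gen_c"
proof -
  have "Z1 c + o2 * Z2 c + ee * c gen_c = c gen_a + (sa * o2 - ca) * c gen_b + c gen_c"
    by (simp add: Z1_def Z2_def ee_def algebra_simps)
  then show ?thesis
    by (simp add: o2_sa sum_tri_gen)
qed

lemma coords_pos: "0 < o2" "0 \<le> kk" "1 \<le> ee"
  using cs by (auto simp: o2_def kk_def ee_def)

lemma coords_surj: "\<exists>c. Z1 c = x \<and> Z2 c = y \<and> c gen_c = t"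
proof -
  define b where "b = (y + kk * t) / sa"
  define c where "c = (\<lambda>i. case i of gen_a \<Rightarrow> x + ca * b + cc * t | gen_b \<Rightarrow> b | gen_c \<Rightarrow> t)"
  have "Z1 c = x" "Z2 c = y" "c gen_c = t"
    using cs by (auto simp: c_def Z1_def Z2_def b_def)
  then show ?thesis by blast
qed

text \<open>The adjugate of the Gram matrix.\<close>

definition tri_adj :: "tri_gen \<Rightarrow> tri_gen \<Rightarrow> real" where
  "tri_adj i j = (if i = j then 1 - (A (nxt i) (nxt (nxt i)))\<^sup>2
     else if j = nxt i then A i (nxt j) * A (nxt j) j - A i j
     else A i (nxt i) * A (nxt i) j - A i j)"

lemma tri_adj_values:
  "tri_adj gen_a gen_a = 1 - cb\<^sup>2" "tri_adj gen_b gen_b = 1 - cc\<^sup>2" "tri_adj gen_c gen_c = 1 - ca\<^sup>2"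
  "tri_adj gen_a gen_b = ca + cb * cc" "tri_adj gen_b gen_a = ca + cb * cc"
  "tri_adj gen_b gen_c = cb + ca * cc" "tri_adj gen_c gen_b = cb + ca * cc"
  "tri_adj gen_c gen_a = cc + ca * cb" "tri_adj gen_a gen_c = cc + ca * cb"
  by (auto simp: tri_adj_def)

lemma tri_adj_nonneg: "0 \<le> tri_adj i j"
  using cs by (cases i; cases j) (auto simp: tri_adj_values abs_square_le_1)

lemma tri_adj_pos: "0 < tri_adj i i"
  using cs by (cases i) (auto simp: tri_adj_values abs_square_less_1)

text \<open>The heights are \<open>1 + A c\<close>, and the product of \<open>A\<close> with its
  adjugate is \<Delta> times the identity. So the heights satisfy one fixed quadratic equation on
  the level set, also where \<open>A\<close> is singular.\<close>

lemma quad_adj_wall: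
  assumes "quad A c + 2 * sum c UNIV = 0"
  shows "quad tri_adj (wall A c) = quad tri_adj (\<lambda>_. 1)"
proof -
  have "quad tri_adj (wall A c) = quad tri_adj (\<lambda>_. 1) + \<Delta> * (quad A c + 2 * sum c UNIV)"
    unfolding quad_def wall_def sum_tri_gen tri_adj_values gram_values tri_gram_diag \<Delta>_def
    by (simp add: power2_eq_square algebra_simps)
  then show ?thesis
    using assms by simp
qed

lemma wall_neg:
  "\<exists>\<epsilon> R. 0 < \<epsilon> \<and> 0 \<le> R \<and> (\<forall>c. quad A c + 2 * sum c UNIV = 0 \<longrightarrow>
    (\<forall>k. R < \<bar>wall A c k\<bar> \<longrightarrow> (\<exists>i. wall A c i \<le> - \<epsilon> * \<bar>wall A c k\<bar>)))"
  using nonneg_form_neg_coordinate[of tri_adj "quad tri_adj (\<lambda>_. 1)", OF tri_adj_nonneg tri_adj_pos]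
    quad_adj_wall by meson

section \<open>The spherical case\<close>

lemma finite_spherical:
  assumes "\<Delta> > 0"
  shows "finite (carrier G)"
proof -
  have \<kappa>: "\<kappa> > 0"
    using assms cs(7) by (simp add: \<kappa>_def)
  \<comment> \<open>From completing the squares in \<open>quad A c + 4 * sum c UNIV\<close>, whose
    minimum is \<open>- 4 * B\<close>. On the level set this expression equals
    \<open>2 * sum c UNIV\<close>.\<close>
  define B where "B = 1 + o2\<^sup>2 + ee\<^sup>2 / \<kappa>"
  have bound: "len x \<le> nat \<lceil>B\<rceil>" if x: "x \<in> carrier G \<times> UNIV" for x
  proof -
    let ?c = "chpt x"
    have "0 \<le> (Z1 ?c + 2)\<^sup>2 + (Z2 ?c + 2 * o2)\<^sup>2 + \<kappa> * (?c gen_c + 2 * ee / \<kappa>)\<^sup>2"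
      using \<kappa> by simp
    also have "\<dots> = quad A ?c + 4 * sum ?c UNIV + 4 * B"
      using \<kappa> unfolding quad_gram sum_coords B_def by (simp add: power2_eq_square field_simps)
    finally have "- sum ?c UNIV \<le> 2 * B"
      using quad_chpt[OF x] by linarith
    then have "real (len x) \<le> B"
      using len_le_sum[OF x] by linarith
    then show ?thesis by linarith
  qed
  have "carrier G \<times> UNIV \<subseteq> (\<lambda>w. fold adj w (\<one>\<^bsub>G\<^esub>, True)) ` {w. set w \<subseteq> UNIV \<and> length w \<le> nat \<lceil>B\<rceil>}"
  proof
    fix x :: "(tri_gen \<times> bool) list set \<times> bool" assume x: "x \<in> carrier G \<times> UNIV"
    obtain w where "length w = len x" "fold adj w (\<one>\<^bsub>G\<^esub>, True) = x"
      using len_word[OF x] by blast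
    then show "x \<in> (\<lambda>w. fold adj w (\<one>\<^bsub>G\<^esub>, True)) ` {w. set w \<subseteq> UNIV \<and> length w \<le> nat \<lceil>B\<rceil>}"
      using bound[OF x] by force
  qed
  moreover have "finite {w :: tri_gen list. set w \<subseteq> UNIV \<and> length w \<le> nat \<lceil>B\<rceil>}"
    by (rule finite_lists_length_le) simp
  ultimately have "finite (carrier G \<times> (UNIV :: bool set))"
    using finite_surj by blast
  then show ?thesis
    using finite_cartesian_productD1 by auto
qed

end

section \<open>The Euclidean and the hyperbolic plane\<close>


text \<open>Converts a factor gained in \<open>cosh\<close> of a distance into an amount subtracted
  from the distance.\<close>

lemma cosh_diff_ge:
  fixes t d :: real
  assumes "0 \<le> d"
  shows "exp (- d) * cosh t \<le> cosh (t - d)"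
proof -
  have "sinh t * sinh d \<le> cosh t * sinh d"
    using assms sinh_less_cosh_real[of t] by (intro mult_right_mono) auto
  then show ?thesis
    by (simp add: cosh_diff cosh_minus_sinh [symmetric] algebra_simps)
qed

lemma mink_commute: "mink u v = mink v u"
  by (cases u; cases v) (simp add: algebra_simps)

text \<open>If \<open>v\<close> were on the lower sheet, then \<open>mink_ge_1\<close> for its
  antipode would make the product with \<open>u\<close> at most \<open>-1\<close>.\<close>

lemma hyp_plane_same_sheet:
  assumes "u \<in> hyp_plane" "mink v v = 1" "mink u v > 0"
  shows "v \<in> hyp_plane"
proof -
  obtain x y t where v: "v = (x, y, t)"
    by (metis prod_cases3)
  have "t > 0"
  proof (rule ccontr)
    assume "\<not> t > 0"
    moreover have "t \<noteq> 0"
    proof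
      assume "t = 0"
      then have "- (x * x) - y * y = 1"
        using assms(2) by (simp add: v)
      then show False
        using zero_le_square[of x] zero_le_square[of y] by linarith
    qed
    ultimately have "(- x, - y, - t) \<in> hyp_plane"
      using assms(2) by (simp add: v hyp_plane_def)
    then have "1 \<le> mink u (- x, - y, - t)"
      using mink_ge_1 assms(1) by blast
    moreover have "mink u (- x, - y, - t) = - mink u v"
      by (cases u) (simp add: v)
    ultimately show False
      using assms(3) by simp
  qed
  then show ?thesis
    using assms(2) by (simp add: v hyp_plane_def)
qed

context triangle_group
begin

lemma coords_diff:
  "Z1 (c - d) = Z1 c - Z1 d" "Z2 (c - d) = Z2 c - Z2 d"
  by (auto simp: Z1_def Z2_def algebra_simps)

lemma coords_zero: "Z1 (\<lambda>_. 0) = 0" "Z2 (\<lambda>_. 0) = 0" "quad A (\<lambda>_. 0) = 0"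
  by (auto simp: Z1_def Z2_def quad_def)

text \<open>Two heights determine the plane coordinates. In the Euclidean case this replaces
  inverting \<open>A\<close>, which is singular.\<close>

lemma wall_coords:
  "Z1 c = wall A c gen_a - 1"
  "sa * Z2 c = (wall A c gen_b - 1) + ca * (wall A c gen_a - 1)"
proof -
  show "Z1 c = wall A c gen_a - 1"
    by (simp add: Z1_def wall_def sum_tri_gen)
  have "sa * Z2 c = sa\<^sup>2 * c gen_b - (sa * kk) * c gen_c"
    by (simp add: Z2_def power2_eq_square algebra_simps)
  then show "sa * Z2 c = (wall A c gen_b - 1) + ca * (wall A c gen_a - 1)"
    unfolding kk_sa cs(8) by (simp add: wall_def sum_tri_gen power2_eq_square algebra_simps)
qed

lemma quad_reflect_potential:
  "quad A (reflect A i c) + 2 * sum (reflect A i c) UNIV = quad A c + 2 * sum c UNIV"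
  by (rule quad_sum_reflect) (auto simp: tri_gram_sym)

lemma quad_reflect_diff: "quad A (reflect A i c - reflect A i d) = quad A (c - d)"
  by (rule quad_diff_reflect) (auto simp: tri_gram_sym)

section \<open>The Euclidean case\<close>

lemma euclidean:
  assumes \<Delta>: "\<Delta> = 0"
    and C: "C \<in> quandle_components cq.Q"
    and U: "U \<subseteq> carrier (Dis cq.Q)" "finite U" "generate (Dis cq.Q) U = carrier (Dis cq.Q)"
  shows "quasi_isometric C (dis_metric cq.Q U) (UNIV :: (real^2) set) dist"
proof -
  define \<pi> :: "(tri_gen \<Rightarrow> real) \<Rightarrow> real^2" where "\<pi> c = vector [Z1 c, Z2 c]" for c
  have quad: "quad A c = (Z1 c)\<^sup>2 + (Z2 c)\<^sup>2" for c
    by (simp add: quad_gram \<kappa>_def \<Delta>)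
  have dist_eq: "dist (\<pi> c) (\<pi> d) = sqrt (quad A (c - d))" for c d
    by (simp add: dist_vec_def L2_set_def UNIV_2 \<pi>_def dist_real_def quad coords_diff)
  define \<delta> where "\<delta> c = sqrt (quad A c)" for c
  have \<delta>: "dist (\<pi> (\<lambda>_. 0)) (\<pi> c) = \<delta> c" for c
    using dist_eq[of c "\<lambda>_. 0"] by (simp add: dist_commute \<delta>_def fun_diff_def)
  have \<delta>_sq: "(\<delta> c)\<^sup>2 = quad A c" and \<delta>_nonneg: "0 \<le> \<delta> c" for c
    by (auto simp: \<delta>_def quad)
  obtain \<epsilon> R where wall_neg': "0 < \<epsilon>" "0 \<le> R"
    "\<And>c k. quad A c + 2 * sum c UNIV = 0 \<Longrightarrow> R < \<bar>wall A c k\<bar> \<Longrightarrow> \<exists>i. wall A c i \<le> - \<epsilon> * \<bar>wall A c k\<bar>"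
    using wall_neg by meson
  define L where "L = 1 + 2 / sa"
  have L: "1 \<le> L"
    using cs by (simp add: L_def)
  have large: "\<exists>k. \<delta> c \<le> L * \<bar>wall A c k - 1\<bar>" for c
  proof -
    define t where "t = max \<bar>wall A c gen_a - 1\<bar> \<bar>wall A c gen_b - 1\<bar>"
    have t: "\<bar>wall A c gen_a - 1\<bar> \<le> t" "\<bar>wall A c gen_b - 1\<bar> \<le> t"
      by (auto simp: t_def)
    then have z1: "\<bar>Z1 c\<bar> \<le> t"
      by (simp add: wall_coords(1))
    have "\<bar>sa * Z2 c\<bar> \<le> \<bar>wall A c gen_b - 1\<bar> + \<bar>ca * (wall A c gen_a - 1)\<bar>"
      unfolding wall_coords(2) by (rule abs_triangle_ineq)
    also have "\<bar>ca * (wall A c gen_a - 1)\<bar> \<le> 1 * \<bar>wall A c gen_a - 1\<bar>"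
      unfolding abs_mult using cs by (intro mult_right_mono) auto
    finally have "sa * \<bar>Z2 c\<bar> \<le> 2 * t"
      using cs(7) t by (simp add: abs_mult)
    then have z2: "\<bar>Z2 c\<bar> \<le> 2 * t / sa"
      using cs(7) by (simp add: field_simps)
    have "\<delta> c \<le> \<bar>Z1 c\<bar> + \<bar>Z2 c\<bar>"
      by (simp add: \<delta>_def quad sqrt_sum_squares_le_sum_abs)
    also have "\<dots> \<le> L * t"
      using z1 z2 by (simp add: L_def algebra_simps)
    finally show ?thesis
      by (cases "\<bar>wall A c gen_a - 1\<bar> \<le> \<bar>wall A c gen_b - 1\<bar>") (auto simp: t_def max_def)
  qed
  define \<eta> where "\<eta> = \<epsilon> / L"
  have \<eta>: "0 < \<eta>"
    using L wall_neg'(1) by (simp add: \<eta>_def)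
  \<comment> \<open>\<open>2 * L\<close> absorbs the difference between a height and the height
    minus 1, \<open>2 * L * R\<close> forces some height beyond \<open>R\<close>, and \<eta> keeps
    \<open>\<delta> c - \<eta>\<close> nonnegative when squares are compared.\<close>
  define R' where "R' = max (2 * L) (max (2 * L * R) \<eta>)"
  have R': "2 * L \<le> R'" "2 * L * R \<le> R'" "\<eta> \<le> R'"
    by (auto simp: R'_def)
  have desc: "\<exists>i. wall A c i < 0 \<and> \<delta> (reflect A i c) \<le> \<delta> c - \<eta>"
    if c: "quad A c + 2 * sum c UNIV = 0" and far: "R' < \<delta> c" for c
  proof -
    obtain k where k: "\<delta> c \<le> L * \<bar>wall A c k - 1\<bar>"
      using large by blast
    have "L * \<bar>wall A c k - 1\<bar> \<le> L * (\<bar>wall A c k\<bar> + 1)"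
      using L by (intro mult_left_mono) auto
    then have "\<delta> c \<le> L * \<bar>wall A c k\<bar> + L"
      using k by (simp add: distrib_left)
    then have Lk: "\<delta> c \<le> 2 * L * \<bar>wall A c k\<bar>"
      using far R'(1) by linarith
    then have "2 * L * R < 2 * L * \<bar>wall A c k\<bar>"
      using far R'(2) by linarith
    then have "R < \<bar>wall A c k\<bar>"
      using L by (simp add: mult_less_cancel_left)
    then obtain i where "wall A c i \<le> - \<epsilon> * \<bar>wall A c k\<bar>"
      using wall_neg'(3)[OF c] by blast
    also have "\<dots> \<le> - \<epsilon> * (\<delta> c / (2 * L))"
      using Lk L wall_neg'(1) by (simp add: field_simps)
    finally have i: "4 * wall A c i \<le> - 2 * \<eta> * \<delta> c"
      using L by (simp add: \<eta>_def field_simps)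
    have pos: "0 < \<delta> c"
      using far R' L by linarith
    \<comment> \<open>The squared distance changes by four times the height, which is negative and
      of the order of the distance; hence the distance itself drops by a constant.\<close>
    have "quad A (reflect A i c) = quad A c + 4 * wall A c i"
      using quad_reflect_potential[of i c] c sum_reflect[of A i c] by linarith
    then have "(\<delta> (reflect A i c))\<^sup>2 \<le> (\<delta> c)\<^sup>2 - 2 * \<eta> * \<delta> c"
      using i by (simp add: \<delta>_sq)
    also have "\<dots> \<le> (\<delta> c - \<eta>)\<^sup>2"
      by (simp add: power2_diff)
    finally have "\<delta> (reflect A i c) \<le> \<delta> c - \<eta>"
      by (rule power2_le_imp_le) (use far R'(3) in linarith)
    moreover have "wall A c i < 0"
      using i mult_pos_pos[OF \<eta> pos] by linarith
    ultimately show ?thesis by blast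
  qed
  have surj: "\<exists>c. quad A c + 2 * sum c UNIV = 0 \<and> \<pi> c = z" for z
  proof -
    \<comment> \<open>\<open>\<pi>\<close> forgets \<open>c gen_c\<close>. As the form does not
      involve this coordinate when \<Delta> is 0, the level equation is linear in it and can be
      solved, \<open>ee\<close> being positive.\<close>
    define t where "t = (- ((z $ 1)\<^sup>2 + (z $ 2)\<^sup>2) / 2 - z $ 1 - o2 * z $ 2) / ee"
    obtain c where c: "Z1 c = z $ 1" "Z2 c = z $ 2" "c gen_c = t"
      using coords_surj by blast
    have et: "ee * t = - ((z $ 1)\<^sup>2 + (z $ 2)\<^sup>2) / 2 - z $ 1 - o2 * z $ 2"
      using coords_pos by (simp add: t_def)
    have "quad A c + 2 * sum c UNIV = 0"
      unfolding quad sum_coords c et by (simp add: field_simps)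
    moreover have "\<pi> c = z"
      by (simp add: \<pi>_def c vec_eq_iff forall_2)
    ultimately show ?thesis by blast
  qed
  show ?thesis
  proof (rule quasi_isometric_model[where \<pi> = \<pi> and \<epsilon> = \<eta> and R = R' and N = "R'\<^sup>2 / 2", OF C U])
    fix c assume "c \<in> {c. quad A c + 2 * sum c UNIV = 0 \<and> \<pi> c \<in> UNIV}"
      and near: "dist (\<pi> (\<lambda>_. 0)) (\<pi> c) \<le> R'"
    then have "(\<delta> c)\<^sup>2 \<le> R'\<^sup>2" "quad A c = - 2 * sum c UNIV"
      using \<delta>_nonneg[of c] by (auto simp: \<delta> intro: power_mono)
    then show "- sum c UNIV \<le> R'\<^sup>2 / 2"
      by (simp add: \<delta>_sq)
  next
    fix z :: "real^2"
    show "\<exists>c\<in>{c. quad A c + 2 * sum c UNIV = 0 \<and> \<pi> c \<in> UNIV}. \<pi> c = z"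
      using surj[of z] by simp
  next
    fix c assume "c \<in> {c. quad A c + 2 * sum c UNIV = 0 \<and> \<pi> c \<in> UNIV}" "R' < dist (\<pi> (\<lambda>_. 0)) (\<pi> c)"
    then show "\<exists>i. wall A c i < 0 \<and> dist (\<pi> (\<lambda>_. 0)) (\<pi> (reflect A i c)) \<le> dist (\<pi> (\<lambda>_. 0)) (\<pi> c) - \<eta>"
      using desc[of c] by (simp add: \<delta>)
  next
    show "0 \<le> R'"
      using R' L by linarith
  qed (auto simp: dist_commute dist_eq quad_reflect_diff quad_reflect_potential coords_zero \<eta> intro: dist_triangle)
qed

section \<open>The hyperbolic case\<close>

lemma hyperbolic:
  assumes \<Delta>: "\<Delta> < 0"
    and C: "C \<in> quandle_components cq.Q"
    and U: "U \<subseteq> carrier (Dis cq.Q)" "finite U" "generate (Dis cq.Q) U = carrier (Dis cq.Q)"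
  shows "quasi_isometric C (dis_metric cq.Q U) hyp_plane hyp_dist"
proof -
  let ?o = "\<lambda>_::tri_gen. 0::real"
  have \<kappa>: "\<kappa> < 0"
    using \<Delta> cs(7) by (simp add: \<kappa>_def divide_neg_pos)
  define \<tau> where "\<tau> = sqrt (- \<kappa>)"
  have \<tau>: "0 < \<tau>" "\<tau>\<^sup>2 = - \<kappa>"
    using \<kappa> by (auto simp: \<tau>_def)
  define N where "N = (ee / \<tau>)\<^sup>2 - 1 - o2\<^sup>2"
  \<comment> \<open>The centre of the inscribed circle is \<open>(1, o2, ee / \<tau>) / sqrt N\<close>: this vector has the same
    product with the three unit normals of the walls.\<close>
  have N: "0 < N"
  proof -
    have kk: "kk \<le> o2"
      unfolding kk_def o2_def using cs mult_mono[of ca 1 cc 1] mult_left_mono[of cc 1 ca]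
      by (intro divide_right_mono) auto
    \<comment> \<open>The expansion below contains \<open>o2\<^sup>2\<close> minus the square of
      this number, the one term whose sign is not evident.\<close>
    have ob: "\<bar>cc * o2 - kk\<bar> \<le> o2"
    proof -
      have "cc * o2 \<le> 1 * o2" "0 \<le> cc * o2"
        using cs coords_pos by (intro mult_right_mono mult_nonneg_nonneg; simp)+
      then show ?thesis
        using kk coords_pos(2) by (simp add: abs_le_iff)
    qed
    have "\<tau>\<^sup>2 = kk\<^sup>2 + cc\<^sup>2 - 1"
      using \<kappa>_eq \<tau>(2) by simp
    then have "ee\<^sup>2 - \<tau>\<^sup>2 * (1 + o2\<^sup>2) = (1 + cc + kk * o2)\<^sup>2 - (kk\<^sup>2 + cc\<^sup>2 - 1) * (1 + o2\<^sup>2)"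
      by (simp add: ee_def)
    also have "\<dots> = 2 + 2 * cc + 2 * (kk * o2) + (o2\<^sup>2 - (cc * o2 - kk)\<^sup>2)"
      by (simp add: power2_eq_square algebra_simps)
    also have "\<dots> > 0"
    proof -
      have "(cc * o2 - kk)\<^sup>2 \<le> o2\<^sup>2"
        using power_mono[OF ob, of 2] by simp
      then show ?thesis
        using cs coords_pos mult_nonneg_nonneg[of kk o2] by linarith
    qed
    finally have "0 < (ee\<^sup>2 - \<tau>\<^sup>2 * (1 + o2\<^sup>2)) / \<tau>\<^sup>2"
      using \<tau>(1) by simp
    also have "\<dots> = N"
      using \<tau>(1) by (simp add: N_def power_divide diff_divide_distrib)
    finally show ?thesis .
  qed
  define n where "n = sqrt N"
  have n: "0 < n" "n\<^sup>2 = N"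
    using N by (auto simp: n_def)
  \<comment> \<open>The vector \<open>o + \<Sum>\<^sub>i c\<^sub>i n\<^sub>i\<close> divided by its
    length \<open>n\<close>; the last coordinate is negated so that the base point lies on the upper
    sheet.\<close>
  define \<pi> where "\<pi> c = ((1 + Z1 c) / n, (o2 + Z2 c) / n, (ee / \<tau> - \<tau> * c gen_c) / n)" for c
  have mink_\<pi>: "mink (\<pi> c) (\<pi> d) = 1 + (quad A (c - d) - (quad A c + 2 * sum c UNIV) - (quad A d + 2 * sum d UNIV)) / (2 * N)" for c d
  proof -
    have \<tau>1: "\<tau> * (ee / \<tau>) = ee"
      using \<tau> by simp
    have "mink (\<pi> c) (\<pi> d) = ((ee / \<tau> - \<tau> * c gen_c) * (ee / \<tau> - \<tau> * d gen_c)
      - (1 + Z1 c) * (1 + Z1 d) - (o2 + Z2 c) * (o2 + Z2 d)) / n\<^sup>2"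
      unfolding \<pi>_def mink.simps times_divide_times_eq power2_eq_square
      by (simp only: diff_divide_distrib)
    also have "(ee / \<tau> - \<tau> * c gen_c) * (ee / \<tau> - \<tau> * d gen_c)
      = (ee / \<tau>)\<^sup>2 - \<tau> * (ee / \<tau>) * (c gen_c + d gen_c) + \<tau>\<^sup>2 * c gen_c * d gen_c"
      by (simp only: power2_eq_square) (simp only: algebra_simps)
    also have "\<dots> - (1 + Z1 c) * (1 + Z1 d) - (o2 + Z2 c) * (o2 + Z2 d)
      = N + (quad A (c - d) - (quad A c + 2 * sum c UNIV) - (quad A d + 2 * sum d UNIV)) / 2"
      unfolding \<tau>1 \<tau>(2) N_def quad_gram sum_coords coords_diff
      by (simp add: power2_eq_square field_simps)
    finally show ?thesis
      using N by (simp add: n(2) add_divide_distrib)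
  qed
  define M where "M = {c. quad A c + 2 * sum c UNIV = 0 \<and> \<pi> c \<in> hyp_plane}"
  have mink_M: "mink (\<pi> c) (\<pi> d) = 1 + quad A (c - d) / (2 * N)" if "c \<in> M" "d \<in> M" for c d
    using that by (simp add: mink_\<pi> M_def)
  have M0: "?o \<in> M"
  proof -
    have "mink (\<pi> ?o) (\<pi> ?o) = 1"
      by (simp add: mink_\<pi> coords_zero fun_diff_def)
    moreover have "0 < snd (snd (\<pi> ?o))"
      using coords_pos \<tau> n by (simp add: \<pi>_def)
    ultimately have "\<pi> ?o \<in> hyp_plane"
      by (cases "\<pi> ?o") (simp add: hyp_plane_def)
    then show ?thesis
      by (simp add: M_def coords_zero)
  qed
  have M_reflect: "reflect A i c \<in> M" if "c \<in> M" for c i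
  proof -
    have q: "quad A (reflect A i c) + 2 * sum (reflect A i c) UNIV = 0"
      using that quad_reflect_potential by (simp add: M_def)
    \<comment> \<open>The two points differ by a multiple of one unit normal, so their product is at
      least 1 and the reflection keeps the sheet.\<close>
    have "c - reflect A i c = (?o)(i := ?o i + 2 * wall A c i)"
      by (auto simp: reflect_def)
    then have "quad A (c - reflect A i c) = (2 * wall A c i)\<^sup>2"
      using quad_fun_upd[of A ?o i "2 * wall A c i"] tri_gram_sym[of p q r]
      by (simp add: coords_zero)
    then have "mink (\<pi> c) (\<pi> (reflect A i c)) = 1 + (2 * wall A c i)\<^sup>2 / (2 * N)"
      using that q by (simp add: mink_\<pi> M_def)
    then have "0 < mink (\<pi> c) (\<pi> (reflect A i c))"
      using N by (simp add: add_pos_nonneg)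
    moreover have "mink (\<pi> (reflect A i c)) (\<pi> (reflect A i c)) = 1"
      using q by (simp add: mink_\<pi> coords_zero fun_diff_def)
    ultimately show ?thesis
      using hyp_plane_same_sheet[of "\<pi> c"] that q by (simp add: M_def)
  qed
  define \<delta> where "\<delta> c = hyp_dist (\<pi> ?o) (\<pi> c)" for c
  have cosh_\<delta>: "cosh (\<delta> c) = 1 - sum c UNIV / N" and \<delta>_nonneg: "0 \<le> \<delta> c" if "c \<in> M" for c
  proof -
    have "1 \<le> mink (\<pi> ?o) (\<pi> c)"
      using mink_ge_1 M0 that by (simp add: M_def)
    moreover have "quad A (?o - c) = - 2 * sum c UNIV"
      using that by (simp add: M_def quad_def fun_diff_def sum_negf)
    ultimately show "cosh (\<delta> c) = 1 - sum c UNIV / N" "0 \<le> \<delta> c"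
      using mink_M[OF M0 that] N by (auto simp: \<delta>_def hyp_dist_def)
  qed
  obtain \<epsilon> R where wall_neg': "0 < \<epsilon>" "0 \<le> R"
    "\<And>c k. quad A c + 2 * sum c UNIV = 0 \<Longrightarrow> R < \<bar>wall A c k\<bar> \<Longrightarrow> \<exists>i. wall A c i \<le> - \<epsilon> * \<bar>wall A c k\<bar>"
    using wall_neg by meson
  define T where "T i = (\<Sum>j\<in>UNIV. tri_adj i j)" for i
  have T: "0 < T i" for i
    unfolding T_def by (rule sum_pos2[of _ i]) (use tri_adj_nonneg tri_adj_pos in auto)
  \<comment> \<open>The adjugate applied to \<open>A c\<close>, which is the vector of heights minus
    1, and summed up: a large coefficient sum forces a large height.\<close>
  have \<Delta>_sum: "\<Delta> * sum c UNIV = (\<Sum>i\<in>UNIV. T i * (wall A c i - 1))" for c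
    unfolding T_def wall_def sum_tri_gen tri_adj_values gram_values tri_gram_diag \<Delta>_def
    by (simp add: power2_eq_square algebra_simps)
  define L where "L = (\<Sum>i\<in>UNIV. T i) / (- \<Delta>)"
  have L: "0 < L"
    unfolding L_def using \<Delta> T by (intro divide_pos_pos sum_pos) auto
  have large: "\<exists>k. - sum c UNIV \<le> L * \<bar>wall A c k - 1\<bar>" for c
  proof -
    define t where "t = Max (range (\<lambda>k. \<bar>wall A c k - 1\<bar>))"
    have t: "\<bar>wall A c k - 1\<bar> \<le> t" for k
      by (simp add: t_def)
    have "t \<in> range (\<lambda>k. \<bar>wall A c k - 1\<bar>)"
      unfolding t_def by (rule Max_in) auto
    then obtain k where k: "t = \<bar>wall A c k - 1\<bar>" by auto
    have "\<Delta> * sum c UNIV \<le> (\<Sum>i\<in>UNIV. T i * t)"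
      unfolding \<Delta>_sum using t T by (intro sum_mono mult_left_mono) (auto intro: less_imp_le abs_le_D1)
    then have "(- \<Delta>) * (- sum c UNIV) \<le> (\<Sum>i\<in>UNIV. T i) * t"
      by (simp add: sum_distrib_right)
    then have "- sum c UNIV \<le> (\<Sum>i\<in>UNIV. T i) * t / (- \<Delta>)"
      using \<Delta> by (subst pos_le_divide_eq) (auto simp: mult.commute)
    then show ?thesis
      by (intro exI[of _ k]) (simp add: L_def k)
  qed
  define \<eta> where "\<eta> = min (1 / 2) (\<epsilon> / L)"
  have \<eta>: "\<eta> \<le> 1 / 2" "\<eta> \<le> \<epsilon> / L"
    unfolding \<eta>_def by (rule min.cobounded1, rule min.cobounded2)
  have \<eta>_pos: "0 < \<eta>"
    using L wall_neg'(1) by (simp add: \<eta>_def)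
  \<comment> \<open>Half of the gain \<eta> is given up: \<open>cosh (\<delta> c)\<close> is
    \<open>1 + w / N\<close> with \<open>w\<close> the negated coefficient sum, and only
    \<open>w / N\<close> shrinks by the factor \<open>1 - \<eta>\<close>. The whole still shrinks by
    \<open>1 - \<eta> / 2\<close> once \<open>w\<close> is at least \<open>N\<close>.\<close>
  define \<epsilon>' where "\<epsilon>' = - ln (1 - \<eta> / 2)"
  have eps': "0 < \<epsilon>'" "exp (- \<epsilon>') = 1 - \<eta> / 2"
    using \<eta>(1) \<eta>_pos by (auto simp: \<epsilon>'_def)
  \<comment> \<open>\<open>N\<close> is for the loss just described; the other two bounds act as in
    the Euclidean case, with \<open>w\<close> in place of the distance.\<close>
  define w0 where "w0 = max N (max (2 * L) (2 * L * R))"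
  have w0: "N \<le> w0" "2 * L \<le> w0" "2 * L * R \<le> w0"
    by (auto simp: w0_def)
  define R' where "R' = max \<epsilon>' (arcosh (1 + w0 / N))"
  have R': "\<epsilon>' \<le> R'" "arcosh (1 + w0 / N) \<le> R'"
    by (auto simp: R'_def)
  have desc: "\<exists>i. wall A c i < 0 \<and> \<delta> (reflect A i c) \<le> \<delta> c - \<epsilon>'"
    if c: "c \<in> M" and far: "R' < \<delta> c" for c
  proof -
    define w where "w = - sum c UNIV"
    have ge1: "1 \<le> 1 + w0 / N"
      using w0(1) N by simp
    have "0 \<le> arcosh (1 + w0 / N)"
      using ge1 by simp
    then have "cosh (arcosh (1 + w0 / N)) < cosh (\<delta> c)"
      using far R'(2) by (subst cosh_real_nonneg_less_iff) auto
    then have "1 + w0 / N < 1 + w / N"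
      using ge1 cosh_\<delta>[OF c] by (simp add: w_def)
    then have w: "w0 < w"
      using N by (simp add: divide_less_cancel)
    obtain k where k: "w \<le> L * \<bar>wall A c k - 1\<bar>"
      using large by (auto simp: w_def)
    have "L * \<bar>wall A c k - 1\<bar> \<le> L * (\<bar>wall A c k\<bar> + 1)"
      using L by (intro mult_left_mono) auto
    then have "w \<le> L * \<bar>wall A c k\<bar> + L"
      using k by (simp add: distrib_left)
    then have Lk: "w \<le> 2 * L * \<bar>wall A c k\<bar>"
      using w w0(2) by linarith
    then have "2 * L * R < 2 * L * \<bar>wall A c k\<bar>"
      using w w0(3) by linarith
    then have "R < \<bar>wall A c k\<bar>"
      using L by (simp add: mult_less_cancel_left)
    then obtain i where i: "wall A c i \<le> - \<epsilon> * \<bar>wall A c k\<bar>"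
      using wall_neg'(3)[of c] c by (auto simp: M_def)
    have wpos: "0 < w"
      using w w0(1) N by linarith
    have "\<eta> * w \<le> \<epsilon> / L * w"
      using \<eta>(2) wpos by (intro mult_right_mono) auto
    also have "\<dots> \<le> \<epsilon> / L * (2 * L * \<bar>wall A c k\<bar>)"
      using Lk L wall_neg'(1) by (intro mult_left_mono) auto
    also have "\<dots> = 2 * (\<epsilon> * \<bar>wall A c k\<bar>)"
      using L by simp
    finally have i2: "2 * wall A c i \<le> - (\<eta> * w)"
      using i by simp
    have neg: "wall A c i < 0"
      using i2 mult_pos_pos[OF \<eta>_pos wpos] by linarith
    have "cosh (\<delta> (reflect A i c)) = 1 + (w + 2 * wall A c i) / N"
      using cosh_\<delta>[OF M_reflect[OF c], of i] by (simp add: sum_reflect w_def diff_divide_distrib add_divide_distrib)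
    also have "\<dots> \<le> 1 + (1 - \<eta>) * w / N"
      using i2 N by (intro add_left_mono divide_right_mono) (auto simp: algebra_simps)
    also have "\<dots> \<le> (1 - \<eta> / 2) * (1 + w / N)"
    proof -
      have "\<eta> / 2 * 1 \<le> \<eta> / 2 * (w / N)"
        using w w0(1) N \<eta>_pos by (intro mult_left_mono) auto
      then show ?thesis
        by (simp add: algebra_simps add_divide_distrib diff_divide_distrib)
    qed
    also have "\<dots> = exp (- \<epsilon>') * cosh (\<delta> c)"
      using eps'(2) cosh_\<delta>[OF c] by (simp add: w_def)
    also have "\<dots> \<le> cosh (\<delta> c - \<epsilon>')"
      using eps'(1) by (intro cosh_diff_ge) auto
    finally have "cosh (\<delta> (reflect A i c)) \<le> cosh (\<delta> c - \<epsilon>')" .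
    then have "\<delta> (reflect A i c) \<le> \<delta> c - \<epsilon>'"
      using \<delta>_nonneg[OF M_reflect[OF c]] far R'(1) by (subst (asm) cosh_real_nonneg_le_iff) auto
    with neg show ?thesis by blast
  qed
  have surj: "\<exists>c\<in>M. \<pi> c = z" if z: "z \<in> hyp_plane" for z
  proof -
    obtain x y t where xyt: "z = (x, y, t)"
      by (metis prod_cases3)
    obtain c where c: "Z1 c = n * x - 1" "Z2 c = n * y - o2" "c gen_c = (ee / \<tau> - n * t) / \<tau>"
      using coords_surj by blast
    have \<pi>c: "\<pi> c = z"
      using \<tau>(1) n(1) by (simp add: \<pi>_def c xyt)
    have "mink (\<pi> c) (\<pi> c) = 1"
      using z by (auto simp: \<pi>c hyp_plane_def)
    then have "quad A c + 2 * sum c UNIV = 0"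
      using N by (simp add: mink_\<pi> coords_zero fun_diff_def)
    then show ?thesis
      using \<pi>c z by (auto simp: M_def)
  qed
  interpret H: Metric_space hyp_plane "\<lambda>u v. if u \<in> hyp_plane \<and> v \<in> hyp_plane then hyp_dist u v else 0"
    by (rule Metric_space_hyp_plane)
  show ?thesis
  proof (rule quasi_isometric_model[where P = hyp_plane and \<pi> = \<pi> and \<epsilon> = \<epsilon>' and R = R' and N = "N * cosh R'", OF C U, folded M_def])
    fix x y z assume xyz: "x \<in> hyp_plane" "y \<in> hyp_plane" "z \<in> hyp_plane"
    then show "hyp_dist x z \<le> hyp_dist x y + hyp_dist y z"
      using H.triangle[of x y z] by simp
  next
    fix x assume "x \<in> hyp_plane"
    then show "hyp_dist x x = 0"
      using H.mdist_zero[of x] by simp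
  next
    fix x y assume "x \<in> hyp_plane" "y \<in> hyp_plane"
    then show "hyp_dist x y = hyp_dist y x" "0 \<le> hyp_dist x y"
      using mink_ge_1[of x y] by (auto simp: hyp_dist_def mink_commute[of x y])
  next
    fix c d :: "tri_gen \<Rightarrow> real" and i assume c: "c \<in> M" "d \<in> M"
    show "hyp_dist (\<pi> (reflect A i c)) (\<pi> (reflect A i d)) = hyp_dist (\<pi> c) (\<pi> d)"
      using mink_M[OF c] mink_M[OF M_reflect[OF c(1)] M_reflect[OF c(2)], of i i]
      by (simp add: hyp_dist_def quad_reflect_diff)
  next
    fix c assume c: "c \<in> M" and "hyp_dist (\<pi> ?o) (\<pi> c) \<le> R'"
    then have "cosh (\<delta> c) \<le> cosh R'"
      using \<delta>_nonneg[OF c] by (subst cosh_real_nonneg_le_iff) (auto simp: \<delta>_def)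
    then show "- sum c UNIV \<le> N * cosh R'"
      using cosh_\<delta>[OF c] N by (simp add: field_simps)
  next
    fix c assume "c \<in> M" "R' < hyp_dist (\<pi> ?o) (\<pi> c)"
    then show "\<exists>i. wall A c i < 0 \<and> hyp_dist (\<pi> ?o) (\<pi> (reflect A i c)) \<le> hyp_dist (\<pi> ?o) (\<pi> c) - \<epsilon>'"
      using desc[of c] by (simp add: \<delta>_def)
  next
    show "0 < \<epsilon>'" "0 \<le> R'"
      using eps'(1) R'(1) by auto
  qed (use M0 M_reflect surj in auto)
qed

end

theorem proposition5p4:
  fixes p q r :: nat
  assumes "p \<ge> 2" and "q \<ge> 2" and "r \<ge> 2"
    and G: "G = tri_group_pos p q r"
    and a: "a = tri_elem p q r gen_a"
    and \<sigma>: "\<sigma> = (\<lambda>g. inv\<^bsub>G\<^esub> a \<otimes>\<^bsub>G\<^esub> g \<otimes>\<^bsub>G\<^esub> a)"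
    and Q: "Q = GAlex G \<sigma>"
  shows "(\<exists>H. subgroup H G \<and> finite (rcosets\<^bsub>G\<^esub> H) \<and> Dis Q \<cong> G\<lparr>carrier := H\<rparr>) \<and>
    (1 / real p + 1 / real q + 1 / real r > 1 \<longrightarrow> finite (carrier Q)) \<and>
    (1 / real p + 1 / real q + 1 / real r = 1 \<longrightarrow>
      (\<forall>C \<in> quandle_components Q. \<forall>U. U \<subseteq> carrier (Dis Q) \<and> finite U \<and>
        generate (Dis Q) U = carrier (Dis Q) \<longrightarrow>
        quasi_isometric C (dis_metric Q U) (UNIV :: (real^2) set) dist)) \<and>
    (1 / real p + 1 / real q + 1 / real r < 1 \<longrightarrow>
      (\<forall>C \<in> quandle_components Q. \<forall>U. U \<subseteq> carrier (Dis Q) \<and> finite U \<and>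
        generate (Dis Q) U = carrier (Dis Q) \<longrightarrow>
        quasi_isometric C (dis_metric Q U) hyp_plane hyp_dist))"
proof -
  interpret triangle_group p q r
    by unfold_locales fact+
  have Q_eq: "Q = cq.Q"
    unfolding Q \<sigma> a G by (simp add: cq.Q_def)
  have "\<Delta> > 0" if "1 / real p + 1 / real q + 1 / real r > 1"
    using \<Delta>_sgn that by (simp add: sgn_if split: if_splits)
  moreover have "\<Delta> = 0" if "1 / real p + 1 / real q + 1 / real r = 1"
    using \<Delta>_sgn that by (simp add: sgn_if split: if_splits)
  moreover have "\<Delta> < 0" if "1 / real p + 1 / real q + 1 / real r < 1"
    using \<Delta>_sgn that by (simp add: sgn_if split: if_splits)
  moreover have "subgroup cq.H G \<and> finite (rcosets\<^bsub>G\<^esub> cq.H) \<and> Dis Q \<cong> G\<lparr>carrier := cq.H\<rparr>"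
    unfolding Q_eq G using cq.H.subgroup_axioms finite_rcosets cq.Dis_iso by blast
  ultimately show ?thesis
    unfolding Q_eq using finite_spherical euclidean hyperbolic by auto
qed

end
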